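(* Let $a,b,c\in i\mathbb{R}$ be purely imaginary numbers and let $$Z^{abc}(s)=\prod_{p\text{ prime}}\left(1-(p^a+p^b)p^{-s}+p^{c-2s}\right)^{-1},$$ an Euler product converging absolutely for $\operatorname{Re}(s)>1$. If $Z^{abc}(s)$ has a meromorphic continuation to all $s\in\mathbb{C}$, then $a+b=c$ and $$Z^{abc}(s)=\zeta(s-a)\zeta(s-b),$$ where $\zeta$ is the Riemann zeta function.
   Context: For $p$ prime and $z\in\mathbb{C}$, $p^{z}=e^{z\log p}$. "Meromorphic in all $s\in\mathbb{C}$" means that the function defined by the Euler product on $\operatorname{Re}(s)>1$ extends to a meromorphic function on the whole complex plane. *)

theory Defs
  imports "HOL-Complex_Analysis.Complex_Analysis" "HOL-Computational_Algebra.Primes"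
begin

text \<open>
  The Riemann zeta function is the analytic continuation of the Dirichlet series to the complex
  plane without the pole at \<open>1\<close>; at the pole itself it is given the dummy value \<open>0\<close>. Existence and
  uniqueness of this continuation is theorem \<open>ex1_riemann_zeta\<close> below.
\<close>
definition is_riemann_zeta :: "(complex \<Rightarrow> complex) \<Rightarrow> bool" where
  "is_riemann_zeta f \<longleftrightarrow> f holomorphic_on (-{1}) \<and> f 1 = 0 \<and>
     (\<forall>s. Re s > 1 \<longrightarrow> (\<lambda>n. of_nat (Suc n) powr (-s)) sums f s)"

definition riemann_zeta :: "complex \<Rightarrow> complex" where
  "riemann_zeta = (THE f. is_riemann_zeta f)"

definition local_factor :: "complex \<Rightarrow> complex \<Rightarrow> complex \<Rightarrow> nat \<Rightarrow> complex \<Rightarrow> complex" where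
  "local_factor a b c p s =
     inverse (1 - (of_nat p powr a + of_nat p powr b) * of_nat p powr (-s) + of_nat p powr (c - 2 * s))"

text \<open>
  The product over all primes is written as a product over all natural numbers whose factors at
  non-primes are \<open>1\<close>; it converges absolutely for \<open>Re s > 1\<close>, see \<open>abs_convergent_euler_Z\<close> below.
  If the denominator of the factor at a prime vanishes at \<open>s\<close> (which may happen for \<open>p = 2\<close> even
  when \<open>Re s > 1\<close>), then \<open>s\<close> is a pole, where the value here is \<open>0\<close> because \<open>inverse 0 = 0\<close>.
\<close>
definition euler_Z :: "complex \<Rightarrow> complex \<Rightarrow> complex \<Rightarrow> complex \<Rightarrow> complex" where
  "euler_Z a b c s = (\<Prod>p. if prime p then local_factor a b c p s else 1)"

subsection \<open>Absolute convergence of the Euler product\<close>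

lemma norm_nat_powr: "n > 0 \<Longrightarrow> norm (of_nat n powr z :: complex) = real n powr Re z"
  by (subst norm_powr_real_powr) auto

lemma abs_convergent_euler_Z:
  assumes "Re a = 0" "Re b = 0" "Re c = 0" "Re s > 1"
  shows "abs_convergent_prod (\<lambda>p. if prime p then local_factor a b c p s else 1)"
proof (rule summable_imp_abs_convergent_prod)
  define D where "D = (\<lambda>p::nat. (of_nat p powr a + of_nat p powr b) * of_nat p powr (-s) 
    - of_nat p powr (c - 2 * s) :: complex)"
  have summ: "summable (\<lambda>p. 6 * real p powr (-Re s))"
    using assms by (intro summable_mult) (simp add: summable_real_powr_iff)
  have Dle: "norm (D p) \<le> 3 * real p powr (-Re s)" if "p > 0" for p
  proof -
    have p: "real p \<ge> 1" using that by linarith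
    have "norm (of_nat p powr a + of_nat p powr b :: complex) \<le> 1 + 1"
      using that assms by (intro norm_triangle_le) (simp add: norm_nat_powr)
    hence 1: "norm ((of_nat p powr a + of_nat p powr b) * of_nat p powr (-s) :: complex)
      \<le> 2 * real p powr (-Re s)"
      using that by (subst norm_mult) (auto intro!: mult_mono simp: norm_nat_powr)
    have 2: "norm (of_nat p powr (c - 2 * s) :: complex) \<le> real p powr (-Re s)"
      using that assms p by (subst norm_nat_powr) (auto intro!: powr_mono)
    show ?thesis unfolding D_def using norm_triangle_ineq4 1 2
      by (smt (verit, best))
  qed
  have "(\<lambda>p::nat. 6 * real p powr (-Re s)) \<longlonglongrightarrow> 0"
    using summ by (rule summable_LIMSEQ_zero)
  hence ev: "eventually (\<lambda>p::nat. 6 * real p powr (-Re s) < 1) sequentially"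
    by (rule order_tendstoD) auto
  show "summable (\<lambda>p. norm ((if prime p then local_factor a b c p s else 1) - 1))"
  proof (rule summable_comparison_test_ev[OF _ summ])
    show "eventually (\<lambda>p. norm (norm ((if prime p then local_factor a b c p s else 1) - 1))
            \<le> 6 * real p powr (-Re s)) sequentially"
      using ev eventually_gt_at_top[of 0]
    proof eventually_elim
      case (elim p)
      have half: "norm (D p) \<le> 1/2" using Dle[of p] elim by simp
      hence "norm (1 - D p) \<ge> 1/2" 
        using norm_triangle_ineq2[of 1 "D p"] by simp
      hence pos: "norm (1 - D p) > 0" and ge: "1 / norm (1 - D p) \<le> 2"
        by (auto intro: less_le_trans[of 0 "1/2"] simp del: zero_less_norm_iff simp: divide_simps)
      have nz: "1 - D p \<noteq> 0" using pos by auto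
      have "local_factor a b c p s - 1 = D p / (1 - D p)"
        using nz unfolding local_factor_def D_def by (simp add: field_simps)
      hence "norm (local_factor a b c p s - 1) = norm (D p) * (1 / norm (1 - D p))"
        by (simp add: norm_divide)
      also have "\<dots> \<le> norm (D p) * 2" using ge by (intro mult_left_mono) auto
      also have "\<dots> \<le> 6 * real p powr (-Re s)" using Dle[of p] elim by simp
      finally show ?case by auto
    qed
  qed
qed

subsection \<open>Existence and uniqueness of the zeta function\<close>

definition zeta_fall :: "nat \<Rightarrow> complex \<Rightarrow> complex" where
  "zeta_fall i s = (\<Prod>j<i. 1 - s - of_nat j)"

text \<open>Remainder in the Taylor expansion of \<open>x powr (1 - s)\<close> from \<open>n + 1\<close> to \<open>n + 2\<close>\<close>
definition zeta_rem :: "nat \<Rightarrow> nat \<Rightarrow> complex \<Rightarrow> complex" where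
  "zeta_rem K n s = of_nat (Suc (Suc n)) powr (1 - s) -
     (\<Sum>i\<le>K. zeta_fall i s / fact i * of_nat (Suc n) powr (1 - s - of_nat i))"

lemma holomorphic_zeta_fall [holomorphic_intros]:
  "f holomorphic_on A \<Longrightarrow> (\<lambda>s. zeta_fall i (f s)) holomorphic_on A"
  unfolding zeta_fall_def by (intro holomorphic_intros)

lemma zeta_rem_bound:
  assumes "Re s > - real K"
  shows "norm (zeta_rem K n s) \<le> norm (zeta_fall (Suc K) s) * real (Suc n) powr (-Re s - real K)"
proof -
  define S where "S = complex_of_real ` {real (Suc n)..real (Suc (Suc n))}"
  define f where "f = (\<lambda>i x. zeta_fall i s * x powr (1 - s - of_nat i))"
  have conv: "convex S" unfolding S_def 
    by (intro convex_linear_image) (auto intro!: bounded_linear.linear bounded_linear_of_real)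
  have deriv: "(f i has_field_derivative f (Suc i) x) (at x within S)" if "x \<in> S" for i x
  proof -
    have "x \<notin> \<real>\<^sub>\<le>\<^sub>0" using that by (auto simp: S_def complex_nonpos_Reals_iff)
    hence "((\<lambda>z. z powr (1 - s - of_nat i)) has_field_derivative 
            (1 - s - of_nat i) * x powr (1 - s - of_nat i - 1)) (at x within S)"
      by (rule has_field_derivative_at_within[OF has_field_derivative_powr])
    hence "(f i has_field_derivative zeta_fall i s * 
            ((1 - s - of_nat i) * x powr (1 - s - of_nat i - 1))) (at x within S)"
      unfolding f_def by (rule DERIV_cmult)
    thus ?thesis by (simp add: f_def zeta_fall_def algebra_simps)
  qed
  have bd: "norm (f (Suc K) x) \<le> norm (zeta_fall (Suc K) s) * real (Suc n) powr (-Re s - real K)"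
    if xS: "x \<in> S" for x
  proof -
    obtain t where "t \<in> {real (Suc n)..real (Suc (Suc n))}" and x: "x = of_real t"
      using xS unfolding S_def by blast
    hence t: "x = of_real t" "t \<ge> real (Suc n)" by auto
    have "norm (x powr (1 - s - of_nat (Suc K))) = t powr (-Re s - real K)"
      using t by (subst norm_powr_real_powr) auto
    also have "\<dots> \<le> real (Suc n) powr (-Re s - real K)"
      using t assms by (intro powr_mono2') auto
    finally show ?thesis unfolding f_def norm_mult by (intro mult_left_mono) auto
  qed
  have w: "of_nat (Suc n) \<in> S" 
    unfolding S_def by (rule image_eqI[of _ _ "real (Suc n)"]) auto
  have z: "of_nat (Suc (Suc n)) \<in> S" 
    unfolding S_def by (rule image_eqI[of _ _ "real (Suc (Suc n))"]) auto
  have "norm (f 0 (of_nat (Suc (Suc n))) - (\<Sum>i\<le>K. f i (of_nat (Suc n)) * 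
           (of_nat (Suc (Suc n)) - of_nat (Suc n)) ^ i / fact i))
        \<le> norm (zeta_fall (Suc K) s) * real (Suc n) powr (-Re s - real K) *
           norm (of_nat (Suc (Suc n)) - of_nat (Suc n) :: complex) ^ Suc K / fact K"
    by (rule complex_Taylor[OF conv deriv bd w z])
  also have "\<dots> = norm (zeta_fall (Suc K) s) * real (Suc n) powr (-Re s - real K) / fact K"
    by simp
  also have "\<dots> \<le> norm (zeta_fall (Suc K) s) * real (Suc n) powr (-Re s - real K) / 1"
    by (intro divide_left_mono) auto
  also have "f 0 (of_nat (Suc (Suc n))) - (\<Sum>i\<le>K. f i (of_nat (Suc n)) * 
           (of_nat (Suc (Suc n)) - of_nat (Suc n)) ^ i / fact i) = zeta_rem K n s"
    by (simp add: f_def zeta_rem_def zeta_fall_def)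
  finally show ?thesis by simp
qed

lemma summable_Suc_powr: "x < -1 \<Longrightarrow> summable (\<lambda>n. real (Suc n) powr x)"
  by (subst summable_Suc_iff[of "\<lambda>n. real n powr x"]) (simp add: summable_real_powr_iff)

lemma open_Re_gt: "open {s. Re s > x}"
  by (rule open_halfspace_Re_gt)

lemma zeta_rem_sum_holomorphic:
  "(\<lambda>s. \<Sum>n. zeta_rem K n s) holomorphic_on {s. Re s > 1 - real K}"
proof (rule holomorphic_uniform_sequence[OF open_Re_gt])
  fix N :: nat
  show "(\<lambda>s. \<Sum>n<N. zeta_rem K n s) holomorphic_on {s. Re s > 1 - real K}"
    unfolding zeta_rem_def by (intro holomorphic_intros) auto
next
  fix x assume x: "x \<in> {s. Re s > 1 - real K}"
  then obtain d where d: "d > 0" "cball x d \<subseteq> {s. Re s > 1 - real K}"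
    using open_contains_cball open_Re_gt by blast
  have "compact ((\<lambda>s. zeta_fall (Suc K) s) ` cball x d)"
    by (intro compact_continuous_image holomorphic_on_imp_continuous_on holomorphic_intros) auto
  then obtain B where B: "\<And>s. s \<in> cball x d \<Longrightarrow> norm (zeta_fall (Suc K) s) \<le> B"
    by (meson compact_imp_bounded bounded_iff imageI)
  define \<sigma> where "\<sigma> = Re x - d"
  have "x - of_real d \<in> cball x d" using d by (simp add: dist_norm)
  hence \<sigma>: "\<sigma> > 1 - real K" using d(2) unfolding \<sigma>_def by fastforce
  have le: "norm (zeta_rem K n s) \<le> B * real (Suc n) powr (-\<sigma> - real K)" if s: "s \<in> cball x d" for n s
  proof -
    have "Re x - Re s \<le> d" using s abs_Re_le_cmod[of "x - s"] by (simp add: dist_norm)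
    hence "Re s \<ge> \<sigma>" by (simp add: \<sigma>_def)
    hence "real (Suc n) powr (-Re s - real K) \<le> real (Suc n) powr (-\<sigma> - real K)"
      by (intro powr_mono) auto
    moreover have "norm (zeta_rem K n s) \<le> 
        norm (zeta_fall (Suc K) s) * real (Suc n) powr (-Re s - real K)"
      using \<open>Re s \<ge> \<sigma>\<close> \<sigma> by (intro zeta_rem_bound) auto
    moreover have "norm (zeta_fall (Suc K) s) * real (Suc n) powr (-Re s - real K) \<le>
       B * real (Suc n) powr (-\<sigma> - real K)"
      using B[OF s] calculation(1) by (intro mult_mono) (auto intro: order_trans[OF norm_ge_zero])
    ultimately show ?thesis by linarith
  qed
  have "uniform_limit (cball x d) (\<lambda>N s. \<Sum>n<N. zeta_rem K n s) (\<lambda>s. \<Sum>n. zeta_rem K n s) sequentially"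
    using le \<sigma> by (intro Weierstrass_m_test[of _ _ "\<lambda>n. B * real (Suc n) powr (-\<sigma> - real K)"] 
        summable_mult summable_Suc_powr) auto
  thus "\<exists>d>0. cball x d \<subseteq> {s. Re s > 1 - real K} \<and>
       uniform_limit (cball x d) (\<lambda>N s. \<Sum>n<N. zeta_rem K n s) (\<lambda>s. \<Sum>n. zeta_rem K n s) sequentially"
    using d by blast
qed

definition dirichlet_zeta :: "complex \<Rightarrow> complex" where
  "dirichlet_zeta s = (\<Sum>n. of_nat (Suc n) powr (-s))"

lemma dirichlet_zeta_sums:
  assumes "Re s > 1"
  shows "(\<lambda>n. of_nat (Suc n) powr (-s)) sums dirichlet_zeta s"
  unfolding dirichlet_zeta_def
proof (rule summable_sums, rule summable_norm_cancel)
  have "summable (\<lambda>n. real (Suc n) powr (-Re s))"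
    using assms by (intro summable_Suc_powr) auto
  thus "summable (\<lambda>n. norm (of_nat (Suc n) powr (-s) :: complex))"
    by (subst norm_nat_powr) auto
qed

lemma zeta_rem_sums:
  assumes "Re s > 1"
  shows "(\<lambda>n. zeta_rem (Suc k) n s) sums
    (-1 + (s - 1) * dirichlet_zeta s -
      (\<Sum>i=2..Suc k. zeta_fall i s / fact i * dirichlet_zeta (s + of_nat i - 1)))"
proof -
  have lim: "(\<lambda>n. of_nat (Suc n) powr (1 - s) :: complex) \<longlonglongrightarrow> 0"
  proof (rule tendsto_norm_zero_cancel)
    have "(\<lambda>n. real (Suc n) powr (1 - Re s)) \<longlonglongrightarrow> 0"
      using assms by (intro tendsto_neg_powr filterlim_compose[OF filterlim_real_sequentially 
        filterlim_Suc]) auto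
    thus "(\<lambda>n. norm (of_nat (Suc n) powr (1 - s) :: complex)) \<longlonglongrightarrow> 0"
      by (subst norm_nat_powr) auto
  qed
  have "(\<lambda>n. of_nat (Suc (Suc n)) powr (1 - s) - of_nat (Suc n) powr (1 - s) :: complex) sums 
          (0 - of_nat (Suc 0) powr (1 - s))"
    using telescope_sums[OF lim] .
  hence 1: "(\<lambda>n. of_nat (Suc (Suc n)) powr (1 - s) - of_nat (Suc n) powr (1 - s) :: complex) sums (-1)"
    by simp
  have 2: "(\<lambda>n. \<Sum>i=1..Suc k. zeta_fall i s / fact i * of_nat (Suc n) powr (-(s + of_nat i - 1))) sums
      (\<Sum>i=1..Suc k. zeta_fall i s / fact i * dirichlet_zeta (s + of_nat i - 1))"
    using assms by (intro sums_sum sums_mult dirichlet_zeta_sums) auto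
  have split: "{..Suc k} = insert 0 {1..Suc k}" "{1..Suc k} = insert 1 {2..Suc k}" by auto
  have 3: "zeta_rem (Suc k) n s = of_nat (Suc (Suc n)) powr (1 - s) - of_nat (Suc n) powr (1 - s) -
     (\<Sum>i=1..Suc k. zeta_fall i s / fact i * of_nat (Suc n) powr (-(s + of_nat i - 1)))" for n
    unfolding zeta_rem_def split(1)
    by (subst sum.insert) (auto simp: zeta_fall_def algebra_simps)
  have "(\<lambda>n. zeta_rem (Suc k) n s) sums (-1 - 
      (\<Sum>i=1..Suc k. zeta_fall i s / fact i * dirichlet_zeta (s + of_nat i - 1)))"
    unfolding 3 by (rule sums_diff[OF 1 2])
  also have "-1 - (\<Sum>i=1..Suc k. zeta_fall i s / fact i * dirichlet_zeta (s + of_nat i - 1)) =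
    -1 + (s - 1) * dirichlet_zeta s -
      (\<Sum>i=2..Suc k. zeta_fall i s / fact i * dirichlet_zeta (s + of_nat i - 1))"
    unfolding split(2) by (subst sum.insert) (auto simp: zeta_fall_def algebra_simps)
  finally show ?thesis .
qed

lemma zeta_strip_ex:
  "\<exists>g. g holomorphic_on {s. Re s > 1 - real (Suc k)} \<and> 
       (\<forall>s. Re s > 1 \<longrightarrow> g s = (s - 1) * dirichlet_zeta s)"
proof -
  have step: "\<exists>g'. g' holomorphic_on {s. Re s > 1 - real (Suc k)} \<and> 
         (\<forall>s. Re s > 1 \<longrightarrow> g' s = (s - 1) * dirichlet_zeta s)"
    if hol: "k = 0 \<or> g holomorphic_on {s. Re s > 1 - real k}" 
    and eq: "\<And>s. Re s > 1 \<Longrightarrow> g s = (s - 1) * dirichlet_zeta s" for g k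
  proof (intro exI conjI allI impI)
    define g' where "g' = (\<lambda>s. 1 + (\<Sum>n. zeta_rem (Suc k) n s) - 
       (\<Sum>i=2..Suc k. zeta_fall (i - 1) s / fact i * g (s + of_nat i - 1)))"
    show "g' holomorphic_on {s. Re s > 1 - real (Suc k)}"
      unfolding g'_def
    proof (intro holomorphic_intros zeta_rem_sum_holomorphic)
      fix i assume i: "i \<in> {2..Suc k}"
      hence "g holomorphic_on {s. Re s > 1 - real k}" using hol by auto
      moreover have "(\<lambda>s. s + of_nat i - 1) ` {s. Re s > 1 - real (Suc k)} \<subseteq> {s. Re s > 1 - real k}"
        using i by auto
      moreover have "(\<lambda>s. s + of_nat i - 1) holomorphic_on {s. Re s > 1 - real (Suc k)}"
        by (intro holomorphic_intros)
      ultimately show "(\<lambda>s. g (s + of_nat i - 1)) holomorphic_on {s. Re s > 1 - real (Suc k)}"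
        using holomorphic_on_compose_gen unfolding o_def by blast
    qed auto
    fix s :: complex assume s: "Re s > 1"
    have "(\<Sum>n. zeta_rem (Suc k) n s) = -1 + (s - 1) * dirichlet_zeta s -
      (\<Sum>i=2..Suc k. zeta_fall i s / fact i * dirichlet_zeta (s + of_nat i - 1))"
      using zeta_rem_sums[OF s] by (rule sums_unique[symmetric])
    moreover have "(\<Sum>i=2..Suc k. zeta_fall i s / fact i * dirichlet_zeta (s + of_nat i - 1)) =
       - (\<Sum>i=2..Suc k. zeta_fall (i - 1) s / fact i * g (s + of_nat i - 1))"
      unfolding sum_negf[symmetric]
    proof (rule sum.cong)
      fix i assume i: "i \<in> {2..Suc k}"
      then obtain j where j: "i = Suc j" by (cases i) auto
      have "g (s + of_nat i - 1) = (s + of_nat j - 1) * dirichlet_zeta (s + of_nat i - 1)"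
        using s i j by (subst eq) auto
      moreover have "zeta_fall i s = - (zeta_fall (i - 1) s * (s + of_nat j - 1))"
        unfolding j by (simp add: zeta_fall_def algebra_simps)
      ultimately show "zeta_fall i s / fact i * dirichlet_zeta (s + of_nat i - 1) =
          - (zeta_fall (i - 1) s / fact i * g (s + of_nat i - 1))"
        by simp
    qed auto
    ultimately show "g' s = (s - 1) * dirichlet_zeta s" by (simp add: g'_def)
  qed
  show ?thesis
  proof (induction k)
    case 0
    show ?case by (rule step[of 0 "\<lambda>s. (s - 1) * dirichlet_zeta s"]) auto
  next
    case (Suc k)
    then obtain g where "g holomorphic_on {s. Re s > 1 - real (Suc k)}"
      "\<And>s. Re s > 1 \<Longrightarrow> g s = (s - 1) * dirichlet_zeta s" by blast
    thus ?case by (intro step[of "Suc k" g]) auto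
  qed
qed

theorem ex1_riemann_zeta: "\<exists>!f. is_riemann_zeta f"
proof -
  obtain G where hol: "\<And>k. G k holomorphic_on {s. Re s > - real k}"
    and eq: "\<And>k s. Re s > 1 \<Longrightarrow> G k s = (s - 1) * dirichlet_zeta s"
    using zeta_strip_ex by (simp, metis)
  have agree: "G k s = G l s" if "k \<le> l" "Re s > - real k" for k l s
  proof (rule analytic_continuation_open[of "{s. Re s > 1}" "{s. Re s > - real k}" "G k" "G l" s])
    show "G l holomorphic_on {s. Re s > - real k}"
      by (rule holomorphic_on_subset[OF hol]) (use that in auto)
    show "{s. Re s > 1} \<noteq> {}" by (auto intro!: exI[of _ 2])
    show "connected {s. Re s > - real k}"
      by (intro convex_connected convex_halfspace_Re_gt)
    show "G k z = G l z" if "z \<in> {s. Re s > 1}" for z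
      using that by (simp add: eq)
    show "s \<in> {s. Re s > - real k}" using that by simp
  qed (auto intro: hol open_Re_gt)
  define idx where "idx = (\<lambda>s. nat \<lceil>1 - Re s\<rceil>)"
  define h where "h = (\<lambda>s. G (idx s) s)"
  have idx: "Re s > - real (idx s)" for s unfolding idx_def by linarith
  have h: "h s = G k s" if "Re s > - real k" for k s
    unfolding h_def using agree that idx by (metis nle_le)
  have "h holomorphic_on (\<Union>k. {s. Re s > - real k})"
  proof (rule holomorphic_on_UN_open)
    fix k show "h holomorphic_on {s. Re s > - real k}"
      using hol[of k] by (rule holomorphic_transform) (simp add: h)
  qed (rule open_Re_gt)
  also have "(\<Union>k. {s. Re s > - real k}) = UNIV" using idx by blast
  finally have hol_h: "h holomorphic_on UNIV" .
  define Z where "Z = (\<lambda>s. if s = 1 then 0 else h s / (s - 1))"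
  have "(\<lambda>s. h s / (s - 1)) holomorphic_on -{1}"
    using holomorphic_on_subset[OF hol_h] by (intro holomorphic_intros) auto
  hence "Z holomorphic_on -{1}"
    by (rule holomorphic_transform) (auto simp: Z_def)
  moreover have "Z s = dirichlet_zeta s" if "Re s > 1" for s
    using that eq[of s 0] h[of 0 s] by (auto simp: Z_def)
  ultimately have ex: "is_riemann_zeta Z"
    using dirichlet_zeta_sums unfolding is_riemann_zeta_def by (auto simp: Z_def)
  show ?thesis
  proof (rule ex1I[of _ Z])
    fix f assume f: "is_riemann_zeta f"
    show "f = Z"
    proof
      fix s show "f s = Z s"
      proof (cases "s = 1")
        case True thus ?thesis using f ex by (simp add: is_riemann_zeta_def)
      next
        case False
        show ?thesis
        proof (rule analytic_continuation_open[of "{s. Re s > 1}" "-{1}" f Z s])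
          show "{s. Re s > 1} \<noteq> {}" by (auto intro!: exI[of _ 2])
          show "connected (-{1::complex})"
            by (rule connected_punctured_universe) simp
          show "f z = Z z" if "z \<in> {s. Re s > 1}" for z
            using f ex that by (auto simp: is_riemann_zeta_def intro: sums_unique2)
        qed (use False f ex open_Re_gt in \<open>auto simp: is_riemann_zeta_def\<close>)
      qed
    qed
  qed (rule ex)
qed

corollary is_riemann_zeta: "is_riemann_zeta riemann_zeta"
  unfolding riemann_zeta_def by (rule theI'[OF ex1_riemann_zeta])

end

theory Submission
  imports Defs
begin

text \<open>
  Let \<open>h\<^sub>p\<close> be the denominator of the local factor at \<open>p\<close>, a quadratic polynomial in
  \<open>T = p powr (-s)\<close>, and suppose \<open>a + b \<noteq> c\<close>. The behaviour of \<open>\<zeta>\<close> on the line \<open>Re s = 1\<close> shows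
  that the primes for which \<open>h\<^sub>p\<close> has a root \<open>T\<close> of modulus below a fixed constant less than \<open>1\<close>
  have a divergent sum of reciprocals. Each of them gives a zero of \<open>h\<^sub>p\<close> with real part of order
  \<open>1 / ln p\<close> in a fixed horizontal strip of height \<open>1\<close>. If the strip is high enough, then the zeros
  for different primes with almost the same logarithm are distinct, so for suitable large \<open>x\<close> the
  primes with \<open>ln p\<close> close to \<open>x\<close> give more points than any fixed power of \<open>x\<close>.

  On the other hand, as Estermann observed, \<open>h\<^sub>p\<close> agrees up to \<open>O(T ^ (N + 1))\<close> with a quotient
  of finite products of factors \<open>1 - p powr \<mu> * T ^ n\<close>, where \<open>n \<le> N\<close> and \<open>\<mu>\<close> is imaginary. Hence, for
  \<open>Re s > 1 / (N + 1)\<close>, the product of \<open>F\<close> and a holomorphic function that vanishes at all zeros of all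
  \<open>h\<^sub>p\<close> is a quotient of products of functions \<open>\<zeta> (n * s - \<mu>)\<close>. So each of the points above is a
  singularity of \<open>F\<close> or comes from a zero or the pole of some \<open>\<zeta> (n * s - \<mu>)\<close>. A Jensen type bound
  leaves only polynomially many candidates of the latter kind in terms of \<open>N\<close>, which can be taken of order
  \<open>x\<close>, and \<open>F\<close> has only finitely many singularities in a compact set: a contradiction.
\<close>

section \<open>The regularised zeta function\<close>

lemma riemann_zeta_eq_dirichlet_zeta: "Re s > 1 \<Longrightarrow> riemann_zeta s = dirichlet_zeta s"
  using is_riemann_zeta dirichlet_zeta_sums unfolding is_riemann_zeta_def
  by (blast intro: sums_unique2)

lemma holomorphic_riemann_zeta: "riemann_zeta holomorphic_on (-{1})"
  using is_riemann_zeta unfolding is_riemann_zeta_def by blast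

text \<open>This is \<open>(s - 1) * riemann_zeta s\<close>: the identity of
  \<open>zeta_rem_sums\<close> for order 2, solved for that product, with the term in
  \<open>dirichlet_zeta (s + 1)\<close> rewritten through order 1 at \<open>s + 1\<close>. The pole
  is gone, and the explicit remainders make polynomial growth visible.\<close>

definition zeta_reg :: "complex \<Rightarrow> complex" where
  "zeta_reg s = 1 + (\<Sum>n. zeta_rem 2 n s) + (s - 1) / 2 * (1 + (\<Sum>n. zeta_rem 1 n (s + 1)))"

lemma holomorphic_zeta_reg: "zeta_reg holomorphic_on {s. Re s > -1}"
proof -
  have "(\<lambda>s. \<Sum>n. zeta_rem 2 n s) holomorphic_on {s. Re s > -1}"
    using zeta_rem_sum_holomorphic[of 2] by simp
  moreover have "((\<lambda>s. \<Sum>n. zeta_rem 1 n s) \<circ> (\<lambda>s. s + 1)) holomorphic_on {s. Re s > -1}"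
    by (rule holomorphic_on_compose_gen[OF _ zeta_rem_sum_holomorphic])
       (auto intro!: holomorphic_intros)
  ultimately show ?thesis
    unfolding zeta_reg_def by (intro holomorphic_intros) (auto simp: o_def)
qed

lemma zeta_reg_eq_dirichlet:
  assumes "Re s > 1"
  shows "zeta_reg s = (s - 1) * dirichlet_zeta s"
proof -
  have 2: "(\<Sum>n. zeta_rem 2 n s) = -1 + (s - 1) * dirichlet_zeta s - zeta_fall 2 s / 2 * dirichlet_zeta (s + 1)"
    using sums_unique[OF zeta_rem_sums[OF assms, of 1]] by (simp add: numeral_2_eq_2 add.commute)
  have 1: "(\<Sum>n. zeta_rem 1 n (s + 1)) = -1 + s * dirichlet_zeta (s + 1)"
    using sums_unique[OF zeta_rem_sums[of "s + 1" 0]] assms by simp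
  have f: "zeta_fall 2 s = s * (s - 1)"
    by (simp add: zeta_fall_def numeral_2_eq_2 algebra_simps)
  show ?thesis unfolding zeta_reg_def 1 2 f by (simp add: field_simps)
qed

lemma zeta_reg_eq:
  assumes "Re s > -1" "s \<noteq> 1"
  shows "zeta_reg s = (s - 1) * riemann_zeta s"
proof (rule analytic_continuation_open[of "{s. Re s > 1}" "{s. Re s > -1} - {1}" zeta_reg])
  show "{s. Re s > 1} \<noteq> {}" by (auto intro!: exI[of _ 2])
  show "connected ({s. Re s > -1} - {1})"
    by (rule connected_open_diff_countable)
       (auto intro!: convex_connected convex_halfspace_Re_gt open_Re_gt)
  show "zeta_reg holomorphic_on {s. Re s > -1} - {1}"
    using holomorphic_zeta_reg by (rule holomorphic_on_subset) auto
  show "(\<lambda>s. (s - 1) * riemann_zeta s) holomorphic_on {s. Re s > -1} - {1}"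
    by (intro holomorphic_intros holomorphic_on_subset[OF holomorphic_riemann_zeta]) auto
  show "zeta_reg z = (z - 1) * riemann_zeta z" if "z \<in> {s. Re s > 1}" for z
    using that by (simp add: zeta_reg_eq_dirichlet riemann_zeta_eq_dirichlet_zeta)
qed (use assms open_Re_gt in auto)

text \<open>The value at the pole is the residue of zeta. All falling products with positive index
  vanish at \<open>1\<close>, so every remainder is \<open>1 - 1\<close>.\<close>

lemma zeta_reg_1 [simp]: "zeta_reg 1 = 1"
proof -
  have "zeta_rem 2 n 1 = 0" for n
  proof -
    have "of_nat (Suc (Suc n)) powr 0 = (1 :: complex)" "of_nat (Suc n) powr 0 = (1 :: complex)"
      by (simp_all del: of_nat_Suc)
    thus ?thesis by (simp add: zeta_rem_def zeta_fall_def numeral_2_eq_2 del: of_nat_Suc)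
  qed
  thus ?thesis by (simp add: zeta_reg_def)
qed

lemma zeta_rem_sum_bound:
  assumes "Re s + real K \<ge> 3/2"
  shows "norm (\<Sum>n. zeta_rem K n s) \<le> 
    norm (zeta_fall (Suc K) s) * (\<Sum>n. real (Suc n) powr (-3/2))"
proof -
  have sm: "summable (\<lambda>n. real (Suc n) powr (-3/2))" by (rule summable_Suc_powr) auto
  have le: "norm (zeta_rem K n s) \<le> norm (zeta_fall (Suc K) s) * real (Suc n) powr (-3/2)" for n
  proof -
    have "norm (zeta_rem K n s) \<le> norm (zeta_fall (Suc K) s) * real (Suc n) powr (-Re s - real K)"
      using assms by (intro zeta_rem_bound) auto
    also have "\<dots> \<le> norm (zeta_fall (Suc K) s) * real (Suc n) powr (-3/2)"
      using assms by (intro mult_left_mono powr_mono) auto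
    finally show ?thesis .
  qed
  have "norm (\<Sum>n. zeta_rem K n s) \<le> (\<Sum>n. norm (zeta_fall (Suc K) s) * real (Suc n) powr (-3/2))"
    by (rule norm_suminf_le[OF le summable_mult[OF sm]])
  also have "\<dots> = norm (zeta_fall (Suc K) s) * (\<Sum>n. real (Suc n) powr (-3/2))"
    by (rule suminf_mult[OF sm])
  finally show ?thesis .
qed

text \<open>The remainders of order K contribute at most a constant times
  \<open>zeta_fall (Suc K) s\<close>, a polynomial of degree K + 1 in s; order 2 gives the cube. On
  \<open>Re s \<ge> -1/2\<close> both remainder sums have the margin 3/2 required by
  \<open>zeta_rem_sum_bound\<close>.\<close>

lemma zeta_reg_bound:
  obtains C where "C > 0" "\<And>s. Re s \<ge> -1/2 \<Longrightarrow> norm (zeta_reg s) \<le> C * (1 + norm s) ^ 3"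
proof
  define Z where "Z = (\<Sum>n. real (Suc n) powr (-3/2))"
  have Z: "Z \<ge> 0" unfolding Z_def by (intro suminf_nonneg summable_Suc_powr) auto
  show "2 + 2 * Z > 0" using Z by simp
  fix s :: complex assume s: "Re s \<ge> -1/2"
  define x where "x = 1 + norm s"
  have x: "x \<ge> 1" by (simp add: x_def)
  have n1: "norm (s - 1) \<le> x" "norm (1 - s) \<le> x" "norm s \<le> x" "norm (1 + s) \<le> x"
    using norm_triangle_ineq4[of s 1] norm_triangle_ineq4[of 1 s] norm_triangle_ineq[of 1 s]
    by (auto simp: x_def)
  have "zeta_fall (Suc 2) s = (1 - s) * s * (1 + s)"
    by (simp add: zeta_fall_def numeral_2_eq_2 algebra_simps)
  hence "norm (zeta_fall (Suc 2) s) \<le> x * x * x"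
    using n1 x by (auto simp: norm_mult intro!: mult_mono)
  hence 1: "norm (\<Sum>n. zeta_rem 2 n s) \<le> x * x * x * Z"
  proof (rule order_trans[rotated, OF mult_right_mono[OF _ Z]])
    show "norm (\<Sum>n. zeta_rem 2 n s) \<le> norm (zeta_fall (Suc 2) s) * Z"
      using zeta_rem_sum_bound[of s 2] s unfolding Z_def by simp
  qed
  have "zeta_fall (Suc 1) (s + 1) = s * (1 + s)"
    by (simp add: zeta_fall_def algebra_simps)
  hence "norm (zeta_fall (Suc 1) (s + 1)) \<le> x * x"
    using n1 x by (auto simp: norm_mult intro!: mult_mono)
  moreover have "norm (\<Sum>n. zeta_rem 1 n (s + 1)) \<le> norm (zeta_fall (Suc 1) (s + 1)) * Z"
    using zeta_rem_sum_bound[of "s + 1" 1] s unfolding Z_def by simp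
  ultimately have 2: "norm (\<Sum>n. zeta_rem 1 n (s + 1)) \<le> x * x * Z"
    using Z by (meson mult_right_mono order_trans)
  have "norm (zeta_reg s) \<le> 1 + x * x * x * Z + x / 2 * (1 + x * x * Z)"
    unfolding zeta_reg_def
  proof (intro norm_triangle_mono)
    show "norm ((s - 1) / 2 * (1 + (\<Sum>n. zeta_rem 1 n (s + 1)))) \<le> x / 2 * (1 + x * x * Z)"
      unfolding norm_mult
    proof (intro mult_mono)
      show "norm (1 + (\<Sum>n. zeta_rem 1 n (s + 1))) \<le> 1 + x * x * Z"
        by (rule norm_triangle_mono) (use 2 in auto)
    qed (use n1 x in \<open>auto simp: norm_divide\<close>)
  qed (use 1 in auto)
  also have "\<dots> \<le> (2 + 2 * Z) * x ^ 3"
  proof -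
    have x3: "1 \<le> x ^ 3" "x \<le> x ^ 3" using x power_increasing[of 1 3 x] by auto
    have "0 \<le> x ^ 3 * Z" using Z x by simp
    moreover have "1 + x * x * x * Z + x / 2 * (1 + x * x * Z) = 1 + x / 2 + 3/2 * (x ^ 3 * Z)"
      by (simp add: power3_eq_cube algebra_simps)
    moreover have "(2 + 2 * Z) * x ^ 3 = 2 * x ^ 3 + 2 * (x ^ 3 * Z)" by (simp add: algebra_simps)
    ultimately show ?thesis using x3 by linarith
  qed
  finally show "norm (zeta_reg s) \<le> (2 + 2 * Z) * (1 + norm s) ^ 3" unfolding x_def .
qed

section \<open>Counting zeros with Blaschke products\<close>

text \<open>A Moebius map moves the zero to the origin, where the Schwarz lemma allows division by
  the coordinate without losing the bound 1. Composing back turns the coordinate into a Blaschke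
  factor.\<close>

lemma blaschke_divide:
  assumes holf: "f holomorphic_on ball 0 1" and le: "\<And>z. norm z < 1 \<Longrightarrow> norm (f z) \<le> 1"
    and a: "norm a < 1" "f a = 0"
  obtains g where "g holomorphic_on ball 0 1" "\<And>z. norm z < 1 \<Longrightarrow> norm (g z) \<le> 1"
    "\<And>z. norm z < 1 \<Longrightarrow> f z = Moebius_function 0 a z * g z"
proof -
  define k where "k = f \<circ> Moebius_function 0 (-a)"
  have M: "norm (Moebius_function 0 w z) < 1" if "norm w < 1" "norm z < 1" for w z
    using that by (rule Moebius_function_norm_lt_1)
  have holk: "k holomorphic_on ball 0 1"
    unfolding k_def using a M
    by (intro holomorphic_on_compose_gen[OF Moebius_function_holomorphic holf]) auto
  have k0: "k 0 = 0" using a by (simp add: k_def Moebius_function_of_zero)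
  have kle: "norm (k z) \<le> 1" if "norm z < 1" for z
    using le M a that by (simp add: k_def)
  obtain h where h: "h holomorphic_on ball 0 1" "\<And>z. norm z < 1 \<Longrightarrow> k z = z * h z" "deriv k 0 = h 0"
    using Schwarz3[OF holk k0] by metis
  have hle: "norm (h z) \<le> 1" if z: "norm z < 1" for z
  proof (rule field_le_mult_one_interval)
    \<comment> \<open>\<open>Schwarz_Lemma\<close> asks for a strict bound, while \<open>k\<close>
      has only the weak one. It is therefore applied to \<open>c * k\<close> for every
      \<open>c < 1\<close>.\<close>
    fix c :: real assume c: "0 < c" "c < 1"
    define kc where "kc = (\<lambda>z. of_real c * k z)"
    have hol: "kc holomorphic_on ball 0 1" unfolding kc_def by (intro holomorphic_intros holk)
    have kc0: "kc 0 = 0" by (simp add: kc_def k0)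
    have lt: "norm (kc z) < 1" if "norm z < 1" for z
    proof -
      have "norm (kc z) \<le> c * 1" unfolding kc_def norm_mult 
        using c kle[OF that] by (intro mult_mono) auto
      thus ?thesis using c by simp
    qed
    show "c * norm (h z) \<le> 1"
    proof (cases "z = 0")
      case True
      have "k field_differentiable (at 0)"
        using holk by (simp add: holomorphic_on_imp_differentiable_at)
      hence "deriv kc 0 = of_real c * deriv k 0" unfolding kc_def by (rule deriv_cmult)
      thus ?thesis using Schwarz_Lemma(2)[OF hol kc0 lt, of 0] True h(3) c by (simp add: norm_mult)
    next
      case False
      have "norm (kc z) \<le> norm z" using Schwarz_Lemma(1)[OF hol kc0 lt z] .
      thus ?thesis using False h(2)[OF z] c by (simp add: kc_def norm_mult)
    qed
  qed
  show ?thesis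
  proof (rule that[of "h \<circ> Moebius_function 0 a"])
    show "h \<circ> Moebius_function 0 a holomorphic_on ball 0 1"
      using a M by (intro holomorphic_on_compose_gen[OF Moebius_function_holomorphic h(1)]) auto
    show "norm ((h \<circ> Moebius_function 0 a) z) \<le> 1" if "norm z < 1" for z
      using hle M a that by simp
    show "f z = Moebius_function 0 a z * (h \<circ> Moebius_function 0 a) z" if z: "norm z < 1" for z
    proof -
      have "f z = k (Moebius_function 0 a z)"
        using Moebius_function_compose[of "-a" a z] a z by (simp add: k_def)
      thus ?thesis using h(2) M a z by simp
    qed
  qed
qed

text \<open>The zeros are divided out one at a time: each Blaschke factor has modulus
  \<open>norm a\<close> at the origin, and the quotient keeps the bound 1.\<close>

lemma blaschke_bound:
  assumes "finite S" "f holomorphic_on ball 0 1" "\<And>z. norm z < 1 \<Longrightarrow> norm (f z) \<le> 1"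
    and "\<And>a. a \<in> S \<Longrightarrow> norm a < 1 \<and> f a = 0"
  shows "norm (f 0) \<le> (\<Prod>a\<in>S. norm a)"
  using assms
proof (induction S arbitrary: f rule: finite_induct)
  case empty
  thus ?case by simp
next
  case (insert a S)
  obtain g where g: "g holomorphic_on ball 0 1" "\<And>z. norm z < 1 \<Longrightarrow> norm (g z) \<le> 1"
    "\<And>z. norm z < 1 \<Longrightarrow> f z = Moebius_function 0 a z * g z"
    using blaschke_divide[OF insert.prems(1,2), of a] insert.prems(3)[of a] by blast
  have a: "norm a < 1" using insert.prems by blast
  have "norm (g 0) \<le> (\<Prod>a\<in>S. norm a)"
  proof (rule insert.IH[OF g(1,2)])
    fix b assume b: "b \<in> S"
    hence b': "norm b < 1" "f b = 0" "b \<noteq> a" using insert by auto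
    \<comment> \<open>The Blaschke factor of \<open>a\<close> must not vanish at another zero
      \<open>b\<close>, not even through a zero denominator; only then does the quotient
      \<open>g\<close> inherit \<open>b\<close>.\<close>
    have "1 - cnj a * b \<noteq> 0"
    proof
      assume "1 - cnj a * b = 0"
      hence "norm (cnj a * b) = 1" by (metis eq_iff_diff_eq_0 norm_one)
      thus False using a b' mult_strict_mono[of "norm a" 1 "norm b" 1] by (simp add: norm_mult)
    qed
    hence "Moebius_function 0 a b \<noteq> 0" using b' by (simp add: Moebius_function_simple)
    thus "norm b < 1 \<and> g b = 0" using g(3)[of b] b' by simp
  qed auto
  hence "norm a * norm (g 0) \<le> norm a * (\<Prod>a\<in>S. norm a)" by (intro mult_left_mono) auto
  thus ?case using g(3)[of 0] insert.hyps by (simp add: Moebius_function_of_zero norm_mult)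
qed

text \<open>Rescaling the disc of radius \<open>R\<close> to the unit disc gives every zero modulus
  at most \<open>r / R\<close>. Read backwards, a lower bound for \<open>f\<close> at the centre
  limits the number of zeros, as in Jensen's formula.\<close>

lemma zeros_bound:
  assumes S: "finite S" "S \<subseteq> cball c r" "\<And>z. z \<in> S \<Longrightarrow> f z = 0"
    and r: "0 < r" "r < R" and hol: "f holomorphic_on ball c R"
    and B: "\<And>z. z \<in> ball c R \<Longrightarrow> norm (f z) \<le> B" "B > 0"
  shows "norm (f c) \<le> B * (r / R) ^ card S"
proof -
  define g where "g = (\<lambda>z. f (c + of_real R * z) / of_real B)"
  have im: "c + of_real R * z \<in> ball c R" if "norm z < 1" for z
    using that r by (simp add: dist_norm norm_mult)
  have "(f \<circ> (\<lambda>z. c + of_real R * z)) holomorphic_on ball 0 1"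
    using im by (intro holomorphic_on_compose_gen[OF _ hol] holomorphic_intros) auto
  hence holg: "g holomorphic_on ball 0 1"
    unfolding g_def o_def using B by (intro holomorphic_intros) auto
  have gle: "norm (g z) \<le> 1" if "norm z < 1" for z
    using B(1)[OF im[OF that]] B(2) by (simp add: g_def norm_divide)
  define T where "T = (\<lambda>w. (w - c) / of_real R) ` S"
  have inj: "inj_on (\<lambda>w. (w - c) / of_real R) S" using r by (auto intro: inj_onI)
  have T: "norm a \<le> r / R" "g a = 0" if a: "a \<in> T" for a
  proof -
    obtain w where w: "w \<in> S" "a = (w - c) / of_real R" using a unfolding T_def by blast
    have "norm (w - c) \<le> r" using w S(2) by (auto simp: dist_norm norm_minus_commute)
    thus "norm a \<le> r / R" using w r by (simp add: norm_divide divide_right_mono)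
    show "g a = 0" using w S(3) r by (simp add: g_def)
  qed
  have lt1: "r / R < 1" using r by simp
  have "norm (g 0) \<le> (\<Prod>a\<in>T. norm a)"
    using T lt1 S(1) by (intro blaschke_bound holg gle) (auto simp: T_def intro: le_less_trans)
  also have "\<dots> \<le> (\<Prod>a\<in>T. r / R)" using T by (intro prod_mono) auto
  also have "\<dots> = (r / R) ^ card S" by (simp add: T_def card_image[OF inj])
  finally show ?thesis using B(2) by (simp add: g_def norm_divide field_simps)
qed

section \<open>The Euler product of the zeta function\<close>

definition sieve :: "nat \<Rightarrow> nat set" where
  "sieve n = {m. m > 0 \<and> (\<forall>p\<le>n. prime p \<longrightarrow> \<not> p dvd m)}"

text \<open>Multiplication by the prime \<open>Suc n\<close> does not change divisibility by smaller
  primes, so the survivors that it strikes out are exactly the image of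
  \<open>sieve n\<close>.\<close>

lemma sieve_Suc:
  "sieve (Suc n) = (if prime (Suc n) then sieve n - (*) (Suc n) ` sieve n else sieve n)"
proof (cases "prime (Suc n)")
  case True
  have "Suc n * m \<in> sieve n \<longleftrightarrow> m \<in> sieve n" for m
  proof -
    have "p dvd Suc n * m \<longleftrightarrow> p dvd m" if "p \<le> n" "prime p" for p
    proof -
      have "\<not> p dvd Suc n" using that True primes_dvd_imp_eq[of p "Suc n"] by auto
      thus ?thesis using that prime_dvd_mult_iff by blast
    qed
    thus ?thesis by (auto simp: sieve_def)
  qed
  hence "m \<in> (*) (Suc n) ` sieve n \<longleftrightarrow> m \<in> sieve n \<and> Suc n dvd m" for m
    unfolding dvd_def image_iff by (metis (no_types))
  thus ?thesis using True by (auto simp: sieve_def le_Suc_eq)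
next
  case False
  thus ?thesis by (auto simp: sieve_def le_Suc_eq)
qed

lemma summable_on_nat_powr:
  assumes "Re s > 1"
  shows "(\<lambda>m. norm (of_nat m powr (-s) :: complex)) summable_on (A :: nat set)"
proof -
  have "(\<lambda>m. norm (of_nat m powr (-s) :: complex)) summable_on UNIV"
  proof (rule norm_summable_imp_summable_on)
    have "summable (\<lambda>m. real m powr (-Re s))" using assms by (simp add: summable_real_powr_iff)
    also have "(\<lambda>m. real m powr (-Re s)) = (\<lambda>m. norm (norm (of_nat m powr (-s) :: complex)))"
    proof
      fix m show "real m powr (-Re s) = norm (norm (of_nat m powr (-s) :: complex))"
        by (cases "m = 0") (auto simp: norm_nat_powr)
    qed
    finally show "summable (\<lambda>m. norm (norm (of_nat m powr (-s) :: complex)))" .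
  qed
  thus ?thesis by (rule summable_on_subset_banach) auto
qed

lemma of_nat_powr_mult:
  "of_nat (m * n) powr (z :: complex) = of_nat m powr z * of_nat n powr z"
  by (simp add: powr_times_real)

text \<open>Euler's argument: striking out the multiples of a prime p from the Dirichlet series
  multiplies its sum by \<open>1 - p powr (-s)\<close>.\<close>

lemma infsum_sieve:
  assumes s: "Re s > 1"
  shows "(\<Sum>\<^sub>\<infinity>m\<in>sieve n. of_nat m powr (-s)) =
    riemann_zeta s * (\<Prod>p\<le>n. if prime p then 1 - of_nat p powr (-s) else 1)"
proof (induction n)
  case 0
  have "((\<lambda>m. of_nat m powr (-s) :: complex) has_sum (\<Sum>\<^sub>\<infinity>m. of_nat m powr (-s))) UNIV"
    using abs_summable_summable[OF summable_on_nat_powr[OF s, of UNIV]] by simp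
  hence "(\<lambda>m. of_nat m powr (-s)) sums (\<Sum>\<^sub>\<infinity>m. of_nat m powr (-s) :: complex)"
    by (rule has_sum_imp_sums)
  hence "(\<lambda>m. of_nat (Suc m) powr (-s)) sums (\<Sum>\<^sub>\<infinity>m. of_nat m powr (-s) :: complex)"
    by (subst sums_Suc_iff) simp
  hence "(\<Sum>\<^sub>\<infinity>m. of_nat m powr (-s) :: complex) = riemann_zeta s"
    using dirichlet_zeta_sums[OF s] riemann_zeta_eq_dirichlet_zeta[OF s] sums_unique2 by metis
  moreover have "(\<Sum>\<^sub>\<infinity>m\<in>sieve 0. of_nat m powr (-s)) = (\<Sum>\<^sub>\<infinity>m. of_nat m powr (-s) :: complex)"
    by (rule infsum_cong_neutral) (auto simp: sieve_def)
  ultimately show ?case by simp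
next
  case (Suc n)
  let ?f = "\<lambda>m::nat. of_nat m powr (-s) :: complex"
  show ?case
  proof (cases "prime (Suc n)")
    case True
    have sub: "(*) (Suc n) ` sieve n \<subseteq> sieve n"
    proof -
      have "p dvd m" if "p \<le> n" "prime p" "p dvd Suc n * m" for p m
        using that True primes_dvd_imp_eq[of p "Suc n"] prime_dvd_mult_iff[of p "Suc n" m]
        by (metis Suc_n_not_le_n)
      hence "Suc n * m \<in> sieve n" if "m \<in> sieve n" for m
        using that unfolding sieve_def mem_Collect_eq by (metis mult_pos_pos zero_less_Suc)
      thus ?thesis by blast
    qed
    have inj: "inj_on ((*) (Suc n)) (sieve n)" by (rule inj_onI) (simp del: mult_Suc)
    have "infsum ?f (sieve (Suc n)) = infsum ?f (sieve n) - infsum ?f ((*) (Suc n) ` sieve n)"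
      using True sub abs_summable_summable[OF summable_on_nat_powr[OF s]] 
      by (simp add: sieve_Suc infsum_Diff)
    also have "infsum ?f ((*) (Suc n) ` sieve n) = (\<Sum>\<^sub>\<infinity>m\<in>sieve n. ?f (Suc n) * ?f m)"
      by (subst infsum_reindex[OF inj]) (simp add: o_def of_nat_powr_mult del: of_nat_Suc mult_Suc of_nat_mult)
    also have "\<dots> = ?f (Suc n) * infsum ?f (sieve n)"
      by (rule infsum_cmult_right')
    finally show ?thesis using True Suc by (simp add: algebra_simps)
  next
    case False
    thus ?thesis using Suc by (simp add: sieve_Suc)
  qed
qed

text \<open>A number other than 1 that survives \<open>sieve n\<close> has a prime factor above
  \<open>n\<close>, so apart from the term 1 only a tail of an absolutely convergent series remains.
  In this form, with zeta as a factor, the limit 1 shows at once that zeta has no zero here.\<close>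

lemma euler_product_tendsto:
  assumes s: "Re s > 1"
  shows "(\<lambda>n. riemann_zeta s * (\<Prod>p\<le>n. if prime p then 1 - of_nat p powr (-s) else 1)) \<longlonglongrightarrow> 1"
proof -
  let ?f = "\<lambda>m::nat. of_nat m powr (-s) :: complex"
  let ?g = "\<lambda>m. norm (?f m)"
  have sg: "?g summable_on A" for A using summable_on_nat_powr[OF s] .
  have sf: "?f summable_on A" for A using abs_summable_summable[OF sg] .
  have "(?g has_sum infsum ?g UNIV) UNIV" using sg by simp
  hence "?g sums infsum ?g UNIV" by (rule has_sum_imp_sums)
  hence "(\<lambda>n. infsum ?g UNIV - (\<Sum>m<n. ?g m)) \<longlonglongrightarrow> infsum ?g UNIV - infsum ?g UNIV"
    unfolding sums_def by (intro tendsto_diff tendsto_const)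
  hence lim: "(\<lambda>n. infsum ?g UNIV - (\<Sum>m<n. ?g m)) \<longlonglongrightarrow> 0" by simp
  have bd: "norm (infsum ?f (sieve n) - 1) \<le> infsum ?g UNIV - (\<Sum>m<n. ?g m)" if n: "n \<ge> 2" for n
  proof -
    have 1: "1 \<in> sieve n" by (auto simp: sieve_def)
    have sub: "sieve n - {1} \<subseteq> UNIV - {..<n}"
    proof (intro subsetI)
      fix m assume m: "m \<in> sieve n - {1}"
      then obtain p where p: "prime p" "p dvd m" using prime_factor_nat by blast
      have "p \<le> m" using m p by (auto simp: sieve_def intro: dvd_imp_le)
      moreover have "\<not> p \<le> n" using m p by (auto simp: sieve_def)
      ultimately show "m \<in> UNIV - {..<n}" by auto
    qed
    have "infsum ?f (sieve n) - 1 = infsum ?f (sieve n - {1})"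
      using infsum_Diff[OF sf sf, of "{1}" "sieve n"] 1 by simp
    also have "norm \<dots> \<le> infsum ?g (sieve n - {1})" using sg by (rule norm_infsum_bound)
    also have "\<dots> \<le> infsum ?g (UNIV - {..<n})"
      using sub by (intro infsum_mono2 sg) auto
    also have "\<dots> = infsum ?g UNIV - infsum ?g {..<n}"
      by (intro infsum_Diff sg) auto
    finally show ?thesis by simp
  qed
  have "(\<lambda>n. infsum ?f (sieve n) - 1) \<longlonglongrightarrow> 0"
    by (rule Lim_null_comparison[OF _ lim]) (rule eventually_mono[OF eventually_ge_at_top[of 2] bd])
  thus ?thesis unfolding infsum_sieve[OF s] by (simp add: LIM_zero_iff)
qed

lemma riemann_zeta_nonzero: "Re s > 1 \<Longrightarrow> riemann_zeta s \<noteq> 0"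
  using euler_product_tendsto[of s] LIMSEQ_unique[OF _ tendsto_const[of 0]] by fastforce

section \<open>Counting the zeros of zeta in a strip\<close>

text \<open>Uniformly in \<open>t\<close>, the terms after the first sum to at most
  \<open>pi\<^sup>2 / 6 - 1 < 3/4\<close>. This is the lower bound at the centre of the discs used
  for counting zeros.\<close>

lemma norm_zeta_reg_two_line: "norm (zeta_reg (Complex 2 t)) \<ge> 1/4"
proof -
  define s where "s = Complex 2 t"
  have s: "Re s > 1" by (simp add: s_def)
  have "(\<lambda>n. of_nat (Suc n) powr (-s)) sums riemann_zeta s"
    using dirichlet_zeta_sums[OF s] riemann_zeta_eq_dirichlet_zeta[OF s] by simp
  hence "(\<lambda>n. of_nat (Suc (Suc n)) powr (-s)) sums (riemann_zeta s - 1)"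
    by (subst sums_Suc_iff) simp
  hence eq: "riemann_zeta s - 1 = (\<Sum>n. of_nat (Suc (Suc n)) powr (-s))" by (rule sums_unique)
  have q: "(\<lambda>n. 1 / (real (Suc n) + 1)\<^sup>2) sums (pi\<^sup>2 / 6 - 1)"
    using inverse_squares_sums by (subst sums_Suc_iff) (simp add: add.commute)
  have "norm (riemann_zeta s - 1) \<le> (\<Sum>n. 1 / (real (Suc n) + 1)\<^sup>2)"
    unfolding eq
  proof (rule norm_suminf_le)
    show "summable (\<lambda>n. 1 / (real (Suc n) + 1)\<^sup>2)" using q by (rule sums_summable)
    show "norm (of_nat (Suc (Suc n)) powr (-s)) \<le> 1 / (real (Suc n) + 1)\<^sup>2" for n
    proof -
      have "norm (of_nat (Suc (Suc n)) powr (-s)) = real (Suc (Suc n)) powr (-2)"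
        by (subst norm_nat_powr) (auto simp: s_def)
      also have "\<dots> = 1 / (real (Suc n) + 1)\<^sup>2"
        by (simp add: powr_minus powr_numeral divide_inverse add_ac)
      finally show ?thesis by simp
    qed
  qed
  also have "\<dots> = pi\<^sup>2 / 6 - 1" using sums_unique[OF q] by simp
  also have "pi\<^sup>2 \<le> (16/5)\<^sup>2" using pi_approx by (intro power_mono) auto
  finally have "norm (riemann_zeta s - 1) \<le> 3/4" by (simp add: power2_eq_square)
  hence 1: "norm (riemann_zeta s) \<ge> 1/4"
    using norm_triangle_ineq2[of 1 "1 - riemann_zeta s"] by (simp add: norm_minus_commute)
  have "norm (s - 1) \<ge> 1" using complex_Re_le_cmod[of "s - 1"] by (simp add: s_def)
  moreover have "zeta_reg s = (s - 1) * riemann_zeta s"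
    using s by (intro zeta_reg_eq) auto
  ultimately show ?thesis
    using mult_mono[of 1 "norm (s - 1)" "1/4" "norm (riemann_zeta s)"] 1 by (simp add: norm_mult s_def)
qed

lemma zeta_reg_nonzero:
  assumes "Re s > 1"
  shows "zeta_reg s \<noteq> 0"
proof -
  have "s \<noteq> 1" using assms by auto
  thus ?thesis using assms riemann_zeta_nonzero[of s] zeta_reg_eq[of s] by simp
qed

lemma zeta_reg_zeros_near:
  obtains C where "C > 0"
    "\<And>t S. finite S \<Longrightarrow> S \<subseteq> {w. 0 < Re w \<and> \<bar>Im w - t\<bar> \<le> 1/2 \<and> zeta_reg w = 0} \<Longrightarrow>
       real (card S) \<le> C * (1 + \<bar>t\<bar>) ^ 3"
proof -
  obtain C where C: "C > 0" "\<And>s. Re s \<ge> -1/2 \<Longrightarrow> norm (zeta_reg s) \<le> C * (1 + norm s) ^ 3"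
    using zeta_reg_bound by blast
  show ?thesis
  proof (rule that[of "21 * (C * 6 ^ 3)"])
    show "21 * (C * 6 ^ 3) > 0" using C by simp
    fix t S assume fin: "finite S" 
      and S: "S \<subseteq> {w. 0 < Re w \<and> \<bar>Im w - t\<bar> \<le> 1/2 \<and> zeta_reg w = 0}"
    \<comment> \<open>The disc of radius 5/2 about \<open>c\<close> stays in
      \<open>Re z > -1/2\<close>, where \<open>zeta_reg_bound\<close> applies. The zeros have real
      part at most 1, hence distance at most the root of \<open>4 + 1/4\<close> from
      \<open>c\<close>, which is below 21/10.\<close>
    define c where "c = Complex 2 t"
    define B where "B = C * (6 * (1 + \<bar>t\<bar>)) ^ 3"
    have B0: "B > 0" using C by (simp add: B_def)
    have Re: "Re z > -1/2" if "z \<in> ball c (5/2)" for z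
      using that abs_Re_le_cmod[of "c - z"] by (auto simp: dist_norm c_def)
    have B: "norm (zeta_reg z) \<le> B" if z: "z \<in> ball c (5/2)" for z
    proof -
      have "norm z \<le> norm c + 5/2"
        using z norm_triangle_ineq2[of z c] by (simp add: dist_norm norm_minus_commute)
      also have "norm c \<le> 2 + \<bar>t\<bar>" using cmod_le[of c] by (simp add: c_def)
      finally have "(1 + norm z) ^ 3 \<le> (6 * (1 + \<bar>t\<bar>)) ^ 3" by (intro power_mono) auto
      hence "C * (1 + norm z) ^ 3 \<le> B" using C unfolding B_def by (intro mult_left_mono) auto
      thus ?thesis using C(2)[of z] Re[OF z] by simp
    qed
    have sub: "S \<subseteq> cball c (21/10)"
    proof
      fix w assume w: "w \<in> S"
      hence wz: "zeta_reg w = 0" "Re w > 0" "\<bar>Im w - t\<bar> \<le> 1/2" using S by auto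
      have "Re w \<le> 1" using zeta_reg_nonzero[of w] wz by (cases "Re w > 1") auto
      hence "(2 - Re w)\<^sup>2 \<le> 2\<^sup>2" using wz by (intro power_mono) auto
      moreover have "(t - Im w)\<^sup>2 \<le> (1/2)\<^sup>2" 
        using wz(3) by (intro power2_le_iff_abs_le[THEN iffD2]) (linarith | simp)+
      moreover have "(norm (c - w))\<^sup>2 = (2 - Re w)\<^sup>2 + (t - Im w)\<^sup>2"
        unfolding cmod_power2 by (simp add: c_def)
      ultimately have "(norm (c - w))\<^sup>2 \<le> 2\<^sup>2 + (1/2)\<^sup>2" by linarith
      also have "\<dots> \<le> (21/10)\<^sup>2" by (simp add: power2_eq_square)
      finally have "norm (c - w) \<le> 21/10" by (rule power2_le_imp_le) simp
      thus "w \<in> cball c (21/10)" by (simp add: dist_norm)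
    qed
    have "norm (zeta_reg c) \<le> B * ((21/10) / (5/2)) ^ card S"
    proof (rule zeros_bound[OF fin sub])
      show "zeta_reg holomorphic_on ball c (5/2)"
        using holomorphic_zeta_reg by (rule holomorphic_on_subset) (use Re in fastforce)
    qed (use S B B0 in auto)
    hence "1/4 \<le> B * (21/25) ^ card S"
      using norm_zeta_reg_two_line[of t] by (simp add: c_def)
    hence "(25/21) ^ card S \<le> 4 * B"
      by (simp add: power_divide field_simps)
    \<comment> \<open>Bernoulli's inequality stands in for a logarithm; the resulting bound is
      cruder but still polynomial in \<open>t\<close>.\<close>
    moreover have "1 + real (card S) * (4/21) \<le> (1 + 4/21) ^ card S"
      by (rule Bernoulli_inequality) auto
    ultimately have "real (card S) \<le> 21 * B" by (simp add: add_divide_distrib)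
    thus "real (card S) \<le> 21 * (C * 6 ^ 3) * (1 + \<bar>t\<bar>) ^ 3" unfolding B_def power_mult_distrib by (simp only: mult_ac)
  qed
qed

text \<open>The strip is covered by \<open>2 * Y + 1\<close> strips of height 1 around the integers,
  which costs one more power.\<close>

lemma zeta_reg_zeros_count:
  obtains C where "C > 0" "\<And>Y. finite {w. 0 < Re w \<and> \<bar>Im w\<bar> \<le> real Y \<and> zeta_reg w = 0}"
    "\<And>Y. real (card {w. 0 < Re w \<and> \<bar>Im w\<bar> \<le> real Y \<and> zeta_reg w = 0}) \<le> C * (1 + real Y) ^ 4"
proof -
  define X where "X = (\<lambda>t::real. {w. 0 < Re w \<and> \<bar>Im w - t\<bar> \<le> 1/2 \<and> zeta_reg w = 0})"
  obtain C where C: "C > 0"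
    "\<And>t S. finite S \<Longrightarrow> S \<subseteq> X t \<Longrightarrow> real (card S) \<le> C * (1 + \<bar>t\<bar>) ^ 3"
    unfolding X_def by (rule zeta_reg_zeros_near) blast
  \<comment> \<open>Finiteness follows from the uniform bound: an infinite set has finite subsets of
    every size.\<close>
  have finX: "finite (X t)" for t
  proof (rule ccontr)
    assume "infinite (X t)"
    then obtain S where "finite S" "card S = nat \<lceil>C * (1 + \<bar>t\<bar>) ^ 3\<rceil> + 1" "S \<subseteq> X t"
      using infinite_arbitrarily_large by blast
    thus False using C(2)[of S t] by linarith
  qed
  have sub: "{w. 0 < Re w \<and> \<bar>Im w\<bar> \<le> real Y \<and> zeta_reg w = 0} \<subseteq> (\<Union>j\<in>{-int Y..int Y}. X (of_int j))"
    (is "?Z Y \<subseteq> _") for Y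
  proof
    fix w assume w: "w \<in> ?Z Y"
    define j where "j = round (Im w)"
    have "\<bar>Im w - of_int j\<bar> \<le> 1/2" using of_int_round_abs_le[of "Im w"] by (simp add: j_def abs_minus_commute)
    moreover have "j \<in> {-int Y..int Y}"
    proof -
      have d: "Im w - of_int j \<le> 1/2" "of_int j - Im w \<le> 1/2" "Im w \<le> real Y" "- real Y \<le> Im w"
        using w calculation unfolding mem_Collect_eq abs_le_iff by auto
      have "real_of_int j < of_int (int Y + 1)" using d by simp
      moreover have "of_int (- int Y - 1) < real_of_int j" using d by simp
      ultimately show ?thesis by (simp only: of_int_less_iff) auto
    qed
    ultimately show "w \<in> (\<Union>j\<in>{-int Y..int Y}. X (of_int j))" using w by (auto simp: X_def)
  qed
  show ?thesis
  proof (rule that[of "2 * C"])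
    fix Y
    show "finite (?Z Y)" by (rule finite_subset[OF sub]) (use finX in auto)
    have "card (?Z Y) \<le> card (\<Union>j\<in>{-int Y..int Y}. X (of_int j))"
      by (rule card_mono[OF _ sub]) (use finX in auto)
    also have "\<dots> \<le> (\<Sum>j\<in>{-int Y..int Y}. card (X (of_int j)))"
      by (rule card_UN_le) auto
    finally have "real (card (?Z Y)) \<le> real (\<Sum>j\<in>{-int Y..int Y}. card (X (of_int j)))"
      by (rule of_nat_mono)
    also have "\<dots> = (\<Sum>j\<in>{-int Y..int Y}. real (card (X (of_int j))))" by (rule of_nat_sum)
    also have "\<dots> \<le> (\<Sum>j\<in>{-int Y..int Y}. C * (1 + real Y) ^ 3)"
    proof (rule sum_mono)
      fix j assume j: "j \<in> {-int Y..int Y}"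
      have "real (card (X (of_int j))) \<le> C * (1 + \<bar>of_int j\<bar>) ^ 3" using C(2) finX by blast
      also have "\<dots> \<le> C * (1 + real Y) ^ 3"
        using j C by (intro mult_left_mono power_mono) auto
      finally show "real (card (X (of_int j))) \<le> C * (1 + real Y) ^ 3" .
    qed
    also have "\<dots> = (2 * real Y + 1) * (C * (1 + real Y) ^ 3)" by simp
    also have "\<dots> \<le> (2 * (1 + real Y)) * (C * (1 + real Y) ^ 3)"
      using C by (intro mult_right_mono) auto
    also have "\<dots> = 2 * C * (1 + real Y) ^ 4" by (simp add: eval_nat_numeral algebra_simps)
    finally show "real (card (?Z Y)) \<le> 2 * C * (1 + real Y) ^ 4" .
  qed (use C in auto)
qed

section \<open>Sums over primes near the line Re s = 1\<close>

text \<open>This is the real part of the sum of \<open>p powr (-s)\<close> over the primes at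
  \<open>s = Complex (1 + \<epsilon>) \<theta>\<close>, hence the leading part of
  \<open>ln (norm (riemann_zeta s))\<close>.\<close>

definition prime_cos_sum :: "real \<Rightarrow> real \<Rightarrow> real" where
  "prime_cos_sum \<theta> \<epsilon> = (\<Sum>p. if prime p then real p powr (-1 - \<epsilon>) * cos (\<theta> * ln (real p)) else 0)"

lemma prime_cos_sums:
  assumes "\<epsilon> > 0"
  shows "(\<lambda>p. if prime p then real p powr (-1 - \<epsilon>) * cos (\<theta> * ln (real p)) else 0) sums
           prime_cos_sum \<theta> \<epsilon>"
  unfolding prime_cos_sum_def
proof (rule summable_sums, rule summable_comparison_test')
  show "summable (\<lambda>p. real p powr (-1 - \<epsilon>))" using assms by (simp add: summable_real_powr_iff)
  show "norm (if prime p then real p powr (-1 - \<epsilon>) * cos (\<theta> * ln (real p)) else 0) \<le> real p powr (-1 - \<epsilon>)" for p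
    by (auto simp: abs_mult mult_left_le)
qed

lemma ln_norm_one_minus_bound:
  assumes "norm z \<le> 1/2"
  shows "\<bar>Re z + ln (norm (1 - z))\<bar> \<le> 2 * (norm z)\<^sup>2"
proof -
  have nz: "1 - z \<noteq> 0" using assms by auto
  have "norm (Ln (1 + (-z)) - (-z)) \<le> norm (-z) ^ 2 / (1 - norm (-z))"
    using assms by (intro Ln_approx_linear) auto
  also have "\<dots> \<le> norm z ^ 2 / (1 / 2)"
    using assms unfolding norm_minus_cancel by (intro divide_left_mono) auto
  finally have "norm (Ln (1 - z) + z) \<le> 2 * (norm z)\<^sup>2" by simp
  moreover have "\<bar>Re (Ln (1 - z) + z)\<bar> \<le> norm (Ln (1 - z) + z)" by (rule abs_Re_le_cmod)
  ultimately show ?thesis using nz by (simp add: Re_Ln add.commute)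
qed

lemma Re_nat_powr:
  assumes "p > 0"
  shows "Re (of_nat p powr z) = real p powr Re z * cos (Im z * ln (real p))"
  using assms by (simp add: powr_def Re_exp Ln_of_nat)

text \<open>The logarithm of the Euler product differs from the prime sum by terms of second order,
  dominated by \<open>2 * real p powr (-2)\<close>. This majorant depends neither on
  \<open>\<theta>\<close> nor on \<open>\<epsilon>\<close>.\<close>

lemma prime_cos_sum_approx:
  obtains K where "\<And>\<theta> \<epsilon>. \<epsilon> > 0 \<Longrightarrow> \<bar>prime_cos_sum \<theta> \<epsilon> - ln (norm (riemann_zeta (Complex (1 + \<epsilon>) \<theta>)))\<bar> \<le> K"
proof
  fix \<theta> \<epsilon> :: real assume e: "\<epsilon> > 0"
  define s where "s = Complex (1 + \<epsilon>) \<theta>"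
  have s: "Re s > 1" using e by (simp add: s_def)
  define P where "P = (\<lambda>n. \<Prod>p\<le>n. if prime p then 1 - of_nat p powr (-s) else 1)"
  define C where "C = (\<lambda>n. \<Sum>p\<le>n. if prime p then real p powr (-1 - \<epsilon>) * cos (\<theta> * ln (real p)) else 0)"
  define K where "K = (\<Sum>p. 2 * real p powr (-2))"
  have sumK: "summable (\<lambda>p. 2 * real p powr (-2))"
    by (intro summable_mult) (simp add: summable_real_powr_iff)
  have Cl: "C \<longlonglongrightarrow> prime_cos_sum \<theta> \<epsilon>"
    using prime_cos_sums[OF e] unfolding C_def sums_def_le .
  have z0: "riemann_zeta s \<noteq> 0" by (rule riemann_zeta_nonzero[OF s])
  have half: "norm (of_nat p powr (-s) :: complex) \<le> real p powr (-1)" 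
    "real p powr (-1) \<le> 1/2" if "prime p" for p
  proof -
    have p: "real p \<ge> 2" using prime_ge_2_nat[OF that] by simp
    have "norm (of_nat p powr (-s) :: complex) = real p powr (-1 - \<epsilon>)"
      using p by (subst norm_nat_powr) (auto simp: s_def)
    also have "\<dots> \<le> real p powr (-1)" using e p by (intro powr_mono) auto
    finally show "norm (of_nat p powr (-s) :: complex) \<le> real p powr (-1)" .
    show "real p powr (-1) \<le> 1/2" using p by (simp add: powr_minus divide_simps)
  qed
  have bd: "\<bar>C n + ln (norm (P n))\<bar> \<le> K" for n
  proof -
    have nz: "1 - of_nat p powr (-s) \<noteq> (0 :: complex)" if "prime p" for p
      using half[OF that] by auto
    have "ln (norm (P n)) = (\<Sum>p\<le>n. if prime p then ln (norm (1 - of_nat p powr (-s) :: complex)) else 0)"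
      unfolding P_def prod_norm[symmetric] using nz by (subst ln_prod) (auto intro!: sum.cong)
    hence "C n + ln (norm (P n)) = (\<Sum>p\<le>n. if prime p then 
        Re (of_nat p powr (-s)) + ln (norm (1 - of_nat p powr (-s) :: complex)) else 0)"
      unfolding C_def by (auto simp: sum.distrib[symmetric] Re_nat_powr s_def prime_gt_0_nat intro!: sum.cong)
    also have "\<bar>\<dots>\<bar> \<le> (\<Sum>p\<le>n. 2 * real p powr (-2))"
    proof (intro order_trans[OF sum_abs] sum_mono)
      fix p
      show "\<bar>if prime p then Re (of_nat p powr (-s)) + ln (norm (1 - of_nat p powr (-s) :: complex)) else 0\<bar>
        \<le> 2 * real p powr (-2)"
      proof (cases "prime p")
        case True
        have "\<bar>Re (of_nat p powr (-s)) + ln (norm (1 - of_nat p powr (-s) :: complex))\<bar> 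
           \<le> 2 * (norm (of_nat p powr (-s) :: complex))\<^sup>2"
          using half[OF True] by (intro ln_norm_one_minus_bound) linarith
        also have "\<dots> \<le> 2 * (real p powr (-1))\<^sup>2"
          using half[OF True] by (intro mult_left_mono power_mono) auto
        also have "(real p powr (-1))\<^sup>2 = real p powr (-2)"
          unfolding power2_eq_square powr_add[symmetric] by simp
        finally show ?thesis using True by simp
      qed auto
    qed
    also have "\<dots> \<le> K" unfolding K_def by (intro sum_le_suminf sumK) auto
    finally show ?thesis .
  qed
  have "(\<lambda>n. norm (riemann_zeta s * P n) / norm (riemann_zeta s)) \<longlonglongrightarrow> norm (1::complex) / norm (riemann_zeta s)"
    using euler_product_tendsto[OF s] z0 by (intro tendsto_intros) (auto simp: P_def)
  hence "(\<lambda>n. norm (P n)) \<longlonglongrightarrow> 1 / norm (riemann_zeta s)" using z0 by (simp add: norm_mult)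
  hence "(\<lambda>n. ln (norm (P n))) \<longlonglongrightarrow> ln (1 / norm (riemann_zeta s))"
    using z0 by (intro tendsto_ln) auto
  hence "(\<lambda>n. C n + ln (norm (P n))) \<longlonglongrightarrow> prime_cos_sum \<theta> \<epsilon> - ln (norm (riemann_zeta s))"
    using tendsto_add[OF Cl] z0 by (fastforce simp: ln_div)
  hence "(\<lambda>n. \<bar>C n + ln (norm (P n))\<bar>) \<longlonglongrightarrow> \<bar>prime_cos_sum \<theta> \<epsilon> - ln (norm (riemann_zeta s))\<bar>"
    by (rule tendsto_rabs)
  thus "\<bar>prime_cos_sum \<theta> \<epsilon> - ln (norm (riemann_zeta (Complex (1 + \<epsilon>) \<theta>)))\<bar> \<le> (\<Sum>p. 2 * real p powr (-2))"
    unfolding s_def[symmetric] K_def[symmetric] by (rule LIMSEQ_le_const2) (use bd in auto)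
qed


text \<open>Since zeta has a simple pole with residue 1, \<open>ln (norm (zeta_reg s))\<close> tends
  to 0 at \<open>1\<close>, and the factor \<open>s - 1\<close> accounts for
  \<open>ln \<epsilon>\<close>.\<close>

lemma prime_cos_sum_zero:
  obtains K where "eventually (\<lambda>\<epsilon>. \<bar>prime_cos_sum 0 \<epsilon> + ln \<epsilon>\<bar> \<le> K) (at_right 0)"
proof -
  obtain K where K: "\<And>\<theta> \<epsilon>. \<epsilon> > 0 \<Longrightarrow> \<bar>prime_cos_sum \<theta> \<epsilon> - ln (norm (riemann_zeta (Complex (1 + \<epsilon>) \<theta>)))\<bar> \<le> K"
    using prime_cos_sum_approx by blast
  have "isCont zeta_reg 1"
    using holomorphic_zeta_reg open_Re_gt[of "-1"]
    by (auto simp: continuous_on_eq_continuous_at dest!: holomorphic_on_imp_continuous_on)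
  hence "((\<lambda>\<epsilon>. zeta_reg (1 + of_real \<epsilon>)) \<longlongrightarrow> zeta_reg 1) (at_right 0)"
    by (rule isCont_tendsto_compose) (auto intro!: tendsto_eq_intros)
  hence "((\<lambda>\<epsilon>. ln (norm (zeta_reg (1 + of_real \<epsilon>)))) \<longlongrightarrow> ln (norm (1::complex))) (at_right 0)"
    by (intro tendsto_ln tendsto_norm) auto
  hence "eventually (\<lambda>\<epsilon>. \<bar>ln (norm (zeta_reg (1 + of_real \<epsilon>)))\<bar> < 1) (at_right 0)"
    by (auto simp: tendsto_iff)
  hence "eventually (\<lambda>\<epsilon>. \<bar>prime_cos_sum 0 \<epsilon> + ln \<epsilon>\<bar> \<le> K + 1) (at_right 0)"
    using eventually_at_right_less[of 0]
  proof eventually_elim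
    case (elim \<epsilon>)
    have eq: "Complex (1 + \<epsilon>) 0 = 1 + of_real \<epsilon>" by (simp add: complex_eq_iff)
    have "riemann_zeta (1 + of_real \<epsilon>) \<noteq> 0" using elim by (intro riemann_zeta_nonzero) auto
    moreover have "zeta_reg (1 + of_real \<epsilon>) = of_real \<epsilon> * riemann_zeta (1 + of_real \<epsilon>)"
      using elim by (subst zeta_reg_eq) auto
    ultimately have "ln (norm (zeta_reg (1 + of_real \<epsilon>))) = ln \<epsilon> + ln (norm (riemann_zeta (1 + of_real \<epsilon>)))"
      using elim by (simp add: norm_mult ln_mult)
    thus ?case using K[of \<epsilon> 0] elim unfolding eq by linarith
  qed
  thus ?thesis by (rule that)
qed

text \<open>Zeros on the line \<open>Re s = 1\<close> are not yet excluded. At such a zero the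
  difference quotient is bounded, so \<open>ln (norm (riemann_zeta s))\<close> falls at least as
  fast as \<open>ln \<epsilon>\<close>; otherwise continuity keeps it bounded.\<close>

lemma prime_cos_sum_line:
  assumes "\<theta> \<noteq> 0"
  obtains (zero) K where "eventually (\<lambda>\<epsilon>. prime_cos_sum \<theta> \<epsilon> \<le> ln \<epsilon> + K) (at_right 0)"
  | (nonzero) K where "eventually (\<lambda>\<epsilon>. \<bar>prime_cos_sum \<theta> \<epsilon>\<bar> \<le> K) (at_right 0)"
proof -
  obtain K where K: "\<And>\<theta> \<epsilon>. \<epsilon> > 0 \<Longrightarrow> \<bar>prime_cos_sum \<theta> \<epsilon> - ln (norm (riemann_zeta (Complex (1 + \<epsilon>) \<theta>)))\<bar> \<le> K"
    using prime_cos_sum_approx by blast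
  define z where "z = Complex 1 \<theta>"
  have eq: "Complex (1 + \<epsilon>) \<theta> = z + of_real \<epsilon>" for \<epsilon> by (simp add: complex_eq_iff z_def)
  have "z \<noteq> 1" using assms by (simp add: z_def complex_eq_iff)
  hence diff: "riemann_zeta field_differentiable (at z)"
    using holomorphic_riemann_zeta by (intro holomorphic_on_imp_differentiable_at[of _ "-{1}"]) auto
  have lim0: "filterlim (\<lambda>\<epsilon>. complex_of_real \<epsilon>) (at 0) (at_right 0)"
    unfolding filterlim_at by (auto intro!: tendsto_eq_intros simp: eventually_at_filter)
  show ?thesis
  proof (cases "riemann_zeta z = 0")
    case True
    have "((\<lambda>h. (riemann_zeta (z + h) - riemann_zeta z) / h) \<longlongrightarrow> deriv riemann_zeta z) (at 0)"
      using diff by (simp add: DERIV_deriv_iff_field_differentiable[symmetric] DERIV_def)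
    hence "((\<lambda>\<epsilon>. riemann_zeta (z + of_real \<epsilon>) / of_real \<epsilon>) \<longlongrightarrow> deriv riemann_zeta z) (at_right 0)"
      using filterlim_compose[OF _ lim0] True by fastforce
    hence "((\<lambda>\<epsilon>. norm (riemann_zeta (z + of_real \<epsilon>) / of_real \<epsilon>)) \<longlongrightarrow> norm (deriv riemann_zeta z)) (at_right 0)"
      by (rule tendsto_norm)
    hence "eventually (\<lambda>\<epsilon>. norm (riemann_zeta (z + of_real \<epsilon>) / of_real \<epsilon>) < norm (deriv riemann_zeta z) + 1) (at_right 0)"
      by (rule order_tendstoD) auto
    hence "eventually (\<lambda>\<epsilon>. prime_cos_sum \<theta> \<epsilon> \<le> ln \<epsilon> + (ln (norm (deriv riemann_zeta z) + 1) + K)) (at_right 0)"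
      using eventually_at_right_less[of 0]
    proof eventually_elim
      case (elim \<epsilon>)
      have nz: "riemann_zeta (z + of_real \<epsilon>) \<noteq> 0" using elim by (intro riemann_zeta_nonzero) (auto simp: z_def)
      have pos: "norm (deriv riemann_zeta z) + 1 > 0" using norm_ge_zero[of "deriv riemann_zeta z"] by linarith
      have "norm (riemann_zeta (z + of_real \<epsilon>)) \<le> \<epsilon> * (norm (deriv riemann_zeta z) + 1)"
        using elim by (simp add: norm_divide divide_simps mult_ac)
      hence "ln (norm (riemann_zeta (z + of_real \<epsilon>))) \<le> ln (\<epsilon> * (norm (deriv riemann_zeta z) + 1))"
        using nz elim pos by (subst ln_le_cancel_iff) auto
      also have "\<dots> = ln \<epsilon> + ln (norm (deriv riemann_zeta z) + 1)" using elim pos by (simp add: ln_mult)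
      finally show ?case using K[of \<epsilon> \<theta>] elim unfolding eq by linarith
    qed
    thus ?thesis by (rule zero)
  next
    case False
    have "isCont riemann_zeta z" using diff by (rule field_differentiable_imp_continuous_at)
    hence "((\<lambda>\<epsilon>. riemann_zeta (z + of_real \<epsilon>)) \<longlongrightarrow> riemann_zeta z) (at_right 0)"
      by (rule isCont_tendsto_compose) (auto intro!: tendsto_eq_intros)
    hence "((\<lambda>\<epsilon>. ln (norm (riemann_zeta (z + of_real \<epsilon>)))) \<longlongrightarrow> ln (norm (riemann_zeta z))) (at_right 0)"
      using False by (intro tendsto_ln tendsto_norm) auto
    hence "eventually (\<lambda>\<epsilon>. \<bar>ln (norm (riemann_zeta (z + of_real \<epsilon>))) - ln (norm (riemann_zeta z))\<bar> < 1) (at_right 0)"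
      by (auto simp: tendsto_iff dist_real_def)
    hence "eventually (\<lambda>\<epsilon>. \<bar>prime_cos_sum \<theta> \<epsilon>\<bar> \<le> \<bar>ln (norm (riemann_zeta z))\<bar> + 1 + K) (at_right 0)"
      using eventually_at_right_less[of 0]
    proof eventually_elim
      case (elim \<epsilon>)
      thus ?case using K[of \<epsilon> \<theta>] unfolding eq by linarith
    qed
    thus ?thesis by (rule nonzero)
  qed
qed

lemma ln_at_right_0_less:
  "eventually (\<lambda>\<epsilon>. ln \<epsilon> < (K :: real)) (at_right 0)"
  using ln_at_0 by (simp add: filterlim_at_bot_dense)

text \<open>The classical inequality \<open>3 + 4 * cos x + cos (2 * x) \<ge> 0\<close> rules out a
  zero: the terms \<open>- 3 * ln \<epsilon>\<close> from the pole cannot balance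
  \<open>4 * ln \<epsilon>\<close> from the zero.\<close>

lemma prime_cos_sum_bounded:
  assumes "\<theta> \<noteq> 0"
  obtains K where "eventually (\<lambda>\<epsilon>. \<bar>prime_cos_sum \<theta> \<epsilon>\<bar> \<le> K) (at_right 0)"
  using assms
proof (cases rule: prime_cos_sum_line)
  case (zero K)
  obtain K0 where K0: "eventually (\<lambda>\<epsilon>. \<bar>prime_cos_sum 0 \<epsilon> + ln \<epsilon>\<bar> \<le> K0) (at_right 0)"
    using prime_cos_sum_zero by blast
  \<comment> \<open>At the doubled frequency an upper bound suffices, so a possible zero there does
    no harm.\<close>
  have "\<exists>K2. eventually (\<lambda>\<epsilon>. prime_cos_sum (2 * \<theta>) \<epsilon> \<le> K2) (at_right 0)"
  proof -
    have "2 * \<theta> \<noteq> 0" using assms by simp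
    thus ?thesis
    proof (cases rule: prime_cos_sum_line)
      case (zero K)
      have "eventually (\<lambda>\<epsilon>. prime_cos_sum (2 * \<theta>) \<epsilon> \<le> K) (at_right 0)"
        using zero ln_at_right_0_less[of 0] by eventually_elim linarith
      thus ?thesis by blast
    next
      case (nonzero K)
      have "eventually (\<lambda>\<epsilon>. prime_cos_sum (2 * \<theta>) \<epsilon> \<le> K) (at_right 0)"
        using nonzero by eventually_elim linarith
      thus ?thesis by blast
    qed
  qed
  then obtain K2 where K2: "eventually (\<lambda>\<epsilon>. prime_cos_sum (2 * \<theta>) \<epsilon> \<le> K2) (at_right 0)" by blast
  have "eventually (\<lambda>\<epsilon>. False) (at_right (0::real))"
    using zero K0 K2 ln_at_right_0_less[of "- (3 * K0 + 4 * K + K2)"] eventually_at_right_less[of 0]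
  proof eventually_elim
    case (elim \<epsilon>)
    let ?t = "\<lambda>\<theta> p. if prime p then real p powr (-1 - \<epsilon>) * cos (\<theta> * ln (real p)) else 0"
    have A: "(\<lambda>p. 3 * ?t 0 p + 4 * ?t \<theta> p + ?t (2 * \<theta>) p) sums
        (3 * prime_cos_sum 0 \<epsilon> + 4 * prime_cos_sum \<theta> \<epsilon> + prime_cos_sum (2 * \<theta>) \<epsilon>)"
      using elim by (intro sums_add sums_mult prime_cos_sums)
    have B: "3 * ?t 0 p + 4 * ?t \<theta> p + ?t (2 * \<theta>) p \<ge> 0" for p
    proof -
      have c: "cos (2 * \<theta> * ln (real p)) = 2 * (cos (\<theta> * ln (real p)))\<^sup>2 - 1"
        using cos_double_cos[of "\<theta> * ln (real p)"] by (simp only: mult.assoc)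
      hence "3 * ?t 0 p + 4 * ?t \<theta> p + ?t (2 * \<theta>) p = 
        (if prime p then real p powr (-1 - \<epsilon>) * (2 * (1 + cos (\<theta> * ln (real p)))\<^sup>2) else 0)"
        unfolding c by (simp add: power2_eq_square algebra_simps)
      thus ?thesis by simp
    qed
    have "0 \<le> 3 * prime_cos_sum 0 \<epsilon> + 4 * prime_cos_sum \<theta> \<epsilon> + prime_cos_sum (2 * \<theta>) \<epsilon>"
      by (rule sums_le[OF B sums_zero A])
    thus False using elim by linarith
  qed
  thus ?thesis by simp
qed

section \<open>Abundance of primes whose denominator has a small root\<close>

text \<open>The weight is twice the quantity that \<open>quadratic_small_root\<close> wants to be at
  least 1/4. Expanded into cosines it has constant term at least 2, of which a coincidence
  \<open>e = 2 * d\<close> or \<open>e = - 2 * d\<close> removes 1, while all nonzero frequencies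
  contribute bounded sums. The mean of the weight over the primes is thus at least 1; as the weight
  is at most 8, the primes where it is below 1/2 cannot account for this mean alone.\<close>

lemma not_summable_prime_weight:
  fixes e d :: real
  assumes "d \<noteq> 0"
  defines "w \<equiv> \<lambda>u. (2 + 2 * cos (e * u)) * (1 - cos (2 * d * u))"
  shows "\<not> summable (\<lambda>p. if prime p \<and> w (ln (real p)) \<ge> 1/2 then 1 / real p else 0)"
proof
  define good where "good = (\<lambda>p::nat. w (ln (real p)) \<ge> 1/2)"
  assume "summable (\<lambda>p. if prime p \<and> w (ln (real p)) \<ge> 1/2 then 1 / real p else 0)"
  hence sm: "summable (\<lambda>p. if prime p \<and> good p then 1 / real p else 0)" by (simp add: good_def)
  define G where "G = (\<Sum>p. if prime p \<and> good p then 1 / real p else 0)"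
  obtain K0 where K0: "eventually (\<lambda>\<epsilon>. \<bar>prime_cos_sum 0 \<epsilon> + ln \<epsilon>\<bar> \<le> K0) (at_right 0)"
    using prime_cos_sum_zero by blast
  have bdd: "\<exists>K. \<theta> \<noteq> 0 \<longrightarrow> eventually (\<lambda>\<epsilon>. \<bar>prime_cos_sum \<theta> \<epsilon>\<bar> \<le> K) (at_right 0)" for \<theta>
    using prime_cos_sum_bounded by metis
  obtain K1 where K1: "eventually (\<lambda>\<epsilon>. e \<noteq> 0 \<longrightarrow> \<bar>prime_cos_sum e \<epsilon>\<bar> \<le> K1) (at_right 0)"
    using bdd[of e] by (cases "e = 0") auto
  obtain K2 where K2: "eventually (\<lambda>\<epsilon>. \<bar>prime_cos_sum (2 * d) \<epsilon>\<bar> \<le> K2) (at_right 0)"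
    using bdd[of "2 * d"] assms by auto
  obtain K3 where K3: "eventually (\<lambda>\<epsilon>. e + 2 * d \<noteq> 0 \<longrightarrow> \<bar>prime_cos_sum (e + 2 * d) \<epsilon>\<bar> \<le> K3) (at_right 0)"
    using bdd[of "e + 2 * d"] by (cases "e + 2 * d = 0") auto
  obtain K4 where K4: "eventually (\<lambda>\<epsilon>. e - 2 * d \<noteq> 0 \<longrightarrow> \<bar>prime_cos_sum (e - 2 * d) \<epsilon>\<bar> \<le> K4) (at_right 0)"
    using bdd[of "e - 2 * d"] by (cases "e - 2 * d = 0") auto
  define k where "k = \<bar>K1\<bar> + \<bar>K2\<bar> + \<bar>K3\<bar> + \<bar>K4\<bar>"
  have k: "K1 \<le> k" "K2 \<le> k" "K3 \<le> k" "K4 \<le> k" "K3 + K4 \<le> k" "0 \<le> k" unfolding k_def by auto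
  have "eventually (\<lambda>\<epsilon>. False) (at_right (0::real))"
    using K0 K1 K2 K3 K4 ln_at_right_0_less[of "- K0 - 16 * G - 10 * k"] 
      ln_at_right_0_less[of "-K0"] eventually_at_right_less[of 0]
  proof eventually_elim
    case (elim \<epsilon>)
    let ?t = "\<lambda>\<theta> p. if prime p then real p powr (-1 - \<epsilon>) * cos (\<theta> * ln (real p)) else 0"
    let ?S = "\<lambda>\<theta>. prime_cos_sum \<theta> \<epsilon>"
    have ws: "(\<lambda>p. 2 * ?t 0 p + 2 * ?t e p - 2 * ?t (2 * d) p - ?t (e + 2 * d) p - ?t (e - 2 * d) p) sums
        (2 * ?S 0 + 2 * ?S e - 2 * ?S (2 * d) - ?S (e + 2 * d) - ?S (e - 2 * d))"
      using elim by (intro sums_add sums_diff sums_mult prime_cos_sums)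
    \<comment> \<open>A majorant of the weighted prime series: weight 8 at the good primes, 1/2 at
      all primes.\<close>
    have gs: "(\<lambda>p. 8 * (if prime p \<and> good p then 1 / real p else 0) + 1/2 * ?t 0 p) sums (8 * G + 1/2 * ?S 0)"
      using elim unfolding G_def by (intro sums_add sums_mult prime_cos_sums summable_sums sm)
    have "2 * ?S 0 + 2 * ?S e - 2 * ?S (2 * d) - ?S (e + 2 * d) - ?S (e - 2 * d) \<le> 8 * G + 1/2 * ?S 0"
    proof (rule sums_le[OF _ ws gs])
      fix p
      define u where "u = ln (real p)"
      have w: "w u = 2 + 2 * cos (e * u) - 2 * cos (2 * d * u) - cos ((e + 2 * d) * u) - cos ((e - 2 * d) * u)"
        unfolding w_def by (simp add: distrib_right left_diff_distrib cos_add cos_diff algebra_simps)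
      have "w u \<le> 4 * 2" unfolding w_def
        using cos_le_one[of "e * u"] cos_ge_minus_one[of "2 * d * u"] cos_le_one[of "2 * d * u"] 
        by (intro mult_mono) auto
      hence w8: "w u \<le> 8" by simp
      show "2 * ?t 0 p + 2 * ?t e p - 2 * ?t (2 * d) p - ?t (e + 2 * d) p - ?t (e - 2 * d) p 
        \<le> 8 * (if prime p \<and> good p then 1 / real p else 0) + 1/2 * ?t 0 p"
      proof (cases "prime p")
        case True
        hence p: "real p \<ge> 1" using prime_ge_1_nat by simp
        have "2 * ?t 0 p + 2 * ?t e p - 2 * ?t (2 * d) p - ?t (e + 2 * d) p - ?t (e - 2 * d) p =
          real p powr (-1 - \<epsilon>) * w u"
          using True unfolding w by (simp add: u_def[symmetric] algebra_simps)
        also have "\<dots> \<le> 8 * (if good p then 1 / real p else 0) + 1/2 * real p powr (-1 - \<epsilon>)"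
        proof (cases "good p")
          case True
          have "real p powr (-1 - \<epsilon>) \<le> real p powr (-1)" using p elim by (intro powr_mono) auto
          hence "real p powr (-1 - \<epsilon>) * w u \<le> 1 / real p * 8"
            using w8 True p by (intro mult_mono) (auto simp: powr_minus_divide good_def u_def)
          moreover have "0 \<le> 1/2 * real p powr (-1 - \<epsilon>)" by simp
          ultimately show ?thesis using True by (simp only: if_True)
        next
          case False
          hence "real p powr (-1 - \<epsilon>) * w u \<le> real p powr (-1 - \<epsilon>) * (1/2)"
            by (intro mult_left_mono) (auto simp: good_def u_def)
          thus ?thesis using False by simp
        qed
        finally show ?thesis using True by simp
      qed auto
    qed
    moreover have S0: "?S 0 \<ge> - ln \<epsilon> - K0" "?S 0 \<ge> 0" using elim(1,7) by linarith+
    moreover have "?S (2 * d) \<le> k" using elim(3) k by linarith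
    moreover have "?S e \<ge> - k" 
    proof (cases "e = 0")
      case False
      hence "\<bar>?S e\<bar> \<le> K1" using elim(2) by blast
      thus ?thesis using k(1) by linarith
    qed (use S0 k in auto)
    \<comment> \<open>Because \<open>d \<noteq> 0\<close>, at most one of the two frequencies is 0,
      so at most one divergent sum \<open>?S 0\<close> is lost out of two.\<close>
    moreover have "?S (e + 2 * d) + ?S (e - 2 * d) \<le> ?S 0 + k"
    proof (cases "e + 2 * d = 0")
      case True
      hence "e - 2 * d \<noteq> 0" using assms by auto
      hence "\<bar>?S (e - 2 * d)\<bar> \<le> K4" using elim(5) by blast
      thus ?thesis using k(4) unfolding True by linarith
    next
      case False
      hence 3: "\<bar>?S (e + 2 * d)\<bar> \<le> K3" using elim(4) by blast
      show ?thesis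
      proof (cases "e - 2 * d = 0")
        case True 
        show ?thesis using 3 k(3) unfolding True by linarith
      next
        case False 
        hence "\<bar>?S (e - 2 * d)\<bar> \<le> K4" using elim(5) by blast
        thus ?thesis using 3 k(5) S0 by linarith
      qed
    qed
    ultimately show False using elim(6) k(6) by linarith
  qed
  thus False by simp
qed

text \<open>The bound \<open>exp y \<ge> (y / m) ^ m\<close> with \<open>m = k + 2\<close> leaves a
  factor \<open>j powr (-2)\<close>.\<close>

lemma summable_power_exp:
  fixes \<eta> :: real
  assumes "\<eta> > 0"
  shows "summable (\<lambda>j. real j ^ k * exp (- (real j * \<eta>)))"
proof (rule summable_comparison_test')
  define m where "m = k + 2"
  show "summable (\<lambda>j. (real m / \<eta>) ^ m * real j powr (-2))"
    by (intro summable_mult) (simp add: summable_real_powr_iff)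
  fix j :: nat assume j: "j \<ge> 1"
  define y where "y = real j * \<eta>"
  have y: "y > 0" using j assms by (simp add: y_def)
  have m: "real m > 0" by (simp add: m_def)
  have "y / real m \<le> exp (y / real m)" using exp_ge_add_one_self[of "y / real m"] by linarith
  hence "(y / real m) ^ m \<le> exp (y / real m) ^ m" using y m by (intro power_mono) auto
  also have "\<dots> = exp y" using m by (simp add: exp_of_nat_mult[symmetric])
  finally have "inverse (exp y) \<le> inverse ((y / real m) ^ m)" using y m by (intro le_imp_inverse_le) auto
  hence "exp (- y) \<le> (real m / y) ^ m" by (simp add: exp_minus power_inverse inverse_eq_divide power_divide)
  hence "real j ^ k * exp (- y) \<le> real j ^ k * (real m / y) ^ m" by (intro mult_left_mono) auto
  also have "\<dots> = (real m / \<eta>) ^ m * (real j ^ k / real j ^ m)"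
    unfolding y_def by (simp add: power_divide power_mult_distrib mult_ac)
  also have "real j ^ k / real j ^ m = real j powr (-2)"
    using j unfolding m_def by (simp add: power_add powr_minus_divide power2_eq_square)
  finally show "norm (real j ^ k * exp (- (real j * \<eta>))) \<le> (real m / \<eta>) ^ m * real j powr (-2)"
    by (simp add: y_def)
qed

lemma finite_ln_interval: "finite {p::nat. 0 < p \<and> ln (real p) < x \<and> P p}"
proof (rule finite_subset)
  show "{p::nat. 0 < p \<and> ln (real p) < x \<and> P p} \<subseteq> {..nat \<lceil>exp x\<rceil>}"
  proof safe
    fix p :: nat assume "0 < p" "ln (real p) < x"
    hence "real p < exp x" by (metis exp_less_mono exp_ln of_nat_0_less_iff)
    thus "p \<le> nat \<lceil>exp x\<rceil>" by linarith
  qed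
qed auto

text \<open>A number with logarithm in the j-th window of length \<open>\<eta>\<close> has
  reciprocal at most \<open>exp (- (j * \<eta>))\<close>. If the windows from \<open>j0\<close> on
  held at most \<open>j ^ k\<close> of them, the sum of reciprocals would converge by
  \<open>summable_power_exp\<close>.\<close>

lemma ln_interval_many:
  fixes \<eta> :: real
  assumes ns: "\<not> summable (\<lambda>p::nat. if P p then 1 / real p else 0)"
    and pos: "\<And>p. P p \<Longrightarrow> p > 0" and \<eta>: "\<eta> > 0"
  obtains j where "j \<ge> j0" "card {p. 0 < p \<and> ln (real p) < real (Suc j) * \<eta> \<and> 
      real j * \<eta> \<le> ln (real p) \<and> P p} > j ^ k"
proof (rule ccontr)
  define Q where "Q = (\<lambda>j. {p. 0 < p \<and> ln (real p) < real (Suc j) * \<eta> \<and> real j * \<eta> \<le> ln (real p) \<and> P p})"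
  assume "\<not> thesis"
  note no_thesis = this and thesisI = that
  have le: "card (Q j) \<le> j ^ k" if j: "j \<ge> j0" for j
    using no_thesis thesisI[OF j] unfolding Q_def by (meson not_le)
  define b where "b = (\<lambda>j. real (card (Q j)) * exp (- (real j * \<eta>)))"
  have "summable (\<lambda>j. real j ^ k * exp (- (real j * \<eta>)))" by (rule summable_power_exp[OF \<eta>])
  hence sb: "summable b"
  proof (rule summable_comparison_test'[where N = j0])
    fix j assume "j \<ge> j0"
    hence "real (card (Q j)) \<le> real j ^ k" using le[of j] by (metis of_nat_le_iff of_nat_power)
    thus "norm (b j) \<le> real j ^ k * exp (- (real j * \<eta>))" by (simp add: b_def mult_right_mono)
  qed
  have "summable (\<lambda>p::nat. if P p then 1 / real p else 0)"
  proof (rule summableI_nonneg_bounded)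
    fix n
    define A where "A = {p. p < n \<and> P p}"
    define f where "f = (\<lambda>p::nat. nat \<lfloor>ln (real p) / \<eta>\<rfloor>)"
    have fin: "finite A" by (simp add: A_def)
    have "(\<Sum>p<n. if P p then 1 / real p else 0) = (\<Sum>p\<in>A. 1 / real p)"
      unfolding A_def by (intro sum.mono_neutral_cong_right) auto
    also have "\<dots> = (\<Sum>j\<in>f ` A. \<Sum>p\<in>{p\<in>A. f p = j}. 1 / real p)" by (rule sum.image_gen[OF fin])
    also have "\<dots> \<le> (\<Sum>j\<in>f ` A. b j)"
    proof (rule sum_mono)
      fix j
      have p: "real j * \<eta> \<le> ln (real p)" "ln (real p) < real (Suc j) * \<eta>" "p > 0" if "p \<in> A" "f p = j" for p
      proof -
        show p: "p > 0" using that pos by (auto simp: A_def)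
        hence "ln (real p) / \<eta> \<ge> 0" using \<eta> by simp
        hence "real j \<le> ln (real p) / \<eta>" "ln (real p) / \<eta> < real (Suc j)"
          using that unfolding f_def by linarith+
        thus "real j * \<eta> \<le> ln (real p)" "ln (real p) < real (Suc j) * \<eta>" using \<eta> by (simp_all add: field_simps)
      qed
      have "(\<Sum>p\<in>{p\<in>A. f p = j}. 1 / real p) \<le> (\<Sum>p\<in>{p\<in>A. f p = j}. exp (- (real j * \<eta>)))"
      proof (rule sum_mono)
        fix q assume q: "q \<in> {p\<in>A. f p = j}"
        have "exp (real j * \<eta>) \<le> exp (ln (real q))" using p(1)[of q] q by (subst exp_le_cancel_iff) simp
        also have "exp (ln (real q)) = real q" using p(3)[of q] q by simp
        finally have "exp (real j * \<eta>) \<le> real q" .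
        thus "1 / real q \<le> exp (- (real j * \<eta>))"
          using p(3)[of q] q by (simp add: exp_minus field_simps)
      qed
      also have "\<dots> = real (card {p\<in>A. f p = j}) * exp (- (real j * \<eta>))" by simp
      also have "\<dots> \<le> b j"
      proof -
        have "card {p\<in>A. f p = j} \<le> card (Q j)"
          by (rule card_mono) (use p in \<open>auto simp: Q_def A_def intro: finite_ln_interval\<close>)
        thus ?thesis by (simp add: b_def mult_right_mono)
      qed
      finally show "(\<Sum>p\<in>{p\<in>A. f p = j}. 1 / real p) \<le> b j" .
    qed
    also have "\<dots> \<le> suminf b" using fin by (intro sum_le_suminf sb) (auto simp: b_def)
    finally show "(\<Sum>p<n. if P p then 1 / real p else 0) \<le> suminf b" .
  qed auto
  thus False using ns by blast
qed

section \<open>Zeros of the local denominators\<close>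

text \<open>The two roots have a product of modulus 1, so one lies in the closed unit disc. For
  \<open>v = C * T\<^sup>2\<close> the equation becomes
  \<open>v + 2 + 1 / v = (norm (A + B))\<^sup>2 * (A * B / C)\<close>, because \<open>A\<close> and
  \<open>B\<close> are unimodular. On the unit circle the left side is real, so a sizeable imaginary
  part on the right keeps \<open>v\<close> well inside.\<close>

lemma quadratic_small_root:
  fixes A B C :: complex
  assumes n: "norm A = 1" "norm B = 1" "norm C = 1"
    and w: "(norm (A + B))\<^sup>2 * (Im (A * B / C))\<^sup>2 \<ge> 1/4"
  obtains T where "1 - (A + B) * T + C * T\<^sup>2 = 0" "1/3 \<le> norm T" "(norm T)\<^sup>2 \<le> 9/10"
proof -
  define D where "D = csqrt ((A + B)\<^sup>2 - 4 * C)"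
  have D2: "D\<^sup>2 = (A + B)\<^sup>2 - 4 * C" by (simp add: D_def)
  have C0: "C \<noteq> 0" using n by auto
  define T1 T2 where "T1 = (A + B + D) / (2 * C)" and "T2 = (A + B - D) / (2 * C)"
  have quad: "1 - S * T + C * T\<^sup>2 = 0" if "2 * C * T = S + E" "E\<^sup>2 = S\<^sup>2 - 4 * C" for S T E
  proof -
    have "4 * C * (1 - S * T + C * T\<^sup>2) = 4 * C - 2 * S * (2 * C * T) + (2 * C * T)\<^sup>2" by algebra
    also have "\<dots> = 0" unfolding that(1) using that(2) by algebra
    finally show ?thesis using C0 by simp
  qed
  have root: "1 - (A + B) * T1 + C * T1\<^sup>2 = 0" "1 - (A + B) * T2 + C * T2\<^sup>2 = 0"
    using quad[of T1 "A + B" D] quad[of T2 "A + B" "-D"] C0 D2 by (simp_all add: T1_def T2_def)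
  have "T1 * T2 = ((A + B)\<^sup>2 - D\<^sup>2) / (4 * C * C)"
    using C0 by (simp add: T1_def T2_def field_simps power2_eq_square)
  also have "\<dots> = 1 / C" unfolding D2 using C0 by simp
  finally have "norm T1 * norm T2 = 1" using n by (metis norm_divide norm_mult norm_one div_by_1)
  hence "norm T1 \<le> 1 \<or> norm T2 \<le> 1"
    by (metis less_le_not_le linorder_le_cases mult_less_cancel_left1 norm_ge_zero not_le order.strict_trans1 zero_less_one)
  then obtain T where T: "1 - (A + B) * T + C * T\<^sup>2 = 0" "norm T \<le> 1" using root by blast
  define r where "r = (norm T)\<^sup>2"
  \<comment> \<open>For a smaller root the terms other than 1 would have modulus at most
    \<open>2/3 + 1/9 < 1\<close>. This bound later limits the real part of the zeros from
    above.\<close>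
  have lower: "1/3 \<le> norm T"
  proof (rule ccontr)
    assume "\<not> 1/3 \<le> norm T"
    hence t: "norm T \<le> 1/3" by simp
    have "1 = (A + B) * T - C * T\<^sup>2" using T(1) by (simp add: algebra_simps)
    hence "1 = norm ((A + B) * T - C * T\<^sup>2)" by (metis norm_one)
    also have "\<dots> \<le> norm (A + B) * norm T + norm C * (norm T)\<^sup>2"
      by (metis norm_mult norm_power norm_triangle_ineq4)
    also have "\<dots> \<le> 2 * (1/3) + 1 * (1/3)\<^sup>2"
      using n t norm_triangle_ineq[of A B] by (intro add_mono mult_mono power_mono) auto
    finally show False by (simp add: power2_eq_square)
  qed
  define v where "v = C * T\<^sup>2"
  have nv: "norm v = r" using n by (simp add: v_def r_def norm_mult norm_power)
  have r: "0 < r" "r \<le> 1" using lower T(2) by (auto simp: r_def power_le_one)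
  have v0: "v \<noteq> 0" using nv r by auto
  have "(norm (A + B))\<^sup>2 * (A * B) = (A + B)\<^sup>2"
  proof -
    have c: "A * cnj A = 1" "B * cnj B = 1" using n by (simp_all add: complex_norm_square[symmetric])
    have "of_real ((norm (A + B))\<^sup>2) * (A * B) = (A + B) * (A * cnj A * B + A * (B * cnj B))"
      unfolding complex_norm_square[of "A + B"] by (simp add: algebra_simps)
    also have "\<dots> = (A + B)\<^sup>2" unfolding c by (simp add: power2_eq_square algebra_simps)
    finally show ?thesis by simp
  qed
  moreover have "(1 + v)\<^sup>2 = (A + B)\<^sup>2 * T\<^sup>2"
  proof -
    have "1 + v = (A + B) * T" using T(1) by (simp add: v_def algebra_simps)
    thus ?thesis by (simp add: power_mult_distrib)
  qed
  ultimately have "(1 + v)\<^sup>2 = of_real ((norm (A + B))\<^sup>2) * (A * B / C) * v"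
    using C0 by (simp add: v_def)
  hence "v + 2 + 1 / v = of_real ((norm (A + B))\<^sup>2) * (A * B / C)"
    using v0 by (simp add: power2_eq_square field_simps)
  hence "Im (v + 2 + 1 / v) = Im (of_real ((norm (A + B))\<^sup>2) * (A * B / C))" by (rule arg_cong)
  hence im: "Im v + Im (1 / v) = (norm (A + B))\<^sup>2 * Im (A * B / C)"
    by (simp only: plus_complex.sel Im_complex_of_real times_complex.sel Re_complex_of_real) simp
  have "Im (1 / v) = - Im v / r\<^sup>2" using nv by (simp add: Im_divide cmod_power2[symmetric])
  hence "(norm (A + B))\<^sup>2 * Im (A * B / C) = Im v * (1 - 1 / r\<^sup>2)" using im by (simp add: algebra_simps)
  hence "(norm (A + B))\<^sup>2 * \<bar>Im (A * B / C)\<bar> = \<bar>Im v\<bar> * \<bar>1 - 1 / r\<^sup>2\<bar>"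
    by (metis abs_mult abs_of_nonneg zero_le_power2)
  also have "\<dots> \<le> r * (1 / r\<^sup>2 - 1)"
  proof -
    have "1 / r\<^sup>2 \<ge> 1" using r by (simp add: power_le_one)
    thus ?thesis using abs_Im_le_cmod[of v] nv by (intro mult_mono) auto
  qed
  also have "\<dots> = 1 / r - r" using r by (simp add: power2_eq_square field_simps)
  finally have 1: "(norm (A + B))\<^sup>2 * \<bar>Im (A * B / C)\<bar> \<le> 1 / r - r" .
  have "\<bar>Im (A * B / C)\<bar> \<le> 1" using abs_Im_le_cmod[of "A * B / C"] n by (simp add: norm_mult norm_divide)
  hence "(Im (A * B / C))\<^sup>2 \<le> \<bar>Im (A * B / C)\<bar>"
    using mult_left_le[of "\<bar>Im (A * B / C)\<bar>" "\<bar>Im (A * B / C)\<bar>"] by (simp add: power2_eq_square)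
  hence "(norm (A + B))\<^sup>2 * (Im (A * B / C))\<^sup>2 \<le> (norm (A + B))\<^sup>2 * \<bar>Im (A * B / C)\<bar>"
    by (intro mult_left_mono) auto
  hence "1/4 \<le> 1 / r - r" using w 1 by linarith
  hence "r * (1/4) \<le> r * (1 / r - r)" using r by (intro mult_left_mono) auto
  hence le: "r / 4 + r * r \<le> 1" using r by (simp add: algebra_simps)
  \<comment> \<open>The constant works because \<open>9/40 + 81/100 > 1\<close>.\<close>
  have "r \<le> 9/10"
  proof (rule ccontr)
    assume "\<not> r \<le> 9/10"
    hence "r > 9/10" by simp
    moreover from this have "r * r \<ge> 9/10 * (9/10)" by (intro mult_mono) auto
    ultimately show False using le by simp
  qed
  thus ?thesis using that T lower by (auto simp: r_def)
qed

text \<open>Here \<open>u\<close> stands for \<open>ln p\<close>. It ranges over the reals so that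
  zeros belonging to different primes can be compared by a Taylor expansion in
  \<open>u\<close>.\<close>

definition prime_den :: "complex \<Rightarrow> complex \<Rightarrow> complex \<Rightarrow> real \<Rightarrow> complex \<Rightarrow> complex" where
  "prime_den a b c u s = 1 - (exp (a * of_real u) + exp (b * of_real u)) * exp (- s * of_real u) 
     + exp (c * of_real u) * (exp (- s * of_real u))\<^sup>2"

lemma local_factor_eq_prime_den:
  assumes "p > 0"
  shows "local_factor a b c p s = inverse (prime_den a b c (ln (real p)) s)"
proof -
  have "of_nat p powr z = exp (z * of_real (ln (real p)))" for z :: complex
    using assms by (simp add: powr_def Ln_of_nat)
  moreover have "exp ((c - 2 * s) * x) = exp (c * x) * (exp (- s * x))\<^sup>2" for x :: complex
    by (simp add: exp_double[symmetric] exp_add[symmetric] algebra_simps)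
  ultimately show ?thesis unfolding local_factor_def prime_den_def by simp
qed

text \<open>Since the zeros of one factor form a vertical lattice of step \<open>2 * pi / u\<close>, every horizontal
  strip of height \<open>1\<close> contains one.\<close>
lemma prime_den_zero:
  assumes abc: "Re a = 0" "Re b = 0" "Re c = 0" and u: "u \<ge> 2 * pi"
    and w: "(2 + 2 * cos (Im (a - b) * u)) * (1 - cos (2 * Im (c - a - b) * u)) \<ge> 1/2"
  obtains s where "prime_den a b c u s = 0" "t \<le> Im s" "Im s \<le> t + 1"
    "1 / (20 * u) \<le> Re s" "Re s \<le> 2 / u" "(norm (exp (- s * of_real u)))\<^sup>2 \<le> 9/10"
proof -
  have u0: "u > 0" using u pi_gt_zero by linarith
  define A B C where "A = exp (a * of_real u)" and "B = exp (b * of_real u)" and "C = exp (c * of_real u)"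
  have n: "norm A = 1" "norm B = 1" "norm C = 1" using abc by (simp_all add: A_def B_def C_def)
  have im: "z = \<i> * of_real (Im z)" if "Re z = 0" for z using that by (simp add: complex_eq_iff)
  have "A * B / C = exp ((a + b - c) * of_real u)"
    unfolding A_def B_def C_def by (simp add: exp_add exp_diff algebra_simps)
  hence "Im (A * B / C) = sin (Im (a + b - c) * u)" using abc by (simp add: Im_exp)
  hence i: "(Im (A * B / C))\<^sup>2 = (1 - cos (2 * Im (c - a - b) * u)) / 2"
  proof -
    have "sin (Im (a + b - c) * u) = - sin (Im (c - a - b) * u)"
      by (metis (no_types, opaque_lifting) sin_minus minus_mult_left minus_diff_eq uminus_complex.sel(2) diff_diff_eq)
    moreover have "cos (2 * Im (c - a - b) * u) = 1 - 2 * (sin (Im (c - a - b) * u))\<^sup>2"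
      using cos_double_sin[of "Im (c - a - b) * u"] by (simp only: mult.assoc)
    ultimately show ?thesis using \<open>Im (A * B / C) = _\<close> by simp
  qed
  have ab: "(norm (A + B))\<^sup>2 = 2 + 2 * cos (Im (a - b) * u)"
  proof -
    have "A = Complex (cos (Im a * u)) (sin (Im a * u))" "B = Complex (cos (Im b * u)) (sin (Im b * u))"
      unfolding A_def B_def using abc by (simp_all add: complex_eq_iff Re_exp Im_exp)
    hence "(norm (A + B))\<^sup>2 = (cos (Im a * u) + cos (Im b * u))\<^sup>2 + (sin (Im a * u) + sin (Im b * u))\<^sup>2"
      by (simp add: cmod_power2)
    also have "\<dots> = ((cos (Im a * u))\<^sup>2 + (sin (Im a * u))\<^sup>2) + ((cos (Im b * u))\<^sup>2 + (sin (Im b * u))\<^sup>2)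
       + 2 * (cos (Im a * u) * cos (Im b * u) + sin (Im a * u) * sin (Im b * u))"
      by algebra
    also have "\<dots> = 2 + 2 * cos (Im a * u - Im b * u)" by (simp add: cos_diff)
    finally show ?thesis by (simp add: left_diff_distrib)
  qed
  obtain T where T: "1 - (A + B) * T + C * T\<^sup>2 = 0" "1/3 \<le> norm T" "(norm T)\<^sup>2 \<le> 9/10"
    using quadratic_small_root[OF n] w unfolding ab i by (auto simp: field_simps)
  have T0: "T \<noteq> 0" using T(2) by auto
  \<comment> \<open>This selects the branch of the logarithm of \<open>T\<close>: successive
    branches change \<open>Im s\<close> by \<open>2 * pi / u \<le> 1\<close>, and the ceiling takes
    the first one reaching height \<open>t\<close>.\<close>
  define k where "k = \<lceil>(t * u + Im (Ln T)) / (2 * pi)\<rceil>"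
  define s where "s = (2 * pi * of_int k * \<i> - Ln T) / of_real u"
  have su: "- s * of_real u = Ln T - 2 * pi * of_int k * \<i>" using u0 by (simp add: s_def)
  have e: "exp (- s * of_real u) = T"
  proof -
    have "exp (2 * pi * of_int k * \<i>) = 1" by (metis exp_integer_2pi Ints_of_int mult.commute mult.left_commute)
    thus ?thesis unfolding su using T0 by (simp add: exp_diff)
  qed
  have Re: "Re s = - ln (norm T) / u" and Im: "Im s = (2 * pi * of_int k - Im (Ln T)) / u"
    using u0 T0 by (simp_all add: s_def Re_Ln)
  show ?thesis
  proof (rule that[of s])
    show "prime_den a b c u s = 0" unfolding prime_den_def e using T(1) by (simp add: A_def B_def C_def)
    show "(norm (exp (- s * of_real u)))\<^sup>2 \<le> 9/10" unfolding e by (rule T(3))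
    have k: "(t * u + Im (Ln T)) / (2 * pi) \<le> of_int k" "of_int k \<le> (t * u + Im (Ln T)) / (2 * pi) + 1"
      unfolding k_def by linarith+
    have "t * u + Im (Ln T) \<le> of_int k * (2 * pi)" using k(1) by (simp add: field_simps)
    thus "t \<le> Im s" unfolding Im using u0 by (simp add: field_simps)
    have "of_int k * (2 * pi) \<le> t * u + Im (Ln T) + 2 * pi" using k(2) by (simp add: field_simps)
    hence "2 * pi * of_int k - Im (Ln T) \<le> t * u + u" using u by (simp add: mult.commute)
    thus "Im s \<le> t + 1" unfolding Im using u0 by (simp add: field_simps)
    have "ln ((norm T)\<^sup>2) \<le> (norm T)\<^sup>2 - 1" using T0 by (intro ln_le_minus_one) auto
    hence "1/20 \<le> - ln (norm T)" using T(3) T0 by (simp add: ln_realpow)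
    hence "1/20 / u \<le> - ln (norm T) / u" using u0 by (intro divide_right_mono) auto
    thus "1 / (20 * u) \<le> Re s" unfolding Re by simp
    have "ln (1 / norm T) \<le> 1 / norm T - 1" using T0 by (intro ln_le_minus_one) auto
    also have "1 / norm T \<le> 3" using T(2) T0 by (simp add: field_simps)
    finally have "- ln (norm T) \<le> 2" using T0 by (simp add: ln_div)
    thus "Re s \<le> 2 / u" unfolding Re using u0 by (intro divide_right_mono) auto
  qed
qed

text \<open>At a zero, the derivative in \<open>u\<close> is \<open>- s * (1 - exp ((c - 2 * s) * u))\<close> up to a bounded
  error, so for large \<open>Im s\<close> two zeros \<open>u\<close> and \<open>v\<close> with the same \<open>s\<close> cannot be close.\<close>
lemma prime_den_zeros_separated:
  assumes abc: "Re a = 0" "Re b = 0" "Re c = 0"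
    and z: "prime_den a b c u s = 0" "prime_den a b c v s = 0" and uv: "u \<noteq> v" "u \<ge> 0" "v \<ge> 0"
    and s: "Re s \<ge> 0" "norm s \<le> Q" "norm s \<ge> 10 * (1 + norm a + norm b + norm c)"
    and small: "(norm (exp (- s * of_real u)))\<^sup>2 \<le> 9/10"
  shows "1 \<le> (3 * Q + norm a + norm b + norm c)\<^sup>2 * 3 * \<bar>u - v\<bar>"
proof -
  define M where "M = norm a + norm b + norm c"
  define D where "D = (3 * Q + M)\<^sup>2 * 3"
  have Q: "Q \<ge> 0" using s(2) norm_ge_zero[of s] by linarith
  have M: "M \<ge> 0" "norm a \<le> M" "norm b \<le> M" "norm c \<le> M" by (auto simp: M_def)
  define S where "S = complex_of_real ` {0..}"
  \<comment> \<open>\<open>f i\<close> is the i-th derivative in \<open>x\<close> of minus the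
    denominator; its constant term survives only for \<open>i = 0\<close>.\<close>
  define f where "f = (\<lambda>(i::nat) x. (a - s) ^ i * exp ((a - s) * x) + (b - s) ^ i * exp ((b - s) * x)
     - (c - 2 * s) ^ i * exp ((c - 2 * s) * x) - (if i = 0 then 1 else 0))"
  have conv: "convex S" unfolding S_def
    by (intro convex_linear_image) (auto intro!: bounded_linear.linear bounded_linear_of_real)
  have deriv: "(f i has_field_derivative f (Suc i) x) (at x within S)" for i x
    unfolding f_def by (auto intro!: derivative_eq_intros simp: algebra_simps)
  have e1: "norm (exp (z * x)) \<le> 1" if "x \<in> S" "Re z \<le> 0" for x z
    using that by (auto simp: S_def mult_nonpos_nonneg)
  have le: "norm (a - s) \<le> 3 * Q + M" "norm (b - s) \<le> 3 * Q + M" "norm (c - 2 * s) \<le> 3 * Q + M"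
    using norm_triangle_ineq4[of a s] norm_triangle_ineq4[of b s] norm_triangle_ineq4[of c "2 * s"] s Q M
    by (auto simp: norm_mult)
  have bd: "norm (f (Suc 1) x) \<le> D" if x: "x \<in> S" for x
  proof -
    have t: "norm (z\<^sup>2 * exp (z * x)) \<le> (3 * Q + M)\<^sup>2" if "norm z \<le> 3 * Q + M" "Re z \<le> 0" for z
    proof -
      have "norm (z\<^sup>2 * exp (z * x)) \<le> (3 * Q + M)\<^sup>2 * 1"
        unfolding norm_mult norm_power using that e1[OF x] by (intro mult_mono power_mono) auto
      thus ?thesis by simp
    qed
    have "norm (f (Suc 1) x) \<le> norm ((a - s)\<^sup>2 * exp ((a - s) * x)) + norm ((b - s)\<^sup>2 * exp ((b - s) * x))
      + norm ((c - 2 * s)\<^sup>2 * exp ((c - 2 * s) * x))"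
      unfolding f_def by (simp add: numeral_2_eq_2[symmetric] power2_eq_square[symmetric])
         (meson add_mono norm_triangle_ineq norm_triangle_ineq4 order_refl order_trans)
    also have "\<dots> \<le> (3 * Q + M)\<^sup>2 + (3 * Q + M)\<^sup>2 + (3 * Q + M)\<^sup>2"
      using abc s le by (intro add_mono t) auto
    also have "\<dots> = D" by (simp add: D_def)
    finally show ?thesis .
  qed
  have f0: "f 0 (of_real x) = - prime_den a b c x s" for x
    unfolding f_def prime_den_def
    by (simp add: left_diff_distrib exp_diff exp_minus exp_double[symmetric] field_simps power2_eq_square
        exp_add[symmetric] mult_2)
  \<comment> \<open>The function vanishes at both \<open>u\<close> and \<open>v\<close>, so the
    expansion compares \<open>f 1 u\<close> times the distance with \<open>D\<close> times its
    square.\<close>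
  have "norm (f 0 (of_real v) - (\<Sum>i\<le>1. f i (of_real u) * (of_real v - of_real u) ^ i / fact i))
     \<le> D * norm (of_real v - of_real u :: complex) ^ Suc 1 / fact 1"
    using uv by (intro complex_Taylor[OF conv deriv bd]) (auto simp: S_def)
  also have "D * norm (of_real v - of_real u :: complex) ^ Suc 1 / fact 1 = D * \<bar>u - v\<bar> * \<bar>u - v\<bar>"
    by (auto simp: algebra_simps simp flip: of_real_diff)
  also have "norm (f 0 (of_real v) - (\<Sum>i\<le>1. f i (of_real u) * (of_real v - of_real u) ^ i / fact i))
    = norm (f 1 (of_real u)) * \<bar>u - v\<bar>"
    using z by (simp add: f0 norm_mult abs_minus_commute flip: of_real_diff)
  finally have "norm (f 1 (of_real u)) \<le> D * \<bar>u - v\<bar>" using uv by simp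
  moreover have "norm (f 1 (of_real u)) \<ge> 1"
  proof -
    define A B C where "A = exp ((a - s) * of_real u)" and "B = exp ((b - s) * of_real u)"
      and "C = exp ((c - 2 * s) * of_real u)"
    \<comment> \<open>Vanishing at \<open>u\<close> eliminates \<open>A + B\<close> from the
      derivative. What remains is governed by \<open>s * (1 - C)\<close>, with \<open>C\<close> away
      from 1 and \<open>s\<close> large.\<close>
    have AB: "A + B = 1 + C" using f0[of u] z by (simp add: f_def A_def B_def C_def algebra_simps)
    have "f 1 (of_real u) = a * A + b * B - c * C - s * (A + B - 2 * C)"
      by (simp add: f_def A_def B_def C_def algebra_simps)
    also have "\<dots> = (a * A + b * B - c * C) - s * (1 - C)" unfolding AB by simp
    finally have f1: "f 1 (of_real u) = (a * A + b * B - c * C) - s * (1 - C)" .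
    have "C = exp (c * of_real u) * (exp (- s * of_real u))\<^sup>2"
      by (simp add: C_def exp_double[symmetric] exp_add[symmetric] algebra_simps)
    hence "norm C \<le> 9/10" using small abc by (simp add: norm_mult norm_power)
    hence "norm (1 - C) \<ge> 1/10" using norm_triangle_ineq2[of 1 C] by simp
    hence "norm (s * (1 - C)) \<ge> (10 * (1 + M)) * (1/10)"
      unfolding norm_mult using s M by (intro mult_mono) (auto simp: M_def)
    moreover have "norm (a * A + b * B - c * C) \<le> M"
    proof -
      have "of_real u \<in> S" using uv by (auto simp: S_def)
      hence "norm A \<le> 1" "norm B \<le> 1" "norm C \<le> 1"
        unfolding A_def B_def C_def using abc s uv by (auto intro!: e1)
      hence "norm (a * A) \<le> norm a" "norm (b * B) \<le> norm b" "norm (c * C) \<le> norm c"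
        by (simp_all add: norm_mult mult_left_le)
      thus ?thesis unfolding M_def
        by (meson add_mono norm_triangle_ineq norm_triangle_ineq4 order_trans)
    qed
    ultimately show ?thesis 
      using norm_triangle_ineq2[of "s * (1 - C)" "a * A + b * B - c * C"] unfolding f1
      by (simp add: norm_minus_commute)
  qed
  ultimately show ?thesis unfolding D_def M_def by (simp add: add_ac)
qed

section \<open>Cyclotomic approximation of the local denominators\<close>

text \<open>Adding or subtracting one exponential at a time keeps all coefficients integral. This is
  essential: they become numbers of factors, that is, exponents of zeta functions.\<close>

inductive_set exp_sums :: "complex set \<Rightarrow> (real \<Rightarrow> complex) set" for \<Lambda> where
  zero: "(\<lambda>u. 0) \<in> exp_sums \<Lambda>"
| plus: "f \<in> exp_sums \<Lambda> \<Longrightarrow> \<mu> \<in> \<Lambda> \<Longrightarrow> (\<lambda>u. f u + exp (\<mu> * of_real u)) \<in> exp_sums \<Lambda>"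
| minus: "f \<in> exp_sums \<Lambda> \<Longrightarrow> \<mu> \<in> \<Lambda> \<Longrightarrow> (\<lambda>u. f u - exp (\<mu> * of_real u)) \<in> exp_sums \<Lambda>"

lemma exp_sums_add: "g \<in> exp_sums \<Lambda> \<Longrightarrow> f \<in> exp_sums \<Lambda> \<Longrightarrow> (\<lambda>u. f u + g u) \<in> exp_sums \<Lambda>"
proof (induction g rule: exp_sums.induct)
  case (plus g \<mu>)
  thus ?case using exp_sums.plus[of "\<lambda>u. f u + g u" \<Lambda> \<mu>] by (simp add: add_ac)
next
  case (minus g \<mu>)
  thus ?case using exp_sums.minus[of "\<lambda>u. f u + g u" \<Lambda> \<mu>] by (simp add: algebra_simps)
qed simp

lemma exp_sums_uminus: "f \<in> exp_sums \<Lambda> \<Longrightarrow> (\<lambda>u. - f u) \<in> exp_sums \<Lambda>"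
proof (induction f rule: exp_sums.induct)
  case zero
  show ?case using exp_sums.zero by simp
next
  case (plus g \<mu>)
  thus ?case using exp_sums.minus[of "\<lambda>u. - g u" \<Lambda> \<mu>] by simp
next
  case (minus g \<mu>)
  thus ?case using exp_sums.plus[of "\<lambda>u. - g u" \<Lambda> \<mu>] by (simp add: algebra_simps)
qed

lemma exp_sums_diff: "f \<in> exp_sums \<Lambda> \<Longrightarrow> g \<in> exp_sums \<Lambda> \<Longrightarrow> (\<lambda>u. f u - g u) \<in> exp_sums \<Lambda>"
  using exp_sums_add[OF exp_sums_uminus[of g]] by simp

lemma exp_sums_exp: "\<mu> \<in> \<Lambda> \<Longrightarrow> (\<lambda>u. exp (\<mu> * of_real u)) \<in> exp_sums \<Lambda>"
  using exp_sums.plus[OF exp_sums.zero] by simp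

lemma exp_sums_sum: "(\<And>i. i \<in> I \<Longrightarrow> f i \<in> exp_sums \<Lambda>) \<Longrightarrow> (\<lambda>u. \<Sum>i\<in>I. f i u) \<in> exp_sums \<Lambda>"
  by (induction I rule: infinite_finite_induct) (auto intro: exp_sums.zero exp_sums_add)

lemma exp_sums_mult:
  assumes "\<And>\<mu> \<nu>. \<mu> \<in> \<Lambda>1 \<Longrightarrow> \<nu> \<in> \<Lambda>2 \<Longrightarrow> \<mu> + \<nu> \<in> \<Lambda>" "f \<in> exp_sums \<Lambda>1" "g \<in> exp_sums \<Lambda>2"
  shows "(\<lambda>u. f u * g u) \<in> exp_sums \<Lambda>"
proof -
  have 1: "(\<lambda>u. f u * exp (\<mu> * of_real u)) \<in> exp_sums \<Lambda>" if "\<mu> \<in> \<Lambda>2" for \<mu>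
    using assms(2)
  proof (induction f rule: exp_sums.induct)
    case zero
    show ?case using exp_sums.zero by simp
  next
    case (plus f \<nu>)
    thus ?case using exp_sums.plus[OF plus.IH, of "\<nu> + \<mu>"] assms(1) that by (simp add: ring_distribs exp_add)
  next
    case (minus f \<nu>)
    thus ?case using exp_sums.minus[OF minus.IH, of "\<nu> + \<mu>"] assms(1) that by (simp add: ring_distribs exp_add)
  qed
  show ?thesis using assms(3)
  proof (induction g rule: exp_sums.induct)
    case zero
    show ?case using exp_sums.zero by simp
  next
    case (plus g \<mu>)
    show ?case using exp_sums_add[OF 1[OF plus.hyps(2)] plus.IH] by (simp add: ring_distribs)
  next
    case (minus g \<mu>)
    show ?case using exp_sums_diff[OF minus.IH 1[OF minus.hyps(2)]] by (simp add: ring_distribs)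
  qed
qed

text \<open>Lists record how often a frequency occurs. The positive and the negative terms will
  become factors on the two sides of the factorisation.\<close>

lemma exp_sums_lists:
  assumes "f \<in> exp_sums \<Lambda>"
  obtains L1 L2 where "set L1 \<subseteq> \<Lambda>" "set L2 \<subseteq> \<Lambda>"
    "\<And>u. f u = (\<Sum>\<mu>\<leftarrow>L1. exp (\<mu> * of_real u)) - (\<Sum>\<mu>\<leftarrow>L2. exp (\<mu> * of_real u))"
proof -
  have "\<exists>L1 L2. set L1 \<subseteq> \<Lambda> \<and> set L2 \<subseteq> \<Lambda> \<and>
    (\<forall>u. f u = (\<Sum>\<mu>\<leftarrow>L1. exp (\<mu> * of_real u)) - (\<Sum>\<mu>\<leftarrow>L2. exp (\<mu> * of_real u)))"
    using assms
  proof (induction f rule: exp_sums.induct)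
    case zero
    show ?case by (intro exI[of _ "[]"]) auto
  next
    case (plus f \<mu>)
    then obtain L1 L2 where "set L1 \<subseteq> \<Lambda>" "set L2 \<subseteq> \<Lambda>"
      "\<And>u. f u = (\<Sum>\<mu>\<leftarrow>L1. exp (\<mu> * of_real u)) - (\<Sum>\<mu>\<leftarrow>L2. exp (\<mu> * of_real u))" by blast
    thus ?case using plus.hyps(2) by (intro exI[of _ "\<mu> # L1"] exI[of _ L2]) auto
  next
    case (minus f \<mu>)
    then obtain L1 L2 where "set L1 \<subseteq> \<Lambda>" "set L2 \<subseteq> \<Lambda>"
      "\<And>u. f u = (\<Sum>\<mu>\<leftarrow>L1. exp (\<mu> * of_real u)) - (\<Sum>\<mu>\<leftarrow>L2. exp (\<mu> * of_real u))" by blast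
    thus ?case using minus.hyps(2) by (intro exI[of _ L1] exI[of _ "\<mu> # L2"]) auto
  qed
  thus ?thesis using that by blast
qed

lemma exp_sums_bounded:
  assumes "\<And>\<mu>. \<mu> \<in> \<Lambda> \<Longrightarrow> Re \<mu> = 0" "f \<in> exp_sums \<Lambda>"
  shows "\<exists>B. \<forall>u. norm (f u) \<le> B"
  using assms(2)
proof (induction f rule: exp_sums.induct)
  case (plus f \<mu>)
  then obtain B where "\<And>u. norm (f u) \<le> B" by blast
  hence "norm (f u + exp (\<mu> * of_real u)) \<le> B + 1" for u
    using assms(1)[OF plus.hyps(2)] by (intro norm_triangle_mono) auto
  thus ?case by blast
next
  case (minus f \<mu>)
  then obtain B where "\<And>u. norm (f u) \<le> B" by blast
  moreover have "norm (exp (\<mu> * of_real u)) = 1" for u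
    using assms(1)[OF minus.hyps(2)] by (simp add: norm_exp_eq_Re)
  ultimately have "norm (f u - exp (\<mu> * of_real u)) \<le> B + 1" for u
    using norm_triangle_ineq4[of "f u" "exp (\<mu> * of_real u)"] by (metis add_right_mono order_trans)
  thus ?case by blast
qed auto

section \<open>Frequencies graded by the degree in T\<close>

text \<open>These frequencies can accompany \<open>T ^ n\<close>. Only two features matter later:
  there are at most \<open>(n + 1) ^ 3\<close> of them, and their norm is linear in
  \<open>n\<close>.\<close>

definition freqs :: "complex \<Rightarrow> complex \<Rightarrow> complex \<Rightarrow> nat \<Rightarrow> complex set" where
  "freqs a b c n = (\<lambda>(x, y, z). of_nat x * a + of_nat y * b + of_nat z * c) ` ({..n} \<times> {..n} \<times> {..n})"

lemma freqsI: "x \<le> n \<Longrightarrow> y \<le> n \<Longrightarrow> z \<le> n \<Longrightarrow> of_nat x * a + of_nat y * b + of_nat z * c \<in> freqs a b c n"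
  unfolding freqs_def by (rule image_eqI[of _ _ "(x, y, z)"]) auto

lemma freqs_add:
  assumes "\<mu> \<in> freqs a b c m" "\<nu> \<in> freqs a b c n"
  shows "\<mu> + \<nu> \<in> freqs a b c (m + n)"
proof -
  obtain x y z where 1: "\<mu> = of_nat x * a + of_nat y * b + of_nat z * c" "x \<le> m" "y \<le> m" "z \<le> m"
    using assms(1) unfolding freqs_def by auto
  obtain x' y' z' where 2: "\<nu> = of_nat x' * a + of_nat y' * b + of_nat z' * c" "x' \<le> n" "y' \<le> n" "z' \<le> n"
    using assms(2) unfolding freqs_def by auto
  have "\<mu> + \<nu> = of_nat (x + x') * a + of_nat (y + y') * b + of_nat (z + z') * c"
    by (simp add: 1 2 ring_distribs)
  thus ?thesis using 1 2 by (auto intro!: freqsI simp del: of_nat_add)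
qed

lemma freqs_0: "0 \<in> freqs a b c n"
  using freqsI[of 0 n 0 0 a b c] by simp

lemma Re_freqs: "Re a = 0 \<Longrightarrow> Re b = 0 \<Longrightarrow> Re c = 0 \<Longrightarrow> \<mu> \<in> freqs a b c n \<Longrightarrow> Re \<mu> = 0"
  unfolding freqs_def by auto

lemma norm_freqs_le: 
  assumes "\<mu> \<in> freqs a b c n"
  shows "norm \<mu> \<le> real n * (norm a + norm b + norm c)"
proof -
  obtain x y z where 1: "\<mu> = of_nat x * a + of_nat y * b + of_nat z * c" "x \<le> n" "y \<le> n" "z \<le> n"
    using assms unfolding freqs_def by auto
  have "norm \<mu> \<le> real x * norm a + real y * norm b + real z * norm c"
    unfolding 1 by (intro norm_triangle_mono) (auto simp: norm_mult)
  also have "\<dots> \<le> real n * norm a + real n * norm b + real n * norm c"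
    using 1 by (intro add_mono mult_right_mono) auto
  finally show ?thesis by (simp add: algebra_simps)
qed

text \<open>Tying the frequencies of a coefficient to its degree makes the property stable under
  products; the common degree bound makes later estimates uniform in \<open>u\<close>, hence in the
  prime.\<close>

definition graded :: "complex \<Rightarrow> complex \<Rightarrow> complex \<Rightarrow> (real \<Rightarrow> complex poly) \<Rightarrow> bool" where
  "graded a b c P \<longleftrightarrow> (\<forall>j. (\<lambda>u. coeff (P u) j) \<in> exp_sums (freqs a b c j)) \<and> (\<exists>d. \<forall>u. degree (P u) \<le> d)"

lemma graded_mult: 
  assumes "graded a b c P" "graded a b c Q" 
  shows "graded a b c (\<lambda>u. P u * Q u)"
  unfolding graded_def
proof (intro conjI allI)
  fix j
  have "(\<lambda>u. coeff (P u) i * coeff (Q u) (j - i)) \<in> exp_sums (freqs a b c j)" if "i \<le> j" for i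
    using that assms freqs_add[of _ a b c i _ "j - i"] unfolding graded_def
    by (intro exp_sums_mult[of "freqs a b c i" "freqs a b c (j - i)"]) auto
  thus "(\<lambda>u. coeff (P u * Q u) j) \<in> exp_sums (freqs a b c j)"
    unfolding coeff_mult by (intro exp_sums_sum) auto
next
  obtain d e where "\<And>u. degree (P u) \<le> d" "\<And>u. degree (Q u) \<le> e" using assms unfolding graded_def by blast
  hence "degree (P u * Q u) \<le> d + e" for u by (meson add_mono degree_mult_le order_trans)
  thus "\<exists>d. \<forall>u. degree (P u * Q u) \<le> d" by blast
qed

lemma graded_one_minus_monom:
  assumes "\<mu> \<in> freqs a b c n"
  shows "graded a b c (\<lambda>u. 1 - monom (exp (\<mu> * of_real u)) n)"
  unfolding graded_def
proof (intro conjI allI)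
  fix j
  have 1: "(\<lambda>u::real. coeff (1 :: complex poly) j) \<in> exp_sums (freqs a b c j)"
    using exp_sums_exp[OF freqs_0, of a b c j] exp_sums.zero by (cases "j = 0") simp_all
  have "(\<lambda>u. if n = j then exp (\<mu> * of_real u) else 0) \<in> exp_sums (freqs a b c j)"
    using exp_sums_exp[OF assms] exp_sums.zero by (cases "n = j") simp_all
  from exp_sums_diff[OF 1 this] show "(\<lambda>u. coeff (1 - monom (exp (\<mu> * of_real u)) n) j) \<in> exp_sums (freqs a b c j)"
    by simp
next
  have "degree (1 - monom (exp (\<mu> * of_real u)) n) \<le> n" for u
    by (rule degree_diff_le) (auto simp: degree_monom_le)
  thus "\<exists>d. \<forall>u. degree (1 - monom (exp (\<mu> * of_real u)) n) \<le> d" by blast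
qed

text \<open>For \<open>u = ln p\<close> and \<open>T = p powr (-s)\<close>, a pair
  \<open>(n, \<mu>)\<close> contributes the inverse Euler factor at p of
  \<open>riemann_zeta (n * s - \<mu>)\<close>.\<close>

definition cyc_prod :: "(nat \<times> complex) list \<Rightarrow> real \<Rightarrow> complex poly" where
  "cyc_prod L u = (\<Prod>(n, \<mu>)\<leftarrow>L. 1 - monom (exp (\<mu> * of_real u)) n)"

definition den_poly :: "complex \<Rightarrow> complex \<Rightarrow> complex \<Rightarrow> real \<Rightarrow> complex poly" where
  "den_poly a b c u = [:1, - (exp (a * of_real u) + exp (b * of_real u)), exp (c * of_real u):]"

lemma graded_den_poly: "graded a b c (den_poly a b c)"
  unfolding graded_def
proof (intro conjI allI)
  fix j
  have "a \<in> freqs a b c (Suc 0)" "b \<in> freqs a b c (Suc 0)"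
    using freqsI[of 1 1 0 0 a b c] freqsI[of 0 1 1 0 a b c] by simp_all
  hence 1: "(\<lambda>u. - exp (a * of_real u) - exp (b * of_real u)) \<in> exp_sums (freqs a b c (Suc 0))"
    by (intro exp_sums_diff exp_sums_uminus exp_sums_exp)
  have "c \<in> freqs a b c (Suc (Suc 0))"
    using freqsI[of 0 2 0 1 a b c] by (simp add: numeral_2_eq_2)
  hence 2: "(\<lambda>u. exp (c * of_real u)) \<in> exp_sums (freqs a b c (Suc (Suc 0)))" by (rule exp_sums_exp)
  have 0: "(\<lambda>u. 1) \<in> exp_sums (freqs a b c 0)" using exp_sums_exp[OF freqs_0, of a b c 0] by simp
  show "(\<lambda>u. coeff (den_poly a b c u) j) \<in> exp_sums (freqs a b c j)"
  proof -
    consider "j = 0" | "j = Suc 0" | "j = Suc (Suc 0)" | k where "j = Suc (Suc (Suc k))"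
      by (metis not0_implies_Suc)
    thus ?thesis using 0 1 2 exp_sums.zero by cases (simp_all add: den_poly_def)
  qed
next
  have "degree (den_poly a b c u) \<le> 2" for u unfolding den_poly_def by simp
  thus "\<exists>d. \<forall>u. degree (den_poly a b c u) \<le> d" by blast
qed

lemma graded_cyc_prod:
  assumes "\<And>n \<mu>. (n, \<mu>) \<in> set L \<Longrightarrow> \<mu> \<in> freqs a b c n"
  shows "graded a b c (cyc_prod L)"
  using assms
proof (induction L)
  case Nil
  show ?case using graded_one_minus_monom[OF freqs_0, of a b c 1] exp_sums_exp[OF freqs_0, of a b c 0] exp_sums.zero
    by (auto simp: graded_def cyc_prod_def[abs_def])
next
  case (Cons x L)
  obtain n \<mu> where x: "x = (n, \<mu>)" by (cases x)
  have "graded a b c (\<lambda>u. (1 - monom (exp (\<mu> * of_real u)) n) * cyc_prod L u)"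
    using Cons x by (intro graded_mult graded_one_minus_monom) auto
  thus ?case by (simp add: cyc_prod_def[abs_def] x)
qed

text \<open>A factor \<open>1 - x * T ^ m\<close> first acts in degree m, where it subtracts x times
  the constant coefficient. One degree can thus be corrected without disturbing the lower
  ones.\<close>

lemma coeff_mult_cyc_prod:
  assumes "m > 0"
  shows "(\<forall>j<m. coeff (p * cyc_prod (map (Pair m) M) u) j = coeff p j) \<and>
    coeff (p * cyc_prod (map (Pair m) M) u) m = coeff p m - (\<Sum>\<mu>\<leftarrow>M. exp (\<mu> * of_real u)) * coeff p 0"
proof (induction M arbitrary: p)
  case Nil
  show ?case by (simp add: cyc_prod_def)
next
  case (Cons \<mu> M)
  define q where "q = p * (1 - monom (exp (\<mu> * of_real u)) m)"
  have q: "coeff q j = coeff p j - (if j < m then 0 else exp (\<mu> * of_real u) * coeff p (j - m))" for j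
    unfolding q_def right_diff_distrib by (simp add: mult.commute[of p] coeff_monom_mult)
  have "p * cyc_prod (map (Pair m) (\<mu> # M)) u = q * cyc_prod (map (Pair m) M) u"
    by (simp add: cyc_prod_def q_def mult_ac)
  thus ?case using Cons.IH[of q] assms by (simp add: q algebra_simps)
qed

lemma cyc_prod_append: "cyc_prod (L @ M) u = cyc_prod L u * cyc_prod M u"
  by (simp add: cyc_prod_def)

lemma coeff_0_cyc_prod: "(\<And>n \<mu>. (n, \<mu>) \<in> set L \<Longrightarrow> n > 0) \<Longrightarrow> coeff (cyc_prod L u) 0 = 1"
proof (induction L)
  case (Cons x L)
  thus ?case by (cases x) (auto simp: cyc_prod_def coeff_mult)
qed (simp add: cyc_prod_def)

text \<open>Induction on the degree: both sides are graded, so their discrepancy in degree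
  \<open>Suc N\<close> is an integral sum of exponentials, which further factors of that degree
  cancel. Multiplying both sides avoids inverting power series.\<close>

lemma cyclotomic_factorisation:
  "\<exists>Lp Lm. (\<forall>(n, \<mu>) \<in> set Lp \<union> set Lm. 0 < n \<and> n \<le> N \<and> \<mu> \<in> freqs a b c n) \<and>
    (\<forall>u. \<forall>j\<le>N. coeff (den_poly a b c u * cyc_prod Lm u) j = coeff (cyc_prod Lp u) j)"
proof (induction N)
  case 0
  show ?case by (rule exI[of _ "[]"], rule exI[of _ "[]"]) (auto simp: cyc_prod_def den_poly_def)
next
  case (Suc N)
  then obtain Lp Lm where 
    L: "\<And>n \<mu>. (n, \<mu>) \<in> set Lp \<union> set Lm \<Longrightarrow> 0 < n \<and> n \<le> N \<and> \<mu> \<in> freqs a b c n" and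
    eq: "\<And>u j. j \<le> N \<Longrightarrow> coeff (den_poly a b c u * cyc_prod Lm u) j = coeff (cyc_prod Lp u) j" by blast
  have "graded a b c (\<lambda>u. den_poly a b c u * cyc_prod Lm u)" "graded a b c (cyc_prod Lp)"
    using L by (intro graded_mult graded_den_poly graded_cyc_prod; blast)+
  hence "(\<lambda>u. coeff (den_poly a b c u * cyc_prod Lm u) (Suc N) - coeff (cyc_prod Lp u) (Suc N)) 
    \<in> exp_sums (freqs a b c (Suc N))"
    unfolding graded_def by (intro exp_sums_diff) auto
  then obtain M1 M2 where M: "set M1 \<subseteq> freqs a b c (Suc N)" "set M2 \<subseteq> freqs a b c (Suc N)"
    "\<And>u. coeff (den_poly a b c u * cyc_prod Lm u) (Suc N) - coeff (cyc_prod Lp u) (Suc N) =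
       (\<Sum>\<mu>\<leftarrow>M1. exp (\<mu> * of_real u)) - (\<Sum>\<mu>\<leftarrow>M2. exp (\<mu> * of_real u))"
    by (rule exp_sums_lists) blast
  have 0: "coeff (cyc_prod Lp u) 0 = 1" for u
    using L by (intro coeff_0_cyc_prod) auto
  \<comment> \<open>Factors subtract exponentials, so the positive terms \<open>M1\<close> of the
    discrepancy go to the side of the denominator and the negative terms \<open>M2\<close> to the
    other side.\<close>
  define Lp' Lm' where "Lp' = Lp @ map (Pair (Suc N)) M2" and "Lm' = Lm @ map (Pair (Suc N)) M1"
  have "coeff (den_poly a b c u * cyc_prod Lm' u) j = coeff (cyc_prod Lp' u) j" if "j \<le> Suc N" for u j
  proof -
    define P Q where "P = den_poly a b c u * cyc_prod Lm u" and "Q = cyc_prod Lp u"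
    note 1 = coeff_mult_cyc_prod[of "Suc N" P M1 u]
    note 2 = coeff_mult_cyc_prod[of "Suc N" Q M2 u]
    have P: "den_poly a b c u * cyc_prod Lm' u = P * cyc_prod (map (Pair (Suc N)) M1) u"
      by (simp only: Lm'_def P_def cyc_prod_append mult.assoc)
    have Q: "cyc_prod Lp' u = Q * cyc_prod (map (Pair (Suc N)) M2) u"
      by (simp only: Lp'_def Q_def cyc_prod_append)
    have Q0: "coeff Q 0 = 1" "coeff P 0 = 1" using 0[of u] eq[of 0 u] by (simp_all add: P_def Q_def)
    show ?thesis
    proof (cases "j = Suc N")
      case True
      have "coeff P j - coeff Q j = (\<Sum>\<mu>\<leftarrow>M1. exp (\<mu> * of_real u)) - (\<Sum>\<mu>\<leftarrow>M2. exp (\<mu> * of_real u))"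
        using M(3)[of u] by (simp only: P_def Q_def True)
      hence "coeff P j - (\<Sum>\<mu>\<leftarrow>M1. exp (\<mu> * of_real u)) = coeff Q j - (\<Sum>\<mu>\<leftarrow>M2. exp (\<mu> * of_real u))"
        by algebra
      thus ?thesis using 1 2 Q0 unfolding P Q True by simp
    next
      case False
      hence "j < Suc N" "j \<le> N" using that by auto
      thus ?thesis using 1 2 eq[of j u] unfolding P Q P_def[symmetric] Q_def[symmetric] by simp
    qed
  qed
  moreover have "\<forall>(n, \<mu>) \<in> set Lp' \<union> set Lm'. 0 < n \<and> n \<le> Suc N \<and> \<mu> \<in> freqs a b c n"
    using L M by (fastforce simp: Lp'_def Lm'_def)
  ultimately show ?case by blast
qed

text \<open>The coefficients beyond degree \<open>N\<close> are bounded in \<open>u\<close> because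
  all frequencies are imaginary, and their number is bounded too. Hence one constant
  \<open>K\<close> serves all primes.\<close>

lemma cyclotomic_approximation:
  assumes "Re a = 0" "Re b = 0" "Re c = 0"
  obtains Lp Lm K where "\<And>n \<mu>. (n, \<mu>) \<in> set Lp \<union> set Lm \<Longrightarrow> 0 < n \<and> n \<le> N \<and> \<mu> \<in> freqs a b c n"
    "\<And>u T. norm T \<le> 1 \<Longrightarrow> 
      norm (poly (den_poly a b c u * cyc_prod Lm u) T - poly (cyc_prod Lp u) T) \<le> K * norm T ^ Suc N"
proof -
  obtain Lp Lm where 
    L: "\<And>n \<mu>. (n, \<mu>) \<in> set Lp \<union> set Lm \<Longrightarrow> 0 < n \<and> n \<le> N \<and> \<mu> \<in> freqs a b c n" and
    eq: "\<And>u j. j \<le> N \<Longrightarrow> coeff (den_poly a b c u * cyc_prod Lm u) j = coeff (cyc_prod Lp u) j" 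
    using cyclotomic_factorisation[of N a b c] by blast
  define D where "D = (\<lambda>u. den_poly a b c u * cyc_prod Lm u - cyc_prod Lp u)"
  have g: "graded a b c (\<lambda>u. den_poly a b c u * cyc_prod Lm u)" "graded a b c (cyc_prod Lp)"
    using L by (intro graded_mult graded_den_poly graded_cyc_prod; blast)+
  have "(\<lambda>u. coeff (D u) j) \<in> exp_sums (freqs a b c j)" for j
    using g unfolding graded_def D_def coeff_diff by (intro exp_sums_diff) auto
  hence "\<exists>B. \<forall>u. norm (coeff (D u) j) \<le> B" for j
    by (rule exp_sums_bounded[rotated]) (use Re_freqs assms in blast)
  then obtain B where B: "\<And>j u. norm (coeff (D u) j) \<le> B j" by metis
  obtain d e where "\<And>u. degree (den_poly a b c u * cyc_prod Lm u) \<le> d" "\<And>u. degree (cyc_prod Lp u) \<le> e" 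
    using g unfolding graded_def by blast
  hence deg: "degree (D u) \<le> max d e" for u
    unfolding D_def by (intro degree_diff_le) (auto intro: max.coboundedI1 max.coboundedI2)
  have c0: "coeff (D u) j = 0" if "j \<le> N" for u j using eq[OF that] by (simp add: D_def)
  show ?thesis
  proof (rule that[of Lp Lm "\<Sum>j\<le>max d e. B j"])
    fix u T assume T: "norm (T :: complex) \<le> 1"
    have "poly (D u) T = (\<Sum>j\<le>max d e. coeff (D u) j * T ^ j)"
      unfolding poly_altdef using deg[of u] by (intro sum.mono_neutral_left) (auto simp: coeff_eq_0)
    also have "norm \<dots> \<le> (\<Sum>j\<le>max d e. B j * norm T ^ Suc N)"
    proof (rule sum_norm_le)
      fix j
      have "0 \<le> B j" using B[of 0 j] norm_ge_zero[of "coeff (D 0) j"] by linarith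
      show "norm (coeff (D u) j * T ^ j) \<le> B j * norm T ^ Suc N"
      proof (cases "j \<le> N")
        case True
        thus ?thesis using c0 \<open>0 \<le> B j\<close> by simp
      next
        case False
        hence "norm T ^ j \<le> norm T ^ Suc N" using T by (intro power_decreasing) auto
        thus ?thesis using B[of u j] \<open>0 \<le> B j\<close> unfolding norm_mult norm_power by (intro mult_mono) auto
      qed
    qed
    also have "\<dots> = (\<Sum>j\<le>max d e. B j) * norm T ^ Suc N" by (simp add: sum_distrib_right)
    finally show "norm (poly (den_poly a b c u * cyc_prod Lm u) T - poly (cyc_prod Lp u) T) 
      \<le> (\<Sum>j\<le>max d e. B j) * norm T ^ Suc N" by (simp add: D_def)
  qed (use L in blast)
qed

section \<open>The corrected Euler product\<close>

text \<open>A Weierstrass test for products, with a summable majorant near each point. The second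
  conclusion recovers the value as a limit of partial products even where a factor vanishes.\<close>

lemma holomorphic_prodinf:
  fixes f :: "nat \<Rightarrow> complex \<Rightarrow> complex"
  assumes D: "open D" and hol: "\<And>n. f n holomorphic_on D"
    and bd: "\<And>x. x \<in> D \<Longrightarrow> \<exists>d>0. \<exists>M. cball x d \<subseteq> D \<and> summable M \<and> (\<forall>n. \<forall>z\<in>cball x d. norm (f n z - 1) \<le> M n)"
  shows "(\<lambda>z. \<Prod>n. f n z) holomorphic_on D"
    and "\<And>z. z \<in> D \<Longrightarrow> (\<lambda>n. \<Prod>k\<le>n. f k z) \<longlonglongrightarrow> (\<Prod>n. f n z)"
proof -
  show lim: "(\<lambda>n. \<Prod>k\<le>n. f k z) \<longlonglongrightarrow> (\<Prod>n. f n z)" if z: "z \<in> D" for z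
  proof -
    obtain d M where d: "d > 0" "summable M" "\<And>n w. w \<in> cball z d \<Longrightarrow> norm (f n w - 1) \<le> M n"
      using bd[OF z] by blast
    have "summable (\<lambda>n. norm (f n z - 1))"
      by (rule summable_comparison_test'[OF d(2)]) (use d in auto)
    thus ?thesis
      by (intro convergent_prod_LIMSEQ abs_convergent_prod_imp_convergent_prod summable_imp_abs_convergent_prod)
  qed
  show "(\<lambda>z. \<Prod>n. f n z) holomorphic_on D"
  proof (rule holomorphic_uniform_sequence[OF D])
    show "(\<lambda>z. \<Prod>k<n. f k z) holomorphic_on D" for n by (intro holomorphic_intros hol)
    fix x assume x: "x \<in> D"
    obtain d M where d: "d > 0" "cball x d \<subseteq> D" "summable M" 
      "\<And>n w. w \<in> cball x d \<Longrightarrow> norm (f n w - 1) \<le> M n"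
      using bd[OF x] by blast
    have "uniformly_convergent_on (cball x d) (\<lambda>N z. \<Prod>n<N. f n z)"
    proof (rule uniformly_convergent_on_prod')
      show "continuous_on (cball x d) (f n)" for n
        using holomorphic_on_imp_continuous_on[OF hol] d(2) by (rule continuous_on_subset)
      show "uniformly_convergent_on (cball x d) (\<lambda>N z. \<Sum>n<N. norm (f n z - 1))"
        by (rule Weierstrass_m_test'[OF _ d(3)]) (use d(4) in auto)
    qed auto
    then obtain l where l: "uniform_limit (cball x d) (\<lambda>N z. \<Prod>n<N. f n z) l sequentially"
      unfolding uniformly_convergent_on_def by blast
    have "l z = (\<Prod>n. f n z)" if "z \<in> cball x d" for z
    proof -
      have "(\<lambda>n. \<Prod>k<n. f k z) \<longlonglongrightarrow> l z" using tendsto_uniform_limitI[OF l that] .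
      hence "(\<lambda>n. \<Prod>k\<le>n. f k z) \<longlonglongrightarrow> l z" by (simp add: LIMSEQ_lessThan_iff_atMost)
      thus ?thesis using lim d(2) that LIMSEQ_unique by blast
    qed
    hence "uniform_limit (cball x d) (\<lambda>N z. \<Prod>n<N. f n z) (\<lambda>z. \<Prod>n. f n z) sequentially"
      using l by (subst uniform_limit_cong'[of _ _ _ _ l]) auto
    thus "\<exists>d>0. cball x d \<subseteq> D \<and> uniform_limit (cball x d) (\<lambda>N z. \<Prod>n<N. f n z) (\<lambda>z. \<Prod>n. f n z) sequentially"
      using d by blast
  qed
qed

lemma holomorphic_on_poly:
  fixes P :: "complex poly"
  assumes "g holomorphic_on D"
  shows "(\<lambda>s. poly P (g s)) holomorphic_on D"
proof -
  have "poly P holomorphic_on UNIV"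
    by (auto simp: holomorphic_on_open intro: poly_DERIV)
  from holomorphic_on_compose_gen[OF assms this] show ?thesis by (simp add: o_def)
qed

lemma poly_cyc_prod: "poly (cyc_prod L u) T = (\<Prod>(n, \<mu>)\<leftarrow>L. 1 - exp (\<mu> * of_real u) * T ^ n)"
  by (induction L) (auto simp: cyc_prod_def poly_monom)

lemma poly_den_poly: "poly (den_poly a b c u) (exp (- s * of_real u)) = prime_den a b c u s"
proof -
  have "poly (den_poly a b c u) T = 1 - (exp (a * of_real u) + exp (b * of_real u)) * T + exp (c * of_real u) * T\<^sup>2" for T
    by (simp add: den_poly_def power2_eq_square algebra_simps)
  thus ?thesis by (simp only: prime_den_def)
qed

text \<open>Every factor is 1 minus a number of modulus at most \<open>\<rho>\<close>. The bound
  does not depend on \<open>u\<close>, so division by \<open>cyc_prod\<close> costs a constant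
  uniform in the prime.\<close>

lemma norm_poly_cyc_prod_ge:
  assumes "\<And>n \<mu>. (n, \<mu>) \<in> set L \<Longrightarrow> 0 < n \<and> Re \<mu> = 0" "norm T \<le> \<rho>" "\<rho> < 1"
  shows "norm (poly (cyc_prod L u) T) \<ge> (1 - \<rho>) ^ length L"
  using assms(1) unfolding poly_cyc_prod
proof (induction L)
  case (Cons x L)
  obtain n \<mu> where x: "x = (n, \<mu>)" by (cases x)
  have n: "0 < n" "Re \<mu> = 0" using Cons.prems x by auto
  have "norm (exp (\<mu> * of_real u) * T ^ n) = norm T ^ n" using n by (simp add: norm_mult norm_power)
  also have "\<dots> \<le> norm T ^ 1" using n assms by (intro power_decreasing) auto
  finally have "1 - \<rho> \<le> norm (1 - exp (\<mu> * of_real u) * T ^ n)"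
    using norm_triangle_ineq2[of 1 "exp (\<mu> * of_real u) * T ^ n"] assms by simp
  hence "(1 - \<rho>) * (1 - \<rho>) ^ length L \<le> norm (1 - exp (\<mu> * of_real u) * T ^ n) * 
    norm (\<Prod>(n, \<mu>)\<leftarrow>L. 1 - exp (\<mu> * of_real u) * T ^ n)"
    using Cons assms by (intro mult_mono) auto
  thus ?case by (simp add: x norm_mult)
qed simp

lemma norm_prime_exp:
  assumes "prime p" "Re s \<ge> \<sigma>" "\<sigma> > 0"
  shows "norm (exp (- s * of_real (ln (real p)))) \<le> real p powr (-\<sigma>)" "real p powr (-\<sigma>) \<le> 2 powr (-\<sigma>)"
proof -
  have p: "real p \<ge> 2" using prime_ge_2_nat[OF assms(1)] by simp
  have "norm (exp (- s * of_real (ln (real p)))) = real p powr (- Re s)" using p by (simp add: powr_def)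
  also have "\<dots> \<le> real p powr (-\<sigma>)" using p assms by (intro powr_mono) auto
  finally show "norm (exp (- s * of_real (ln (real p)))) \<le> real p powr (-\<sigma>)" .
  show "real p powr (-\<sigma>) \<le> 2 powr (-\<sigma>)" using p assms by (intro powr_mono2') auto
qed

text \<open>Here \<open>norm T \<le> 1/4\<close>, and \<open>2 * (1/4) + 1/16 < 1\<close>. Beyond
  abscissa 2 the default \<open>inverse 0 = 0\<close> therefore never enters the local
  factors.\<close>

lemma prime_den_nonzero:
  assumes "prime p" "Re a = 0" "Re b = 0" "Re c = 0" "Re s > 2"
  shows "prime_den a b c (ln (real p)) s \<noteq> 0"
proof
  define A B C T where "A = exp (a * of_real (ln (real p)))" and "B = exp (b * of_real (ln (real p)))" 
    and "C = exp (c * of_real (ln (real p)))" and "T = exp (- s * of_real (ln (real p)))"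
  assume "prime_den a b c (ln (real p)) s = 0"
  hence "1 = (A + B) * T - C * T\<^sup>2" unfolding prime_den_def A_def B_def C_def T_def by (simp add: algebra_simps)
  hence "1 = norm ((A + B) * T - C * T\<^sup>2)" by (metis norm_one)
  also have "\<dots> \<le> norm (A + B) * norm T + norm C * (norm T)\<^sup>2"
    by (metis norm_mult norm_power norm_triangle_ineq4)
  also have "\<dots> \<le> 2 * (1/4) + 1 * (1/4)\<^sup>2"
  proof -
    have "norm T \<le> 2 powr (-2)" 
      using norm_prime_exp[OF assms(1), of 2 s] assms(5) unfolding T_def by linarith
    hence "norm T \<le> 1/4" by (simp add: powr_minus_divide)
    moreover have "norm A = 1" "norm B = 1" "norm C = 1" using assms by (simp_all add: A_def B_def C_def)
    ultimately show ?thesis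
      using norm_triangle_ineq[of A B] by (intro add_mono mult_mono power_mono) auto
  qed
  finally show False by (simp add: power2_eq_square)
qed

lemma euler_product_cyc_prod:
  assumes "\<And>n \<mu>. (n, \<mu>) \<in> set L \<Longrightarrow> 0 < n \<and> Re \<mu> = 0" "Re s > 1"
  shows "(\<lambda>m. (\<Prod>(n, \<mu>)\<leftarrow>L. riemann_zeta (of_nat n * s - \<mu>)) * 
     (\<Prod>p\<le>m. if prime p then poly (cyc_prod L (ln (real p))) (exp (- s * of_real (ln (real p)))) else 1)) \<longlonglongrightarrow> 1"
  using assms(1)
proof (induction L)
  case Nil
  have "(if P then poly (cyc_prod [] u) T else 1) = 1" for P u T by (auto simp: cyc_prod_def)
  thus ?case by simp
next
  case (Cons x L)
  obtain n \<mu> where x: "x = (n, \<mu>)" by (cases x)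
  have n: "0 < n" "Re \<mu> = 0" using Cons.prems x by auto
  define w where "w = of_nat n * s - \<mu>"
  have "1 * 1 < real n * Re s" using n assms(2) by (intro mult_le_less_imp_less) auto
  hence w: "Re w > 1" using n by (simp add: w_def)
  let ?F = "\<lambda>p. poly (cyc_prod L (ln (real p))) (exp (- s * of_real (ln (real p))))"
  have e: "(if prime p then poly (cyc_prod (x # L) (ln (real p))) (exp (- s * of_real (ln (real p)))) else 1)
     = (if prime p then 1 - of_nat p powr (-w) else 1) * (if prime p then ?F p else 1)" for p
  proof (cases "prime p")
    case True
    hence "of_nat p powr (-w) = exp (\<mu> * of_real (ln (real p))) * exp (- s * of_real (ln (real p))) ^ n"
      by (simp add: powr_def Ln_of_nat prime_gt_0_nat w_def exp_of_nat_mult[symmetric] exp_add[symmetric] algebra_simps)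
    thus ?thesis using True by (simp add: poly_cyc_prod x)
  qed simp
  have "(\<lambda>m. (riemann_zeta w * (\<Prod>p\<le>m. if prime p then 1 - of_nat p powr (-w) else 1)) *
     ((\<Prod>(n, \<mu>)\<leftarrow>L. riemann_zeta (of_nat n * s - \<mu>)) * (\<Prod>p\<le>m. if prime p then ?F p else 1))) \<longlonglongrightarrow> 1 * 1"
    using Cons by (intro tendsto_mult euler_product_tendsto[OF w]) auto
  thus ?case unfolding e prod.distrib by (simp add: x w_def mult_ac)
qed

text \<open>\<open>H\<close> is the product over the primes of the errors of the cyclotomic
  approximation. It converges further left than the Euler product and retains every local
  denominator as a factor, hence all their zeros.\<close>

lemma correction_product:
  assumes abc: "Re a = 0" "Re b = 0" "Re c = 0"
  obtains Lp Lm H where 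
    "\<And>n \<mu>. (n, \<mu>) \<in> set Lp \<union> set Lm \<Longrightarrow> 0 < n \<and> n \<le> N \<and> \<mu> \<in> freqs a b c n"
    "H holomorphic_on {s. Re s > 1 / real (Suc N)}"
    "\<And>s. Re s > 2 \<Longrightarrow> euler_Z a b c s * (H s * (\<Prod>(n, \<mu>)\<leftarrow>Lm. riemann_zeta (of_nat n * s - \<mu>)))
        = (\<Prod>(n, \<mu>)\<leftarrow>Lp. riemann_zeta (of_nat n * s - \<mu>))"
    "\<And>p s. prime p \<Longrightarrow> Re s > 1 / real (Suc N) \<Longrightarrow> prime_den a b c (ln (real p)) s = 0 \<Longrightarrow> H s = 0"
proof -
  obtain Lp Lm K where L: "\<And>n \<mu>. (n, \<mu>) \<in> set Lp \<union> set Lm \<Longrightarrow> 0 < n \<and> n \<le> N \<and> \<mu> \<in> freqs a b c n"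
    and K: "\<And>u T. norm T \<le> 1 \<Longrightarrow> 
      norm (poly (den_poly a b c u * cyc_prod Lm u) T - poly (cyc_prod Lp u) T) \<le> K * norm T ^ Suc N"
    using cyclotomic_approximation[OF abc, of N] by metis
  have L0: "0 < n \<and> Re \<mu> = 0" if "(n, \<mu>) \<in> set Lp \<union> set Lm" for n \<mu>
    using L[OF that] Re_freqs abc by blast
  have K0: "K \<ge> 0" using order_trans[OF norm_ge_zero K[of 1 1]] by simp
  define T :: "nat \<Rightarrow> complex \<Rightarrow> complex" where "T = (\<lambda>p s. exp (- s * of_real (ln (real p))))"
  have den: "poly (den_poly a b c (ln (real p))) (T p s) = prime_den a b c (ln (real p)) s" for p s
    unfolding T_def by (rule poly_den_poly)
  define D where "D = {s. Re s > 1 / real (Suc N)}"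
  \<comment> \<open>By \<open>cyclotomic_approximation\<close> this ratio is 1 up to order
    \<open>norm (T p s) ^ Suc N\<close>; its denominator has no zero in
    \<open>Re s > 0\<close>.\<close>
  define r where "r = (\<lambda>p s. if prime p then poly (den_poly a b c (ln (real p)) * cyc_prod Lm (ln (real p))) (T p s) 
     / poly (cyc_prod Lp (ln (real p))) (T p s) else 1)"
  have nz: "poly (cyc_prod Lp (ln (real p))) (T p s) \<noteq> 0" if "prime p" "Re s > 0" for p s
  proof -
    have "2 powr (- Re s) < (1::real)" using that by (simp add: powr_less_one)
    moreover have "norm (T p s) \<le> 2 powr (- Re s)"
      using norm_prime_exp[OF that(1) order_refl that(2)] unfolding T_def by linarith
    ultimately have "(1 - 2 powr (- Re s)) ^ length Lp \<le> norm (poly (cyc_prod Lp (ln (real p))) (T p s))"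
      "(1 - 2 powr (- Re s)) ^ length Lp > 0"
      using L0 by (auto intro!: norm_poly_cyc_prod_ge zero_less_power)
    thus ?thesis by auto
  qed
  have Dpos: "Re s > 0" if "s \<in> D" for s
    using that unfolding D_def by (auto intro: less_trans[of 0 "1 / real (Suc N)"])
  have hol_r: "r p holomorphic_on D" for p
  proof (cases "prime p")
    case True
    have eq: "r p = (\<lambda>s. poly (den_poly a b c (ln (real p)) * cyc_prod Lm (ln (real p))) (T p s) 
       / poly (cyc_prod Lp (ln (real p))) (T p s))" using True by (simp add: r_def)
    have "T p holomorphic_on D" unfolding T_def by (intro holomorphic_intros)
    thus ?thesis unfolding eq 
      using nz[OF True] Dpos by (intro holomorphic_on_divide holomorphic_on_poly) auto
  next
    case False
    hence "r p = (\<lambda>_. 1)" by (simp add: r_def)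
    thus ?thesis by simp
  qed
  have bd: "\<exists>d>0. \<exists>M. cball x d \<subseteq> D \<and> summable M \<and> (\<forall>p. \<forall>z\<in>cball x d. norm (r p z - 1) \<le> M p)"
    if x: "x \<in> D" for x
  proof -
    \<comment> \<open>Halfway between \<open>Re x\<close> and the boundary, so that
      \<open>\<sigma> * Suc N > 1\<close> and the majorant is summable over the primes.\<close>
    define \<sigma> where "\<sigma> = (Re x + 1 / real (Suc N)) / 2"
    have \<sigma>: "1 / real (Suc N) < \<sigma>" "\<sigma> < Re x" using x unfolding \<sigma>_def D_def by auto
    have \<sigma>0: "\<sigma> > 0" using \<sigma>(1) by (auto intro: less_trans[of 0 "1 / real (Suc N)"])
    define M where "M = (\<lambda>p::nat. K / (1 - 2 powr (-\<sigma>)) ^ length Lp * real p powr (- (\<sigma> * real (Suc N))))"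
    have lt1: "2 powr (-\<sigma>) < (1::real)" using \<sigma>0 by (simp add: powr_less_one)
    have Re: "Re z \<ge> \<sigma>" if "z \<in> cball x (Re x - \<sigma>)" for z
      using that abs_Re_le_cmod[of "x - z"] by (auto simp: dist_norm)
    have "1 < \<sigma> * real (Suc N)" using \<sigma>(1) by (simp add: field_simps)
    hence "summable M" unfolding M_def by (intro summable_mult) (simp add: summable_real_powr_iff)
    moreover have "norm (r p z - 1) \<le> M p" if z: "z \<in> cball x (Re x - \<sigma>)" for p z
    proof (cases "prime p")
      case True
      define t where "t = T p z"
      have t: "norm t \<le> real p powr (-\<sigma>)" "norm t \<le> 2 powr (-\<sigma>)" 
        using norm_prime_exp[OF True Re[OF z] \<sigma>0] unfolding t_def T_def by linarith+
      have nz': "poly (cyc_prod Lp (ln (real p))) t \<noteq> 0"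
        unfolding t_def by (rule nz[OF True]) (use Re[OF z] \<sigma>0 in linarith)
      have "r p z - 1 = (poly (den_poly a b c (ln (real p)) * cyc_prod Lm (ln (real p))) t 
          - poly (cyc_prod Lp (ln (real p))) t) / poly (cyc_prod Lp (ln (real p))) t"
        using True nz' by (simp add: r_def t_def diff_divide_distrib)
      also have "norm \<dots> \<le> K * norm t ^ Suc N / (1 - 2 powr (-\<sigma>)) ^ length Lp"
        unfolding norm_divide using t lt1 L0 K0
        by (intro frac_le K norm_poly_cyc_prod_ge mult_nonneg_nonneg zero_less_power) auto
      also have "\<dots> \<le> K * (real p powr (-\<sigma>)) ^ Suc N / (1 - 2 powr (-\<sigma>)) ^ length Lp"
        using t lt1 K0 by (intro divide_right_mono mult_left_mono power_mono zero_le_power) auto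
      also have "(real p powr (-\<sigma>)) ^ Suc N = real p powr (- (\<sigma> * real (Suc N)))"
        using prime_gt_0_nat[OF True] by (subst powr_realpow[symmetric]) (auto simp: powr_powr)
      finally show ?thesis by (simp add: M_def)
    next
      case False
      thus ?thesis using K0 lt1 by (simp add: r_def M_def)
    qed
    moreover have "cball x (Re x - \<sigma>) \<subseteq> D" using Re \<sigma>(1) unfolding D_def by force
    ultimately show ?thesis using \<sigma>(2) by (intro exI[of _ "Re x - \<sigma>"]) auto
  qed
  have D: "open D" unfolding D_def by (rule open_Re_gt)
  define H where "H = (\<lambda>s. \<Prod>p. r p s)"
  have holH: "H holomorphic_on D" unfolding H_def by (rule holomorphic_prodinf(1)[OF D hol_r bd])
  have Hlim: "(\<lambda>n. \<Prod>k\<le>n. r k s) \<longlonglongrightarrow> H s" if "s \<in> D" for s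
    unfolding H_def by (rule holomorphic_prodinf(2)[of D r, OF D hol_r _ that]) (rule bd)
  show ?thesis
  proof (rule that[of Lp Lm H])
    show "H holomorphic_on {s. Re s > 1 / real (Suc N)}" using holH by (simp add: D_def)
  next
    fix p s assume p: "prime p" "Re s > 1 / real (Suc N)" "prime_den a b c (ln (real p)) s = 0"
    hence "r p s = 0" by (simp add: r_def den)
    hence 0: "(\<Prod>k\<le>n. r k s) = 0" if "n \<ge> p" for n using that by (intro prod_zero) auto
    have "eventually (\<lambda>n. (\<Prod>k\<le>n. r k s) = 0) sequentially"
      by (rule eventually_mono[OF eventually_ge_at_top[of p] 0])
    hence "(\<lambda>n. \<Prod>k\<le>n. r k s) \<longlonglongrightarrow> 0" by (rule tendsto_eventually)
    moreover have "(\<lambda>n. \<Prod>k\<le>n. r k s) \<longlonglongrightarrow> H s" using p(2) by (intro Hlim) (simp add: D_def)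
    ultimately show "H s = 0" by (rule LIMSEQ_unique[symmetric])
  next
    fix s assume s: "Re s > 2"
    have sD: "s \<in> D" 
    proof -
      have "1 / real (Suc N) \<le> 1" by simp
      hence "1 / real (Suc N) < Re s" using s by linarith
      thus ?thesis by (simp only: D_def mem_Collect_eq)
    qed
    let ?E = "\<lambda>L m. \<Prod>p\<le>m. if prime p then poly (cyc_prod L (ln (real p))) (exp (- s * of_real (ln (real p)))) else 1"
    let ?Z = "\<lambda>L. \<Prod>(n, \<mu>)\<leftarrow>L. riemann_zeta (of_nat n * s - \<mu>)"
    let ?F = "\<lambda>m. \<Prod>p\<le>m. if prime p then local_factor a b c p s else 1"
    have Z: "?F \<longlonglongrightarrow> euler_Z a b c s"
      unfolding euler_Z_def using abs_convergent_euler_Z[OF abc, of s] s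
      by (intro convergent_prod_LIMSEQ abs_convergent_prod_imp_convergent_prod) auto
    have Lp: "(\<lambda>m. ?Z Lp * ?E Lp m) \<longlonglongrightarrow> 1" and Lm: "(\<lambda>m. ?Z Lm * ?E Lm m) \<longlonglongrightarrow> 1"
      using L0 s by (intro euler_product_cyc_prod; auto)+
    have "(\<lambda>m. (?F m * ((\<Prod>p\<le>m. r p s) * ?Z Lm)) * (?Z Lp * ?E Lp m)) \<longlonglongrightarrow> (euler_Z a b c s * (H s * ?Z Lm)) * 1"
      by (intro tendsto_mult Z Lp tendsto_const Hlim sD)
    moreover have "(?F m * ((\<Prod>p\<le>m. r p s) * ?Z Lm)) * (?Z Lp * ?E Lp m) = ?Z Lp * (?Z Lm * ?E Lm m)" for m
    proof -
      \<comment> \<open>The identity holds factor by factor, since neither \<open>prime_den\<close>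
        nor \<open>cyc_prod Lp\<close> vanishes at a prime for \<open>Re s > 2\<close>.\<close>
      have "?F m * (\<Prod>p\<le>m. r p s) * ?E Lp m = ?E Lm m"
        unfolding prod.distrib[symmetric]
      proof (rule prod.cong)
        fix p
        have Tps: "exp (- s * of_real (ln (real p))) = T p s" by (simp only: T_def)
        show "(if prime p then local_factor a b c p s else 1) * r p s * 
           (if prime p then poly (cyc_prod Lp (ln (real p))) (exp (- s * of_real (ln (real p)))) else 1) =
           (if prime p then poly (cyc_prod Lm (ln (real p))) (exp (- s * of_real (ln (real p)))) else 1)"
          using nz[of p s] prime_den_nonzero[OF _ abc s, of p] s unfolding Tps
          by (auto simp: r_def local_factor_eq_prime_den prime_gt_0_nat den)
      qed simp
      thus ?thesis by (metis (no_types, lifting) mult.assoc mult.left_commute)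
    qed
    ultimately have "(\<lambda>m. ?Z Lp * (?Z Lm * ?E Lm m)) \<longlonglongrightarrow> euler_Z a b c s * (H s * ?Z Lm)" by simp
    moreover have "(\<lambda>m. ?Z Lp * (?Z Lm * ?E Lm m)) \<longlonglongrightarrow> ?Z Lp * 1" by (intro tendsto_mult tendsto_const Lm)
    ultimately show "euler_Z a b c s * (H s * ?Z Lm) = ?Z Lp" using LIMSEQ_unique by force
  qed (use L in blast)
qed

section \<open>Zeros of local denominators and singularities of the continuation\<close>

text \<open>Removing the sparse singularities of \<open>F\<close> and the finite set
  \<open>X\<close> leaves a connected open set, to which the identity theorem applies. At a singular
  point the value of \<open>F\<close> is arbitrary, so the conclusion is confined to points of
  analyticity.\<close>

lemma meromorphic_identity:
  assumes F: "F meromorphic_on UNIV" and D: "open D" "connected D" and X: "finite X"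
    and G: "G1 holomorphic_on D - X" "G2 holomorphic_on D - X"
    and \<xi>: "\<xi> \<in> D" "eventually (\<lambda>z. F z * G1 z = G2 z) (at \<xi>)"
    and z: "z \<in> D - X" "F analytic_on {z}"
  shows "F z * G1 z = G2 z"
proof -
  define Y where "Y = {w. \<not> F analytic_on {w}} \<union> X"
  have Y: "Y sparse_in UNIV" unfolding Y_def
    by (intro sparse_in_union' meromorphic_on_imp_sparse_singularities F finite_imp_sparse X)
  hence YD: "Y sparse_in D" by (rule sparse_in_subset) simp
  have V: "open (D - Y)" "connected (D - Y)"
    using D YD by (auto intro!: open_diff_sparse_pts sparse_imp_connected)
  have "F analytic_on (D - Y)" by (subst analytic_on_analytic_at) (auto simp: Y_def)
  hence holF: "F holomorphic_on D - Y" by (rule analytic_imp_holomorphic)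
  have holG: "G1 holomorphic_on D - Y" "G2 holomorphic_on D - Y"
    using G by (auto intro: holomorphic_on_subset simp: Y_def)
  obtain S where S: "open S" "\<xi> \<in> S" "\<And>z. z \<in> S \<Longrightarrow> z \<noteq> \<xi> \<Longrightarrow> F z * G1 z = G2 z"
    using \<xi>(2) unfolding eventually_at_topological by blast
  have "eventually (\<lambda>w. w \<notin> Y) (at \<xi>)"
    using eventually_not_in_cosparse[OF Y] by (rule eventually_cosparse_imp_eventually_at) simp
  moreover have "eventually (\<lambda>w. w \<in> (S \<inter> D) - {\<xi>}) (at \<xi>)"
    using S D \<xi>(1) by (intro eventually_at_in_open) auto
  ultimately have "eventually (\<lambda>w. w \<in> (S - {\<xi>}) \<inter> (D - Y)) (at \<xi>)"
    by eventually_elim auto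
  hence ne: "(S - {\<xi>}) \<inter> (D - Y) \<noteq> {}" using eventually_happens[of _ "at \<xi>"] by auto
  show ?thesis
  proof (rule analytic_continuation_open[of "(S - {\<xi>}) \<inter> (D - Y)" "D - Y" "\<lambda>z. F z * G1 z" G2])
    show "open ((S - {\<xi>}) \<inter> (D - Y))" using S V by (intro open_Int open_delete) auto
    show "(\<lambda>z. F z * G1 z) holomorphic_on D - Y" by (intro holomorphic_intros holF holG)
  qed (use V ne holG S z in \<open>auto simp: Y_def\<close>)
qed

lemma holomorphic_zeta_prod_list:
  assumes "\<And>n \<mu> s. (n, \<mu>) \<in> set L \<Longrightarrow> s \<in> A \<Longrightarrow> of_nat n * s - \<mu> \<noteq> 1"
  shows "(\<lambda>s. \<Prod>(n, \<mu>)\<leftarrow>L. riemann_zeta (of_nat n * s - \<mu>)) holomorphic_on A"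
  using assms
proof (induction L)
  case (Cons x L)
  obtain n \<mu> where x: "x = (n, \<mu>)" by (cases x)
  have "(riemann_zeta \<circ> (\<lambda>s. of_nat n * s - \<mu>)) holomorphic_on A"
    by (rule holomorphic_on_compose_gen[OF _ holomorphic_riemann_zeta])
       (use Cons.prems x in \<open>auto intro!: holomorphic_intros\<close>)
  moreover have "(\<lambda>s. \<Prod>(n, \<mu>)\<leftarrow>L. riemann_zeta (of_nat n * s - \<mu>)) holomorphic_on A"
    using Cons by auto
  ultimately show ?case by (auto simp: x o_def intro!: holomorphic_on_mult)
qed simp

text \<open>Where \<open>F\<close> is analytic and no zeta factor has its pole,
  \<open>H s = 0\<close> forces the product over \<open>Lp\<close> to vanish, so one of its zeta
  factors does. The remaining case is a pole \<open>of_nat n * s - \<mu> = 1\<close>.\<close>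

lemma prime_den_zero_cases:
  assumes abc: "Re a = 0" "Re b = 0" "Re c = 0" and F: "F meromorphic_on UNIV"
    and eq: "\<forall>\<^sub>\<approx>s\<in>{s. Re s > 1}. F s = euler_Z a b c s"
    and s: "F analytic_on {s}" "Re s > 1 / real (Suc N)" "prime p" "prime_den a b c (ln (real p)) s = 0"
  obtains n \<mu> where "0 < n" "n \<le> N" "\<mu> \<in> freqs a b c n" 
    "of_nat n * s - \<mu> = 1 \<or> zeta_reg (of_nat n * s - \<mu>) = 0"
proof -
  obtain Lp Lm H where 
    L: "\<And>n \<mu>. (n, \<mu>) \<in> set Lp \<union> set Lm \<Longrightarrow> 0 < n \<and> n \<le> N \<and> \<mu> \<in> freqs a b c n"
    and holH: "H holomorphic_on {s. Re s > 1 / real (Suc N)}"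
    and H_eq: "\<And>s. Re s > 2 \<Longrightarrow> euler_Z a b c s * (H s * (\<Prod>(n, \<mu>)\<leftarrow>Lm. riemann_zeta (of_nat n * s - \<mu>)))
        = (\<Prod>(n, \<mu>)\<leftarrow>Lp. riemann_zeta (of_nat n * s - \<mu>))"
    and H_zero: "\<And>p s. prime p \<Longrightarrow> Re s > 1 / real (Suc N) \<Longrightarrow> prime_den a b c (ln (real p)) s = 0 \<Longrightarrow> H s = 0"
    by (rule correction_product[OF abc, of N]) blast
  define D where "D = {s. Re s > 1 / real (Suc N)}"
  define X where "X = (\<lambda>(n, \<mu>). (1 + \<mu>) / of_nat n) ` (set Lp \<union> set Lm)"
  define G1 where "G1 = (\<lambda>s. H s * (\<Prod>(n, \<mu>)\<leftarrow>Lm. riemann_zeta (of_nat n * s - \<mu>)))"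
  define G2 where "G2 = (\<lambda>s. \<Prod>(n, \<mu>)\<leftarrow>Lp. riemann_zeta (of_nat n * s - \<mu>))"
  have inX: "s \<in> X" if "(n, \<mu>) \<in> set Lp \<union> set Lm" "of_nat n * s - \<mu> = 1" for n \<mu> s
  proof -
    have "s = (1 + \<mu>) / of_nat n" using that L[OF that(1)] by (simp add: field_simps)
    thus ?thesis using that(1) unfolding X_def by (intro image_eqI[of _ _ "(n, \<mu>)"]) auto
  qed
  show ?thesis
  proof (cases "s \<in> X")
    case True
    then obtain n \<mu> where n: "(n, \<mu>) \<in> set Lp \<union> set Lm" "s = (1 + \<mu>) / of_nat n" unfolding X_def by auto
    have "of_nat n * s - \<mu> = 1" using n L[OF n(1)] by simp
    thus ?thesis using that L[OF n(1)] by blast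
  next
    case False
    have "F s * G1 s = G2 s"
    proof (rule meromorphic_identity[OF F])
      show "open D" unfolding D_def by (rule open_Re_gt)
      show "connected D" unfolding D_def by (intro convex_connected convex_halfspace_Re_gt)
      show "finite X" by (simp add: X_def)
      show "G1 holomorphic_on D - X" unfolding G1_def using inX
        by (intro holomorphic_on_mult holomorphic_zeta_prod_list holomorphic_on_subset[OF holH]) (auto simp: D_def)
      show "G2 holomorphic_on D - X" unfolding G2_def using inX
        by (intro holomorphic_zeta_prod_list) auto
      have "1 / real (Suc N) \<le> 1" by simp
      hence "1 / real (Suc N) < Re 3" by (simp only: complex_Re_numeral)
      thus "3 \<in> D" by (simp only: D_def mem_Collect_eq)
      \<comment> \<open>The point 3 lies inside \<open>Re s > 2\<close>, where the identity of the
        correction product is available.\<close>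
      have "eventually (\<lambda>z. F z = euler_Z a b c z) (at 3)"
        using eq by (rule eventually_cosparse_imp_eventually_at) simp
      moreover have "eventually (\<lambda>z. z \<in> {s. Re s > 2} - {3}) (at 3)"
        by (intro eventually_at_in_open open_Re_gt) simp
      ultimately show "eventually (\<lambda>z. F z * G1 z = G2 z) (at 3)"
        by eventually_elim (use H_eq in \<open>simp add: G1_def G2_def\<close>)
    qed (use False s in \<open>auto simp: D_def\<close>)
    moreover have "G1 s = 0" using H_zero[OF s(3,2,4)] by (simp add: G1_def)
    ultimately have "G2 s = 0" by simp
    then obtain n \<mu> where n: "(n, \<mu>) \<in> set Lp" "riemann_zeta (of_nat n * s - \<mu>) = 0"
      unfolding G2_def by (auto simp: prod_list_zero_iff)
    have ne: "of_nat n * s - \<mu> \<noteq> 1" using inX[of n \<mu> s] n False by auto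
    have n': "0 < n" "n \<le> N" "\<mu> \<in> freqs a b c n" using L[of n \<mu>] n by auto
    \<comment> \<open>Since \<open>\<mu>\<close> is imaginary, this puts
      \<open>of_nat n * s - \<mu>\<close> into the domain of \<open>zeta_reg_eq\<close>.\<close>
    have "Re s > 0" using s(2) by (auto intro: less_trans[of 0 "1 / real (Suc N)"])
    hence "0 \<le> real n * Re s" by simp
    moreover have "Re (of_nat n * s - \<mu>) = real n * Re s" using Re_freqs[OF abc n'(3)] by simp
    ultimately have "Re (of_nat n * s - \<mu>) > -1" by linarith
    hence "zeta_reg (of_nat n * s - \<mu>) = 0" using zeta_reg_eq[OF _ ne] n(2) by simp
    thus ?thesis using that n' by blast
  qed
qed

section \<open>The Euler product for c = a + b\<close>

text \<open>For \<open>c = a + b\<close> the quadratic splits into the inverse Euler factors of the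
  two shifted zeta functions. On \<open>Re s > 1\<close> they do not vanish, so no default value
  intervenes.\<close>

lemma euler_Z_eq_zeta:
  assumes "Re a = 0" "Re b = 0" "Re s > 1"
  shows "euler_Z a b (a + b) s = riemann_zeta (s - a) * riemann_zeta (s - b)"
proof -
  let ?L = "[(1 :: nat, a), (1, b)]"
  let ?E = "\<lambda>m. \<Prod>p\<le>m. if prime p then poly (cyc_prod ?L (ln (real p))) (exp (- s * of_real (ln (real p)))) else 1"
  let ?F = "\<lambda>m. \<Prod>p\<le>m. if prime p then local_factor a b (a + b) p s else 1"
  have F: "?F \<longlonglongrightarrow> euler_Z a b (a + b) s"
    unfolding euler_Z_def using abs_convergent_euler_Z[of a b "a + b" s] assms
    by (intro convergent_prod_LIMSEQ abs_convergent_prod_imp_convergent_prod) auto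
  have E: "(\<lambda>m. (\<Prod>(n, \<mu>)\<leftarrow>?L. riemann_zeta (of_nat n * s - \<mu>)) * ?E m) \<longlonglongrightarrow> 1"
    using assms by (intro euler_product_cyc_prod) auto
  have "?F m * ?E m = 1" for m
    unfolding prod.distrib[symmetric]
  proof (intro prod.neutral ballI)
    fix p
    show "(if prime p then local_factor a b (a + b) p s else 1) *
      (if prime p then poly (cyc_prod ?L (ln (real p))) (exp (- s * of_real (ln (real p)))) else 1) = 1"
    proof (cases "prime p")
      case True
      define T where "T = exp (- s * of_real (ln (real p)))"
      have "norm T \<le> 2 powr (- 1)"
        using norm_prime_exp[OF True, of 1 s] assms unfolding T_def by linarith
      hence T: "norm T \<le> 1/2" by (simp add: powr_minus_divide)
      have "norm (poly (cyc_prod ?L (ln (real p))) T) \<ge> (1 - 1/2) ^ length ?L"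
        by (rule norm_poly_cyc_prod_ge[OF _ T]) (use assms in auto)
      hence nz: "poly (cyc_prod ?L (ln (real p))) T \<noteq> 0" by auto
      have "poly (cyc_prod ?L (ln (real p))) T = prime_den a b (a + b) (ln (real p)) s"
        unfolding poly_cyc_prod prime_den_def T_def[symmetric]
        by (simp add: exp_add power2_eq_square algebra_simps)
      thus ?thesis using True nz
        by (simp add: local_factor_eq_prime_den prime_gt_0_nat T_def)
    qed simp
  qed
  moreover have "(\<Prod>(n, \<mu>)\<leftarrow>?L. riemann_zeta (of_nat n * s - \<mu>)) = riemann_zeta (s - a) * riemann_zeta (s - b)"
    by simp
  ultimately have "?F m * ((\<Prod>(n, \<mu>)\<leftarrow>?L. riemann_zeta (of_nat n * s - \<mu>)) * ?E m) = 
      riemann_zeta (s - a) * riemann_zeta (s - b)" for m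
    by (metis (no_types, lifting) mult.left_commute mult.right_neutral)
  moreover have "(\<lambda>m. ?F m * ((\<Prod>(n, \<mu>)\<leftarrow>?L. riemann_zeta (of_nat n * s - \<mu>)) * ?E m)) \<longlonglongrightarrow> euler_Z a b (a + b) s * 1"
    by (intro tendsto_mult F E)
  ultimately have "(\<lambda>m::nat. riemann_zeta (s - a) * riemann_zeta (s - b)) \<longlonglongrightarrow> euler_Z a b (a + b) s * 1" by (simp only:)
  thus ?thesis using LIMSEQ_unique[OF tendsto_const] by (metis mult.right_neutral)
qed

section \<open>The counting argument\<close>

text \<open>The substitution \<open>w = of_nat n * s - \<mu>\<close> is injective and takes the
  points to zeros of \<open>zeta_reg\<close> of height at most \<open>Y\<close>, or to the pole,
  which accounts for the extra 1.\<close>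

lemma card_affine_zeros_le:
  assumes Z: "finite Z" "\<And>w. 0 < Re w \<Longrightarrow> \<bar>Im w\<bar> \<le> Y \<Longrightarrow> zeta_reg w = 0 \<Longrightarrow> w \<in> Z"
    and n: "n > 0" "Re \<mu> = 0" "real n * (t + 1) + norm \<mu> \<le> Y" "t \<ge> 0"
  defines "A \<equiv> {s. 0 < Re s \<and> t \<le> Im s \<and> Im s \<le> t + 1 \<and> 
      (of_nat n * s - \<mu> = 1 \<or> zeta_reg (of_nat n * s - \<mu>) = 0)}"
  shows "finite A" "card A \<le> card Z + 1"
proof -
  have sub: "A \<subseteq> (\<lambda>w. (w + \<mu>) / of_nat n) ` insert 1 Z"
  proof
    fix s assume s: "s \<in> A"
    define w where "w = of_nat n * s - \<mu>"
    have Re: "0 < Re w" using s n by (simp add: w_def A_def)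
    have "\<bar>Im w\<bar> \<le> real n * \<bar>Im s\<bar> + \<bar>Im \<mu>\<bar>"
      using abs_triangle_ineq4[of "real n * Im s" "Im \<mu>"] by (simp add: w_def abs_mult)
    also have "\<dots> \<le> real n * (t + 1) + norm \<mu>"
      using s n abs_Im_le_cmod[of \<mu>] by (intro add_mono mult_left_mono) (auto simp: A_def)
    finally have "\<bar>Im w\<bar> \<le> Y" using n(3) by linarith
    hence "w \<in> insert 1 Z" using Z(2)[OF Re] s by (auto simp: A_def w_def)
    moreover have "s = (w + \<mu>) / of_nat n" using n by (simp add: w_def)
    ultimately show "s \<in> (\<lambda>w. (w + \<mu>) / of_nat n) ` insert 1 Z" by blast
  qed
  show "finite A" using sub by (rule finite_subset) (use Z in auto)
  have "card A \<le> card ((\<lambda>w. (w + \<mu>) / of_nat n) ` insert 1 Z)" by (rule card_mono[OF _ sub]) (use Z in auto)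
  also have "\<dots> \<le> card (insert 1 Z)" by (rule card_image_le) (use Z in auto)
  also have "\<dots> \<le> card Z + 1" using Z by (simp add: card_insert_if)
  finally show "card A \<le> card Z + 1" .
qed

text \<open>More than \<open>j ^ 9\<close> distinct zeros of denominators compete with a supply of
  singularities and zeta zeros of order \<open>j ^ 8\<close>.\<close>

lemma frequency_sum_zero:
  assumes abc: "Re a = 0" "Re b = 0" "Re c = 0" and F: "F meromorphic_on UNIV"
    and eq: "\<forall>\<^sub>\<approx>s\<in>{s. Re s > 1}. F s = euler_Z a b c s"
  shows "a + b = c"
proof (rule ccontr)
  assume "a + b \<noteq> c"
  define d where "d = Im (c - a - b)"
  define e where "e = Im (a - b)"
  have d: "d \<noteq> 0" using \<open>a + b \<noteq> c\<close> abc by (auto simp: d_def complex_eq_iff)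
  define good where "good = (\<lambda>p::nat. prime p \<and> 1/2 \<le> (2 + 2 * cos (e * ln (real p))) * (1 - cos (2 * d * ln (real p))))"
  have ns: "\<not> summable (\<lambda>p. if good p then 1 / real p else 0)"
    unfolding good_def by (rule not_summable_prime_weight[OF d])
  have good_pos: "p > 0" if "good p" for p using that by (auto simp: good_def prime_gt_0_nat)

  define M where "M = norm a + norm b + norm c"
  \<comment> \<open>This height meets the lower bound on \<open>norm s\<close> in
    \<open>prime_den_zeros_separated\<close>; \<open>Q\<close> bounds the norm of the points in the
    box.\<close>
  define t where "t = 10 * (1 + norm a + norm b + norm c)"
  define Q where "Q = t + 3"
  define R where "R = (3 * Q + norm a + norm b + norm c)\<^sup>2 * 3"
  \<comment> \<open>With windows of length \<open>1 / R\<close>, two primes in the same window are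
    too close to share a zero.\<close>
  define \<eta> where "\<eta> = 1 / R"
  have M0: "M \<ge> 0" and t0: "t \<ge> 10" by (auto simp: M_def t_def)
  have R1: "R \<ge> 1"
  proof -
    have "1\<^sup>2 \<le> (3 * Q + norm a + norm b + norm c)\<^sup>2"
      using t0 by (intro power_mono) (auto simp: Q_def add_nonneg_nonneg intro: order_trans[of _ "3 * Q"])
    thus ?thesis by (simp add: R_def)
  qed
  have \<eta>: "0 < \<eta>" "\<eta> \<le> 1" using R1 by (auto simp: \<eta>_def)

  define box where "box = {s. 0 \<le> Re s \<and> Re s \<le> 1 \<and> t \<le> Im s \<and> Im s \<le> t + 1}"
  have "compact box"
  proof -
    have "box = cbox (Complex 0 t) (Complex 1 (t + 1))" by (auto simp: box_def in_cbox_complex_iff)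
    thus ?thesis by simp
  qed
  define B where "B = box \<inter> {w. \<not> F analytic_on {w}}"
  have finB: "finite B" unfolding B_def
    by (intro sparse_in_compact_finite \<open>compact box\<close> sparse_in_subset[OF meromorphic_on_imp_sparse_singularities[OF F]]) auto

  obtain C where C: "C > 0" 
    and Zfin: "\<And>Y. finite {w. 0 < Re w \<and> \<bar>Im w\<bar> \<le> real Y \<and> zeta_reg w = 0}"
    and Zcard: "\<And>Y. real (card {w. 0 < Re w \<and> \<bar>Im w\<bar> \<le> real Y \<and> zeta_reg w = 0}) \<le> C * (1 + real Y) ^ 4"
    by (rule zeta_reg_zeros_count) blast
  define Y0 where "Y0 = nat \<lceil>t + 1 + M\<rceil>"
  \<comment> \<open>\<open>W\<close> collects the coefficients of the final estimate, so that
    \<open>W \<le> j\<close> turns the bound \<open>W * j ^ 8\<close> into \<open>j ^ 9\<close>. The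
    other term required of \<open>j\<close> makes the logarithms at least
    \<open>2 * pi\<close>.\<close>
  define W where "W = real (card B) + 41 ^ 4 + 41 ^ 8 * C * (1 + real Y0) ^ 4"
  obtain j where j: "j \<ge> nat \<lceil>W\<rceil> + nat \<lceil>2 * pi / \<eta>\<rceil> + 1" 
    and big: "card {p. 0 < p \<and> ln (real p) < real (Suc j) * \<eta> \<and> real j * \<eta> \<le> ln (real p) \<and> good p} > j ^ 9"
    by (rule ln_interval_many[OF ns good_pos \<eta>(1)], assumption, rule that)
  define P where "P = {p. 0 < p \<and> ln (real p) < real (Suc j) * \<eta> \<and> real j * \<eta> \<le> ln (real p) \<and> good p}"
  have j1: "j \<ge> 1" and jW: "real j \<ge> W" and jpi: "real j \<ge> 2 * pi / \<eta>" using j by linarith+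
  \<comment> \<open>The zeros have real part at least \<open>1 / (20 * ln p)\<close> and
    \<open>ln p < Suc j\<close>, so this \<open>N\<close> moves the line
    \<open>Re s = 1 / Suc N\<close> to their left.\<close>
  define N where "N = 20 * Suc j"

  define is_zero where "is_zero = (\<lambda>p s. prime_den a b c (ln (real p)) s = 0 \<and> t \<le> Im s \<and> Im s \<le> t + 1 \<and>
     1 / (20 * ln (real p)) \<le> Re s \<and> Re s \<le> 2 / ln (real p) \<and> (norm (exp (- s * of_real (ln (real p)))))\<^sup>2 \<le> 9/10)"
  have "\<exists>s. is_zero p s" if p: "p \<in> P" for p
  proof -
    have "2 * pi \<le> real j * \<eta>" using jpi \<eta> by (simp add: field_simps)
    hence 1: "2 * pi \<le> ln (real p)" using p by (simp add: P_def)
    have 2: "1/2 \<le> (2 + 2 * cos (Im (a - b) * ln (real p))) * (1 - cos (2 * Im (c - a - b) * ln (real p)))"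
      using p unfolding P_def good_def d_def e_def by blast
    show ?thesis unfolding is_zero_def by (rule prime_den_zero[OF abc 1 2, of t]) blast
  qed
  then obtain z where "\<And>p. p \<in> P \<Longrightarrow> is_zero p (z p)" by metis
  hence z: "\<And>p. p \<in> P \<Longrightarrow> prime_den a b c (ln (real p)) (z p) = 0"
    and Im_z: "\<And>p. p \<in> P \<Longrightarrow> t \<le> Im (z p)" "\<And>p. p \<in> P \<Longrightarrow> Im (z p) \<le> t + 1"
    and Re_z: "\<And>p. p \<in> P \<Longrightarrow> 1 / (20 * ln (real p)) \<le> Re (z p)" "\<And>p. p \<in> P \<Longrightarrow> Re (z p) \<le> 2 / ln (real p)"
    and z_small: "\<And>p. p \<in> P \<Longrightarrow> (norm (exp (- z p * of_real (ln (real p)))))\<^sup>2 \<le> 9/10"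
    unfolding is_zero_def by blast+
  have ln_p: "2 \<le> ln (real p)" "ln (real p) < real (Suc j)" if "p \<in> P" for p
  proof -
    have "2 * pi \<le> real j * \<eta>" using jpi \<eta> by (simp add: field_simps)
    thus "2 \<le> ln (real p)" using that pi_gt3 by (simp add: P_def)
    have "ln (real p) < real (Suc j) * \<eta>" using that by (simp add: P_def)
    also have "\<dots> \<le> real (Suc j) * 1" using \<eta> by (intro mult_left_mono) auto
    finally show "ln (real p) < real (Suc j)" by simp
  qed
  have Re_pos: "1 / real (Suc N) < Re (z p)" if p: "p \<in> P" for p
  proof -
    have "20 * ln (real p) < real (Suc N)" using ln_p[OF p] by (simp add: N_def)
    hence "1 / real (Suc N) < 1 / (20 * ln (real p))" using ln_p(1)[OF p] by (intro divide_strict_left_mono) auto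
    thus ?thesis using Re_z(1)[OF p] by linarith
  qed
  have Re_0: "0 < Re (z p)" if p: "p \<in> P" for p
    using Re_pos[OF p] by (rule less_trans[rotated]) simp
  have Re_1: "Re (z p) \<le> 1" if p: "p \<in> P" for p
  proof -
    have "2 / ln (real p) \<le> 1" using ln_p(1)[OF p] by simp
    thus ?thesis using Re_z(2)[OF p] by linarith
  qed
  have inj: "inj_on z P"
  proof (rule inj_onI, rule ccontr)
    fix p q assume pq: "p \<in> P" "q \<in> P" "z p = z q" "p \<noteq> q"
    have "norm (z p) \<le> \<bar>Re (z p)\<bar> + \<bar>Im (z p)\<bar>" by (rule cmod_le)
    also have "\<dots> \<le> Q" using Re_0[OF pq(1)] Re_1[OF pq(1)] Im_z[OF pq(1)] t0 by (simp add: Q_def)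
    finally have nQ: "norm (z p) \<le> Q" .
    have nt: "10 * (1 + norm a + norm b + norm c) \<le> norm (z p)"
      using Im_z(1)[OF pq(1)] abs_Im_le_cmod[of "z p"] unfolding t_def by linarith
    have "0 < p" "0 < q" using pq by (auto simp: P_def)
    hence "ln (real p) \<noteq> ln (real q)" using pq(4) by simp
    hence "1 \<le> R * \<bar>ln (real p) - ln (real q)\<bar>" unfolding R_def
      using pq z[of p] z[of q] z_small[of p] Re_0[of p] ln_p(1)[of p] ln_p(1)[of q] nQ nt
      by (intro prime_den_zeros_separated[OF abc]) auto
    moreover have "\<bar>ln (real p) - ln (real q)\<bar> < \<eta>"
      using pq by (simp add: P_def abs_less_iff algebra_simps)
    hence "R * \<bar>ln (real p) - ln (real q)\<bar> < R * \<eta>" using R1 by (intro mult_strict_left_mono) auto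
    hence "R * \<bar>ln (real p) - ln (real q)\<bar> < 1" using R1 by (simp add: \<eta>_def)
    ultimately show False by simp
  qed

  define Y where "Y = N * Y0"
  define Z where "Z = {w. 0 < Re w \<and> \<bar>Im w\<bar> \<le> real Y \<and> zeta_reg w = 0}"
  \<comment> \<open>An index holds the multiple \<open>n\<close> of \<open>s\<close> and the three
    coefficients of a frequency: four parameters, hence the fourth power of
    \<open>N\<close>.\<close>
  define I where "I = {1..N} \<times> {..N} \<times> {..N} \<times> {..N}"
  define \<mu> where "\<mu> = (\<lambda>(x::nat, y::nat, w::nat). of_nat x * a + of_nat y * b + of_nat w * c)"
  define A where "A = (\<lambda>(n::nat, v). {s. 0 < Re s \<and> t \<le> Im s \<and> Im s \<le> t + 1 \<and> 
      (of_nat n * s - \<mu> v = 1 \<or> zeta_reg (of_nat n * s - \<mu> v) = 0)})"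
  have A: "finite (A i)" "card (A i) \<le> card Z + 1" if i: "i \<in> I" for i
  proof -
    obtain n x y w where i': "i = (n, x, y, w)" by (cases i)
    hence n: "0 < n" "n \<le> N" "x \<le> N" "y \<le> N" "w \<le> N" using i by (auto simp: I_def)
    have "\<mu> (x, y, w) \<in> freqs a b c N" using n by (auto simp: \<mu>_def intro: freqsI)
    hence mu: "norm (\<mu> (x, y, w)) \<le> real N * M" "Re (\<mu> (x, y, w)) = 0"
      using norm_freqs_le Re_freqs[OF abc] by (auto simp: M_def)
    have "real n * (t + 1) + norm (\<mu> (x, y, w)) \<le> real N * (t + 1) + real N * M"
      using n t0 mu by (intro add_mono mult_right_mono) auto
    also have "\<dots> = real N * (t + 1 + M)" by (simp add: algebra_simps)
    also have "\<dots> \<le> real N * real Y0" unfolding Y0_def by (intro mult_left_mono) linarith+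
    finally have le: "real n * (t + 1) + norm (\<mu> (x, y, w)) \<le> real Y" by (simp add: Y_def)
    have finZ: "finite Z" unfolding Z_def by (rule Zfin)
    have inZ: "w \<in> Z" if "0 < Re w" "\<bar>Im w\<bar> \<le> real Y" "zeta_reg w = 0" for w
      using that by (simp add: Z_def)
    have t: "0 \<le> t" using t0 by simp
    have Ai: "A i = {s. 0 < Re s \<and> t \<le> Im s \<and> Im s \<le> t + 1 \<and> 
      (of_nat n * s - \<mu> (x, y, w) = 1 \<or> zeta_reg (of_nat n * s - \<mu> (x, y, w)) = 0)}"
      by (simp only: A_def i' prod.case)
    show "finite (A i)" "card (A i) \<le> card Z + 1"
      unfolding Ai by (rule card_affine_zeros_le[OF finZ inZ n(1) mu(2) le t]; assumption)+
  qed
  have sub: "z ` P \<subseteq> B \<union> (\<Union>i\<in>I. A i)"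
  proof (intro image_subsetI)
    fix p assume p: "p \<in> P"
    show "z p \<in> B \<union> (\<Union>i\<in>I. A i)"
    proof (cases "F analytic_on {z p}")
      case False
      thus ?thesis using p Re_0[OF p] Re_1[OF p] Im_z[OF p] by (auto simp: B_def box_def)
    next
      case True
      have "prime p" using p by (simp add: P_def good_def)
      with prime_den_zero_cases[OF abc F eq True Re_pos[OF p] _ z[OF p]]
      obtain n \<nu> where n: "0 < n" "n \<le> N" "\<nu> \<in> freqs a b c n" 
        "of_nat n * z p - \<nu> = 1 \<or> zeta_reg (of_nat n * z p - \<nu>) = 0" by blast
      then obtain x y w where v: "\<nu> = \<mu> (x, y, w)" "x \<le> n" "y \<le> n" "w \<le> n"
        unfolding freqs_def \<mu>_def by auto
      have "z p \<in> A (n, x, y, w)" using n v(1) Re_0[OF p] Im_z[OF p] by (simp add: A_def)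
      moreover have "(n, x, y, w) \<in> I" using n v by (simp add: I_def)
      ultimately show ?thesis by blast
    qed
  qed
  have cardI: "card I \<le> (N + 1) ^ 4"
    by (simp add: I_def card_cartesian_product eval_nat_numeral)
  have finI: "finite I" by (simp add: I_def)
  have "card P = card (z ` P)" using inj by (simp add: card_image)
  also have "\<dots> \<le> card (B \<union> (\<Union>i\<in>I. A i))"
    by (rule card_mono[OF _ sub]) (use finB finI A in auto)
  also have "\<dots> \<le> card B + card (\<Union>i\<in>I. A i)" by (rule card_Un_le)
  also have "card (\<Union>i\<in>I. A i) \<le> (\<Sum>i\<in>I. card (A i))" by (rule card_UN_le[OF finI])
  also have "(\<Sum>i\<in>I. card (A i)) \<le> (\<Sum>i\<in>I. card Z + 1)" using A by (intro sum_mono)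
  also have "\<dots> = card I * (card Z + 1)" by simp
  also have "\<dots> \<le> (N + 1) ^ 4 * (card Z + 1)" using cardI by (intro mult_right_mono) auto
  finally have "card P \<le> card B + (N + 1) ^ 4 * (card Z + 1)" by simp
  hence "real (card P) \<le> real (card B + (N + 1) ^ 4 * (card Z + 1))" by (rule of_nat_mono)
  also have "\<dots> = real (card B) + (real N + 1) ^ 4 * (real (card Z) + 1)" by (simp add: algebra_simps)
  \<comment> \<open>From \<open>N = 20 * Suc j\<close> and \<open>j \<ge> 1\<close> one gets
    \<open>N + 1 \<le> 41 * j\<close>. The indices and the zeros up to height \<open>N * Y0\<close>
    each contribute a fourth power of \<open>j\<close>.\<close>
  also have "\<dots> \<le> real (card B) + (41 * real j) ^ 4 * (C * ((1 + real Y0) * (41 * real j)) ^ 4 + 1)"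
  proof (intro add_mono mult_mono power_mono order_refl)
    show N: "real N + 1 \<le> 41 * real j" using j1 by (simp add: N_def)
    have "real (card Z) \<le> C * (1 + real Y) ^ 4" unfolding Z_def by (rule Zcard)
    also have "\<dots> \<le> C * ((1 + real Y0) * (41 * real j)) ^ 4"
    proof (intro mult_left_mono power_mono)
      have "1 + real Y \<le> (1 + real Y0) * (real N + 1)" by (simp add: Y_def algebra_simps)
      also have "\<dots> \<le> (1 + real Y0) * (41 * real j)" using N by (intro mult_left_mono) auto
      finally show "1 + real Y \<le> (1 + real Y0) * (41 * real j)" .
    qed (use C in auto)
    finally show "real (card Z) \<le> C * ((1 + real Y0) * (41 * real j)) ^ 4" .
  qed (use C in auto)
  also have "\<dots> = real (card B) + 41 ^ 4 * real j ^ 4 + 41 ^ 8 * C * (1 + real Y0) ^ 4 * real j ^ 8"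
  proof -
    have "real j ^ 8 = real j ^ 4 * real j ^ 4" by (simp flip: power_add)
    thus ?thesis unfolding power_mult_distrib by (simp add: algebra_simps)
  qed
  also have "\<dots> \<le> real (card B) * real j ^ 8 + 41 ^ 4 * real j ^ 8 + 41 ^ 8 * C * (1 + real Y0) ^ 4 * real j ^ 8"
  proof -
    have "real (card B) * 1 \<le> real (card B) * real j ^ 8" using j1 by (intro mult_left_mono) auto
    moreover have "41 ^ 4 * real j ^ 4 \<le> 41 ^ 4 * real j ^ 8" 
      using j1 by (intro mult_left_mono power_increasing) auto
    ultimately show ?thesis by linarith
  qed
  also have "\<dots> = W * real j ^ 8" by (simp add: W_def algebra_simps)
  also have "\<dots> \<le> real j * real j ^ 8" using jW by (intro mult_right_mono) auto
  also have "\<dots> = real (j ^ 9)" by (simp add: eval_nat_numeral)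
  finally have "card P \<le> j ^ 9" by (simp only: of_nat_le_iff)
  thus False using big unfolding P_def by simp
qed

text \<open>A meromorphic \<open>F\<close> may take any values at its singularities, and
  \<open>euler_Z\<close> has the dummy value 0 at its poles. Equalities involving \<open>F\<close>
  are therefore stated off a sparse set, with \<open>\<forall>\<^sub>\<approx>\<close>, whereas the
  one between \<open>euler_Z\<close> and zeta holds at every point of
  \<open>Re s > 1\<close>.\<close>

theorem theoremA:
  fixes a b c :: complex and F :: "complex \<Rightarrow> complex"
  assumes "Re a = 0" and "Re b = 0" and "Re c = 0"
    and "F meromorphic_on UNIV"
    and "\<forall>\<^sub>\<approx>s\<in>{s. Re s > 1}. F s = euler_Z a b c s"
  shows "a + b = c \<and>
    (\<forall>s. Re s > 1 \<longrightarrow> euler_Z a b c s = riemann_zeta (s - a) * riemann_zeta (s - b)) \<and>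
    (\<forall>\<^sub>\<approx>s\<in>UNIV. F s = riemann_zeta (s - a) * riemann_zeta (s - b))"
proof (intro conjI allI impI)
  show c: "a + b = c" by (rule frequency_sum_zero[OF assms])
  show Z: "euler_Z a b c s = riemann_zeta (s - a) * riemann_zeta (s - b)" if "Re s > 1" for s
    using euler_Z_eq_zeta[OF assms(1,2) that] c by simp
  define X where "X = {1 + a, 1 + b}"
  have "(riemann_zeta \<circ> (\<lambda>s. s - d)) holomorphic_on UNIV - X" if "d \<in> {a, b}" for d
    by (rule holomorphic_on_compose_gen[OF _ holomorphic_riemann_zeta])
       (use that in \<open>auto intro!: holomorphic_intros simp: X_def algebra_simps\<close>)
  hence hol: "(\<lambda>s. riemann_zeta (s - a) * riemann_zeta (s - b)) holomorphic_on UNIV - X"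
    by (intro holomorphic_on_mult) (auto simp: o_def)
  have "eventually (\<lambda>s. F s = euler_Z a b c s) (at 3)"
    using assms(5) by (rule eventually_cosparse_imp_eventually_at) simp
  moreover have "eventually (\<lambda>s. s \<in> {s. Re s > 1} - {3}) (at 3)"
    by (intro eventually_at_in_open open_Re_gt) simp
  ultimately have ev: "eventually (\<lambda>s. F s * 1 = riemann_zeta (s - a) * riemann_zeta (s - b)) (at 3)"
    by eventually_elim (simp add: Z)
  \<comment> \<open>The identity theorem carries the equality from a punctured neighbourhood of 3 to
    every point where \<open>F\<close> is analytic and neither zeta factor has its pole.\<close>
  have eq: "F s * 1 = riemann_zeta (s - a) * riemann_zeta (s - b)" if "s \<notin> X" "F analytic_on {s}" for s
    by (rule meromorphic_identity[OF assms(4) open_UNIV connected_UNIV _ _ hol _ ev])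
       (use that in \<open>auto simp: X_def\<close>)
  have "\<forall>\<^sub>\<approx>s\<in>UNIV. s \<notin> X" by (intro eventually_not_in_cosparse finite_imp_sparse) (simp add: X_def)
  thus "\<forall>\<^sub>\<approx>s\<in>UNIV. F s = riemann_zeta (s - a) * riemann_zeta (s - b)"
    using meromorphic_on_imp_analytic_cosparse[OF assms(4)] by eventually_elim (use eq in simp)
qed

end
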